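(* Let $F_n$ be the free group of rank $n$, $\varphi\in\mathrm{Aut}(F_n)$ and $G=F_n\rtimes_\varphi\mathbb{Z}$. If all groups $\overline{G}_k=(F_n^{ab})^{\otimes k}\rtimes_{\overline{\varphi}_k}\mathbb{Z}$, $k\ge1$, are residually nilpotent, then $\gamma_{\omega^2}(G)=1$. Moreover, in this situation, if $G$ is not residually nilpotent, then the length of the lower central series of $G$ is equal to $\omega^2$.
   Context: The transfinite lower central series of $G$: $\gamma_1(G)=G$, $\gamma_{\alpha+1}(G)=[\gamma_\alpha(G),G]$, and $\gamma_\alpha(G)=\bigcap_{\beta<\alpha}\gamma_\beta(G)$ for limit ordinals $\alpha$. The length of the lower central series is the smallest ordinal $\alpha$ with $\gamma_\alpha(G)=\gamma_{\alpha+1}(G)$. $G$ is residually nilpotent if $\gamma_\omega(G)=1$. $F_n^{ab}=F_n/\gamma_2(F_n)$, $\overline{\varphi}$ is the automorphism of $F_n^{ab}$ induced by $\varphi$, and $\overline{\varphi}_k=\overline{\varphi}^{\otimes k}$ is the induced automorphism of the $k$-fold tensor power $(F_n^{ab})^{\otimes k}$ over $\mathbb{Z}$. For an automorphism $\psi$ of a group $M$, $M\rtimes_\psi\mathbb{Z}$ is the semi-direct product in which a generator $t$ of $\mathbb{Z}$ acts by $t^{-1}mt=\psi(m)$. *)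

theory Defs
  imports "HOL-Algebra.Algebra" "HOL-Algebra.Bij" "HOL-Library.Countable"
begin

section \<open>Countable ordinals\<close>

text \<open>
  Order types of well-orders on subsets of \<open>nat\<close>, ordered by embeddability as initial segments.
\<close>

quotient_type ordinal = "nat rel" / partial: "\<lambda>r s. r =o s"
proof (rule part_equivpI)
  show "\<exists>r :: nat rel. r =o r"
    using ordIso_reflexive[OF natLeq_Well_order] by blast
qed (auto intro: sympI transpI ordIso_symmetric ordIso_transitive)

lemma abs_rep_ordinal: "abs_ordinal (rep_ordinal \<alpha>) = \<alpha>"
  by (rule Quotient3_abs_rep[OF Quotient3_ordinal])

lemma rep_ordinal_refl: "rep_ordinal \<alpha> =o rep_ordinal \<alpha>"
  by (rule Quotient3_rep_reflp[OF Quotient3_ordinal])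

instantiation ordinal :: wellorder
begin

lift_definition less_eq_ordinal :: "ordinal \<Rightarrow> ordinal \<Rightarrow> bool" is "\<lambda>r s. r \<le>o s"
proof -
  fix r s r' s' :: "nat rel"
  assume "r =o s" "r' =o s'"
  note * = this
  show "(r \<le>o r') = (s \<le>o s')"
    using ordIso_ordLeq_trans[OF ordIso_symmetric[OF *(1)]] ordIso_ordLeq_trans[OF *(1)]
      ordLeq_ordIso_trans[OF _ ordIso_symmetric[OF *(2)]] ordLeq_ordIso_trans[OF _ *(2)] by blast
qed

lift_definition less_ordinal :: "ordinal \<Rightarrow> ordinal \<Rightarrow> bool" is "\<lambda>r s. r <o s"
proof -
  fix r s r' s' :: "nat rel"
  assume "r =o s" "r' =o s'"
  note * = this
  show "(r <o r') = (s <o s')"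
    using ordIso_ordLess_trans[OF ordIso_symmetric[OF *(1)]] ordIso_ordLess_trans[OF *(1)]
      ordLess_ordIso_trans[OF _ ordIso_symmetric[OF *(2)]] ordLess_ordIso_trans[OF _ *(2)] by blast
qed

instance
proof
  fix x y z :: ordinal
  have le: "\<alpha> \<le> \<beta> \<longleftrightarrow> rep_ordinal \<alpha> \<le>o rep_ordinal \<beta>" for \<alpha> \<beta> :: ordinal
    by (rule less_eq_ordinal.abs_eq[OF rep_ordinal_refl rep_ordinal_refl, unfolded abs_rep_ordinal])
  have less: "\<alpha> < \<beta> \<longleftrightarrow> rep_ordinal \<alpha> <o rep_ordinal \<beta>" for \<alpha> \<beta> :: ordinal
    by (rule less_ordinal.abs_eq[OF rep_ordinal_refl rep_ordinal_refl, unfolded abs_rep_ordinal])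
  have wo: "Well_order (rep_ordinal \<alpha>)" for \<alpha> :: ordinal
    using ordIso_Well_order_simp[OF rep_ordinal_refl] by (rule conjunct1)
  show total: "x \<le> y \<or> y \<le> x"
    unfolding le by (rule ordLeq_total[OF wo wo])
  show "x < y \<longleftrightarrow> x \<le> y \<and> \<not> y \<le> x"
    unfolding le less not_ordLeq_iff_ordLess[OF wo wo]
    using ordLess_imp_ordLeq by iprover
  show "x \<le> x"
    unfolding le by (rule ordLeq_reflexive[OF wo])
  show "x \<le> y \<Longrightarrow> y \<le> z \<Longrightarrow> x \<le> z"
    unfolding le by (rule ordLeq_transitive)
  show "x = y" if "x \<le> y" "y \<le> x"
  proof -
    have "rep_ordinal x =o rep_ordinal y"
      using that unfolding le ordIso_iff_ordLeq by (rule conjI)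
    then show ?thesis
      by (rule iffD1[OF Quotient3_rel_rep[OF Quotient3_ordinal]])
  qed
next
  fix P :: "ordinal \<Rightarrow> bool" and a
  assume *: "\<And>x. (\<And>y. y < x \<Longrightarrow> P y) \<Longrightarrow> P x"
  define Q where "Q r \<longleftrightarrow> (r =o r \<longrightarrow> P (abs_ordinal r))" for r
  have "Q r" for r
  proof (induction r rule: wf_induct_rule[OF wf_ordLess])
    case (1 r)
    show ?case
      unfolding Q_def
    proof (rule impI, rule *)
      fix y assume r: "r =o r" and y: "y < abs_ordinal r"
      have "rep_ordinal y <o r"
        using y less_ordinal.abs_eq[OF rep_ordinal_refl[of y] r] unfolding abs_rep_ordinal by (rule iffD1[rotated])
      then have "Q (rep_ordinal y)"
        by (rule 1)
      then show "P y"
        unfolding Q_def abs_rep_ordinal using rep_ordinal_refl by (rule mp)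
    qed
  qed
  from this[of "rep_ordinal a"] show "P a"
    unfolding Q_def abs_rep_ordinal using rep_ordinal_refl by (rule mp)
qed

end

lemma ordinal_no_top: "\<exists>\<beta>. \<alpha> < (\<beta> :: ordinal)"
proof -
  define r where "r = rep_ordinal \<alpha>"
  have r: "Well_order r"
    unfolding r_def using ordIso_Well_order_simp[OF rep_ordinal_refl] by (rule conjunct1)
  define r' where "r' = dir_image r Suc"
  define top where "top = {(0 :: nat, 0 :: nat)}"
  define s where "s = r' \<union>o top"
  have r': "Well_order r'" "r =o r'"
    unfolding r'_def by (auto intro: Well_order_dir_image[OF r] dir_image_ordIso[OF r])
  have Field_r': "Field r' = Suc ` Field r"
    unfolding r'_def by (rule dir_image_Field)
  have Field_top: "Field top = {0}"
    by (simp add: top_def)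
  have "Well_order top"
    unfolding top_def by (simp add: well_order_on_def linear_order_on_def partial_order_on_def
        preorder_on_def refl_on_def trans_def antisym_def total_on_def Field_def)
  then have s: "Well_order s"
    unfolding s_def by (intro Osum_Well_order r') (auto simp: Field_r' Field_top)
  have in_s: "(x, y) \<in> s \<longleftrightarrow> (x, y) \<in> r' \<or> y = 0 \<and> (x = 0 \<or> x \<in> Field r')" for x y
    by (auto simp: s_def Osum_def top_def)
  have "0 \<notin> Field r'"
    by (auto simp: Field_r')
  then have "underS s 0 = Field r'"
    by (auto simp: underS_def in_s Field_def)
  moreover have "Restr s (Field r') = r'"
    using \<open>0 \<notin> Field r'\<close> by (auto simp: in_s Field_def)
  moreover have "Field s \<noteq> {}"
    using FieldI1[of 0 0 s] in_s[of 0 0] by blast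
  ultimately have "r' <o s"
    using underS_Restr_ordLess[OF s, of 0] by simp
  then have "r <o s"
    using r'(2) by (rule ordIso_ordLess_trans[rotated])
  moreover have "s =o s"
    by (rule ordIso_reflexive[OF s])
  ultimately have "\<alpha> < abs_ordinal s"
    using less_ordinal.abs_eq[OF rep_ordinal_refl] by (simp add: r_def abs_rep_ordinal)
  then show ?thesis ..
qed

definition osucc :: "ordinal \<Rightarrow> ordinal"
  where "osucc \<alpha> = (LEAST \<beta>. \<alpha> < \<beta>)"

lemma osucc_le_iff: "osucc \<alpha> \<le> \<beta> \<longleftrightarrow> \<alpha> < \<beta>"
proof
  have "\<alpha> < osucc \<alpha>"
    unfolding osucc_def using ordinal_no_top by (rule LeastI_ex)
  then show "osucc \<alpha> \<le> \<beta> \<Longrightarrow> \<alpha> < \<beta>"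
    by simp
qed (simp add: osucc_def Least_le)

lemma less_osucc: "\<alpha> < osucc \<alpha>"
  using osucc_le_iff by blast

lemma osucc_inject: "osucc \<alpha> = osucc \<beta> \<longleftrightarrow> \<alpha> = \<beta>"
  by (metis less_osucc linorder_neqE not_less osucc_le_iff)

instantiation ordinal :: "{zero, one}"
begin

definition "(0 :: ordinal) = (LEAST \<alpha>. True)"

definition "(1 :: ordinal) = osucc 0"

instance ..

end

text \<open>The order type of a well-order on (a subset of) a countable type; junk for other relations.\<close>

definition order_type :: "'a :: countable rel \<Rightarrow> ordinal"
  where "order_type r = abs_ordinal (dir_image r to_nat)"

lemma order_type_Well_order:
  assumes "Well_order r"
  shows "rep_ordinal (order_type r) =o r"
proof -
  have *: "r =o dir_image r to_nat"
    by (intro dir_image_ordIso assms) (simp add: inj_on_def)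
  then have "dir_image r to_nat =o dir_image r to_nat"
    using ordIso_symmetric ordIso_transitive by blast
  then have "rep_ordinal (order_type r) =o dir_image r to_nat"
    unfolding order_type_def by (rule Quotient3_rep_abs[OF Quotient3_ordinal])
  with * show ?thesis
    using ordIso_symmetric ordIso_transitive by blast
qed

lemma Well_orderI_wellorder:
  fixes f :: "'a \<Rightarrow> 'b :: wellorder" and g :: "'a \<Rightarrow> 'c :: wellorder"
  assumes "inj (\<lambda>x. (f x, g x))"
  shows "Well_order {(x, y). f x < f y \<or> f x = f y \<and> g x \<le> g y}" (is "Well_order ?r")
proof -
  have F: "Field ?r = UNIV"
    by (auto simp: Field_def)
  have "?r - Id \<subseteq> inv_image ({(x, y). x < y} <*lex*> {(x, y). x < y}) (\<lambda>x. (f x, g x))"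
    using assms by (auto simp: inj_def order.order_iff_strict)
  then have "wf (?r - Id)"
    by (rule wf_subset[rotated]) (intro wf_inv_image wf_lex_prod wf)
  moreover have "antisym ?r"
    using assms by (auto simp: antisym_def inj_def)
  moreover have "refl_on UNIV ?r" "trans ?r" "total_on UNIV ?r"
    by (auto simp: refl_on_def trans_def total_on_def)
  ultimately show ?thesis
    by (simp add: well_order_on_def linear_order_on_def partial_order_on_def preorder_on_def F)
qed

definition omega :: ordinal
  where "omega = order_type {(m :: nat, n). m \<le> n}"

text \<open>\<open>\<omega>\<^sup>2 = \<omega> \<cdot> \<omega>\<close> is the order type of the lexicographic order on pairs of natural numbers.\<close>

definition omega_squared :: ordinal
  where "omega_squared = order_type {((a :: nat, b :: nat), (c, d)). a < c \<or> a = c \<and> b \<le> d}"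

lemma Well_order_omega: "Well_order {(m :: nat, n). m \<le> n}"
  using natLeq_Well_order by (simp add: natLeq_def)

lemma Well_order_omega_squared:
  "Well_order {((a :: nat, b :: nat), (c, d)). a < c \<or> a = c \<and> b \<le> d}"
  using Well_orderI_wellorder[of "fst :: nat \<times> nat \<Rightarrow> nat" snd]
  by (simp add: case_prod_unfold)


section \<open>Transfinite lower central series\<close>

definition commutator_subgroup :: "('a, 'b) monoid_scheme \<Rightarrow> 'a set \<Rightarrow> 'a set \<Rightarrow> 'a set"
  where "commutator_subgroup G H K =
    generate G (\<Union>h\<in>H. \<Union>k\<in>K. {h \<otimes>\<^bsub>G\<^esub> k \<otimes>\<^bsub>G\<^esub> inv\<^bsub>G\<^esub> h \<otimes>\<^bsub>G\<^esub> inv\<^bsub>G\<^esub> k})"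

text \<open>The series starts at index 1; the value at index 0 is a dummy.\<close>

function lower_central :: "('a, 'b) monoid_scheme \<Rightarrow> ordinal \<Rightarrow> 'a set"
  where "lower_central G \<alpha> =
    (if \<alpha> \<le> 1 then carrier G
     else if \<exists>\<beta>. \<alpha> = osucc \<beta>
       then commutator_subgroup G (lower_central G (THE \<beta>. \<alpha> = osucc \<beta>)) (carrier G)
     else (\<Inter>\<beta>\<in>{1..<\<alpha>}. lower_central G \<beta>))"
  by auto
termination
proof (relation "inv_image {(\<alpha>, \<beta>). \<alpha> < \<beta>} snd")
  show "((G, THE \<beta>. \<alpha> = osucc \<beta>), G, \<alpha>) \<in> inv_image {(\<alpha>, \<beta>). \<alpha> < \<beta>} snd"
    if "\<exists>\<beta>. \<alpha> = osucc \<beta>" for G :: "('a, 'b) monoid_scheme" and \<alpha>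
    using that by (auto simp: osucc_inject less_osucc)
qed (auto intro: wf)

declare lower_central.simps [simp del]

lemma lower_central_1: "lower_central G 1 = carrier G"
  by (simp add: lower_central.simps)

lemma lower_central_osucc:
  assumes "1 \<le> \<alpha>"
  shows "lower_central G (osucc \<alpha>) = commutator_subgroup G (lower_central G \<alpha>) (carrier G)"
proof -
  have "\<not> osucc \<alpha> \<le> 1"
    using assms less_osucc[of \<alpha>] by simp
  then show ?thesis
    by (subst lower_central.simps) (auto simp: osucc_inject)
qed

lemma lower_central_limit:
  assumes "1 \<le> \<alpha>" and "\<And>\<beta>. \<beta> < \<alpha> \<Longrightarrow> osucc \<beta> < \<alpha>"
  shows "lower_central G \<alpha> = (\<Inter>\<beta>\<in>{1..<\<alpha>}. lower_central G \<beta>)"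
proof -
  have *: "\<nexists>\<beta>. \<alpha> = osucc \<beta>"
    using assms(2) less_osucc by blast
  then have "\<not> \<alpha> \<le> 1"
    using assms(1) by (auto simp: one_ordinal_def)
  with * show ?thesis
    by (subst lower_central.simps) simp
qed

definition residually_nilpotent :: "('a, 'b) monoid_scheme \<Rightarrow> bool"
  where "residually_nilpotent G \<longleftrightarrow> lower_central G omega = {\<one>\<^bsub>G\<^esub>}"

text \<open>
  The minimum over all ordinals is the minimum over the countable ones as soon as the series is
  stationary at some countable ordinal, in particular for countable groups.
\<close>

definition lower_central_length :: "('a, 'b) monoid_scheme \<Rightarrow> ordinal"
  where "lower_central_length G =
    (LEAST \<alpha>. 1 \<le> \<alpha> \<and> lower_central G \<alpha> = lower_central G (osucc \<alpha>))"


section \<open>Free groups\<close>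

text \<open>
  A letter \<open>(x, True)\<close> stands for the generator \<open>x\<close> and \<open>(x, False)\<close> for its inverse. The
  elements of the free group are the freely reduced words.
\<close>

type_synonym 'a letter = "'a \<times> bool"

definition letter_inv :: "'a letter \<Rightarrow> 'a letter"
  where "letter_inv l = (fst l, \<not> snd l)"

definition reduced :: "'a letter list \<Rightarrow> bool"
  where "reduced w \<longleftrightarrow> successively (\<lambda>a b. b \<noteq> letter_inv a) w"

definition reduced_Cons :: "'a letter \<Rightarrow> 'a letter list \<Rightarrow> 'a letter list"
  where "reduced_Cons a w =
    (case w of [] \<Rightarrow> [a] | b # v \<Rightarrow> if b = letter_inv a then v else a # w)"

definition free_group :: "'a set \<Rightarrow> 'a letter list monoid"
  where "free_group S =
    \<lparr>carrier = {w. reduced w \<and> fst ` set w \<subseteq> S},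
     monoid.mult = (\<lambda>u v. foldr reduced_Cons u v), one = []\<rparr>"

abbreviation free_group_of_rank :: "nat \<Rightarrow> nat letter list monoid"
  where "free_group_of_rank n \<equiv> free_group {..<n}"

lemma letter_inv_inv [simp]: "letter_inv (letter_inv a) = a"
  by (simp add: letter_inv_def)

lemma reduced_reduced_Cons: "reduced w \<Longrightarrow> reduced (reduced_Cons a w)"
  by (cases w rule: remdups_adj.cases) (auto simp: reduced_def reduced_Cons_def)

lemma reduced_Cons_cancel: "reduced w \<Longrightarrow> reduced_Cons a (reduced_Cons (letter_inv a) w) = w"
  by (cases w rule: remdups_adj.cases) (auto simp: reduced_def reduced_Cons_def)

lemma reduced_foldr: "reduced w \<Longrightarrow> reduced (foldr reduced_Cons u w)"
  by (induction u) (simp_all add: reduced_reduced_Cons)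

lemma set_reduced_Cons: "set (reduced_Cons a w) \<subseteq> insert a (set w)"
  by (auto simp: reduced_Cons_def split: list.splits if_splits)

lemma set_foldr_reduced_Cons: "set (foldr reduced_Cons u w) \<subseteq> set u \<union> set w"
  by (induction u) (use set_reduced_Cons in fastforce)+

lemma foldr_reduced_Cons:
  assumes "reduced w"
  shows "foldr reduced_Cons (reduced_Cons a v) w = reduced_Cons a (foldr reduced_Cons v w)"
proof (cases "\<exists>v'. v = letter_inv a # v'")
  case True
  then obtain v' where v: "v = letter_inv a # v'" by blast
  show ?thesis
    using reduced_Cons_cancel[OF reduced_foldr[OF assms]] by (simp add: v reduced_Cons_def[of a "_ # _"])
next
  case False
  then have "reduced_Cons a v = a # v"
    by (auto simp: reduced_Cons_def split: list.split)
  then show ?thesis by simp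
qed

lemma group_free_group: "group (free_group S)"
proof (rule groupI)
  show "x \<otimes>\<^bsub>free_group S\<^esub> y \<in> carrier (free_group S)"
    if "x \<in> carrier (free_group S)" "y \<in> carrier (free_group S)" for x y
    using that set_foldr_reduced_Cons[of x y] by (force simp: free_group_def reduced_foldr)
  show "x \<otimes>\<^bsub>free_group S\<^esub> y \<otimes>\<^bsub>free_group S\<^esub> z =
      x \<otimes>\<^bsub>free_group S\<^esub> (y \<otimes>\<^bsub>free_group S\<^esub> z)"
    if "z \<in> carrier (free_group S)" for x y z
  proof -
    have "foldr reduced_Cons (foldr reduced_Cons x y) z =
        foldr reduced_Cons x (foldr reduced_Cons y z)"
      using that by (induction x) (simp_all add: foldr_reduced_Cons free_group_def)
    then show ?thesis by (simp add: free_group_def)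
  qed
  show "\<exists>y\<in>carrier (free_group S). y \<otimes>\<^bsub>free_group S\<^esub> x = \<one>\<^bsub>free_group S\<^esub>"
    if x: "x \<in> carrier (free_group S)" for x
  proof
    show "rev (map letter_inv x) \<in> carrier (free_group S)"
      using x by (auto simp: free_group_def reduced_def successively_rev successively_map
          letter_inv_def elim!: successively_mono)
    have "foldr reduced_Cons (rev (map letter_inv x)) x = []"
      by (induction x) (simp_all add: reduced_Cons_def)
    then show "rev (map letter_inv x) \<otimes>\<^bsub>free_group S\<^esub> x = \<one>\<^bsub>free_group S\<^esub>"
      by (simp add: free_group_def)
  qed
qed (auto simp: free_group_def reduced_def)


section \<open>Semidirect products with the integers\<close>

text \<open>
  The pair \<open>(m, i)\<close> stands for \<open>m t\<^sup>i\<close>, so that \<open>m t\<^sup>i m' t\<^sup>j = m (t\<^sup>i m' t\<^sup>-\<^sup>i) t\<^sup>i\<^sup>+\<^sup>j\<close>, where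
  \<open>t\<^sup>i m' t\<^sup>-\<^sup>i = \<psi>\<^sup>-\<^sup>i(m')\<close>.
\<close>

definition semidirect_int :: "('a, 'b) monoid_scheme \<Rightarrow> ('a \<Rightarrow> 'a) \<Rightarrow> ('a \<times> int) monoid"
  where "semidirect_int M \<psi> =
    \<lparr>carrier = carrier M \<times> UNIV,
     monoid.mult = (\<lambda>(m, i) (m', j). (m \<otimes>\<^bsub>M\<^esub> (\<psi> [^]\<^bsub>AutoGroup M\<^esub> (- i)) m', i + j)),
     one = (\<one>\<^bsub>M\<^esub>, 0)\<rparr>"

lemma mult_AutoGroup:
  assumes "f \<in> auto G" "g \<in> auto G" "x \<in> carrier G"
  shows "(f \<otimes>\<^bsub>AutoGroup G\<^esub> g) x = f (g x)"
  using assms by (simp add: AutoGroup_def BijGroup_def auto_def compose_def)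

lemma carrier_AutoGroup [simp]: "carrier (AutoGroup G) = auto G"
  by (simp add: AutoGroup_def)

lemma one_AutoGroup: "x \<in> carrier G \<Longrightarrow> \<one>\<^bsub>AutoGroup G\<^esub> x = x"
  by (simp add: AutoGroup_def BijGroup_def)

context
  fixes M :: "('a, 'b) monoid_scheme" (structure) and \<psi>
  assumes group_M: "group M" and \<psi>: "\<psi> \<in> auto M"
begin

interpretation group M
  by (rule group_M)

interpretation Aut: group "AutoGroup M"
  by (rule AutoGroup)

lemma auto_pow: "\<psi> [^]\<^bsub>AutoGroup M\<^esub> (i :: int) \<in> auto M"
  using Aut.int_pow_closed[of \<psi> i] \<psi> by simp

lemma auto_pow_closed [simp]: "x \<in> carrier M \<Longrightarrow> (\<psi> [^]\<^bsub>AutoGroup M\<^esub> (i :: int)) x \<in> carrier M"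
  using auto_pow[of i] by (auto simp: auto_def hom_def)

lemma auto_pow_mult [simp]:
  "x \<in> carrier M \<Longrightarrow> y \<in> carrier M \<Longrightarrow> (\<psi> [^]\<^bsub>AutoGroup M\<^esub> (i :: int)) (x \<otimes> y) =
    (\<psi> [^]\<^bsub>AutoGroup M\<^esub> i) x \<otimes> (\<psi> [^]\<^bsub>AutoGroup M\<^esub> i) y"
  using auto_pow[of i] by (auto simp: auto_def hom_def)

lemma auto_pow_add:
  "x \<in> carrier M \<Longrightarrow> (\<psi> [^]\<^bsub>AutoGroup M\<^esub> (i :: int)) ((\<psi> [^]\<^bsub>AutoGroup M\<^esub> j) x) =
    (\<psi> [^]\<^bsub>AutoGroup M\<^esub> (i + j)) x"
  using mult_AutoGroup[OF auto_pow auto_pow] Aut.int_pow_mult[of \<psi> i j] \<psi> by simp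

lemma auto_pow_0: "x \<in> carrier M \<Longrightarrow> (\<psi> [^]\<^bsub>AutoGroup M\<^esub> (0 :: int)) x = x"
  using one_AutoGroup[of x M] by (simp add: int_pow_0)

lemma group_semidirect_int: "group (semidirect_int M \<psi>)"
proof (rule groupI)
  show "\<exists>y\<in>carrier (semidirect_int M \<psi>). y \<otimes>\<^bsub>semidirect_int M \<psi>\<^esub> x = \<one>\<^bsub>semidirect_int M \<psi>\<^esub>"
    if "x \<in> carrier (semidirect_int M \<psi>)" for x
  proof -
    obtain m i where x1: "x = (m, i)"
      by (cases x)
    with that have x: "x = (m, i)" "m \<in> carrier M"
      by (simp_all add: semidirect_int_def)
    show ?thesis
      by (rule bexI[of _ "((\<psi> [^]\<^bsub>AutoGroup M\<^esub> i) (inv m), - i)"])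
        (use x in \<open>auto simp: semidirect_int_def simp flip: auto_pow_mult\<close>,
         use auto_pow_mult[of "\<one>" "\<one>" i] in simp)
  qed
qed (auto simp: semidirect_int_def auto_pow_add one_AutoGroup m_assoc add_ac)

lemma semidirect_int_conjugation:
  assumes "m \<in> carrier M"
  shows "inv\<^bsub>semidirect_int M \<psi>\<^esub> (\<one>, 1) \<otimes>\<^bsub>semidirect_int M \<psi>\<^esub> (m, 0)
    \<otimes>\<^bsub>semidirect_int M \<psi>\<^esub> (\<one>, 1) = (\<psi> m, 0)"
proof -
  have one: "(\<psi> [^]\<^bsub>AutoGroup M\<^esub> (i :: int)) \<one> = \<one>" for i
    using auto_pow_mult[of "\<one>" "\<one>" i] by simp
  have "\<psi> [^]\<^bsub>AutoGroup M\<^esub> (1 :: int) = \<psi>"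
    using \<psi> by (simp add: Aut.int_pow_1)
  moreover have "inv\<^bsub>semidirect_int M \<psi>\<^esub> (\<one>, 1) = (\<one>, - 1)"
    by (rule group.inv_equality[OF group_semidirect_int]) (simp_all add: semidirect_int_def one)
  moreover have "\<psi> \<one> = \<one>"
    using \<psi> by (intro hom_one group_M) (simp add: auto_def)
  moreover have "\<psi> m \<in> carrier M"
    using assms \<psi> by (auto simp: auto_def hom_def)
  ultimately show ?thesis
    using assms by (simp add: semidirect_int_def one)
qed

end


section \<open>Abelianization and tensor powers\<close>

text \<open>The map induced by an endomorphism \<open>f\<close> with \<open>f ` N \<subseteq> N\<close> on the quotient by \<open>N\<close>.\<close>

definition quotient_map :: "('a, 'b) monoid_scheme \<Rightarrow> 'a set \<Rightarrow> ('a \<Rightarrow> 'a) \<Rightarrow> 'a set \<Rightarrow> 'a set"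
  where "quotient_map G N f = (\<lambda>C\<in>carrier (G Mod N). N <#>\<^bsub>G\<^esub> f ` C)"

definition abelianization :: "('a, 'b) monoid_scheme \<Rightarrow> 'a set monoid"
  where "abelianization G = G Mod lower_central G (osucc 1)"

definition abelianization_map :: "('a, 'b) monoid_scheme \<Rightarrow> ('a \<Rightarrow> 'a) \<Rightarrow> 'a set \<Rightarrow> 'a set"
  where "abelianization_map G f = quotient_map G (lower_central G (osucc 1)) f"

text \<open>
  The \<open>k\<close>-fold tensor power over the integers of an abelian group (written multiplicatively):
  the free abelian group on the \<open>k\<close>-tuples modulo additivity in each argument.
\<close>

definition tuples :: "('a, 'b) monoid_scheme \<Rightarrow> nat \<Rightarrow> 'a list set"
  where "tuples A k = {xs. length xs = k \<and> set xs \<subseteq> carrier A}"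

definition tensor_relators :: "('a, 'b) monoid_scheme \<Rightarrow> nat \<Rightarrow> ('a list \<Rightarrow>\<^sub>0 int) set"
  where "tensor_relators A k =
    {frag_of (xs @ (a \<otimes>\<^bsub>A\<^esub> b) # ys) - frag_of (xs @ a # ys) - frag_of (xs @ b # ys) | xs a b ys.
      length xs + Suc (length ys) = k \<and> set xs \<union> set ys \<union> {a, b} \<subseteq> carrier A}"

definition tensor_relations :: "('a, 'b) monoid_scheme \<Rightarrow> nat \<Rightarrow> ('a list \<Rightarrow>\<^sub>0 int) set"
  where "tensor_relations A k = generate (free_Abelian_group (tuples A k)) (tensor_relators A k)"

definition tensor_power :: "('a, 'b) monoid_scheme \<Rightarrow> nat \<Rightarrow> ('a list \<Rightarrow>\<^sub>0 int) set monoid"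
  where "tensor_power A k = free_Abelian_group (tuples A k) Mod tensor_relations A k"

definition tensor_power_map ::
  "('a, 'b) monoid_scheme \<Rightarrow> nat \<Rightarrow> ('a \<Rightarrow> 'a) \<Rightarrow> ('a list \<Rightarrow>\<^sub>0 int) set \<Rightarrow> ('a list \<Rightarrow>\<^sub>0 int) set"
  where "tensor_power_map A k \<psi> =
    quotient_map (free_Abelian_group (tuples A k)) (tensor_relations A k)
      (frag_extend (frag_of \<circ> map \<psi>))"

lemma quotient_map_coset:
  fixes G (structure)
  assumes "N \<lhd> G" "f \<in> hom G G" "f ` N \<subseteq> N" "x \<in> carrier G"
  shows "quotient_map G N f (N #>\<^bsub>G\<^esub> x) = N #>\<^bsub>G\<^esub> f x"
proof -
  interpret normal N G by (rule assms)
  have fx: "f x \<in> carrier G"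
    using assms by (auto simp: hom_def)
  have mult: "f (n \<otimes> y) = f n \<otimes> f y" if "n \<in> N" "y \<in> carrier G" for n y
    using that assms(2) by (auto simp: hom_def)
  have "f ` (N #> x) = (\<Union>n'\<in>N. {f n' \<otimes> f x})"
    unfolding r_coset_def image_UN by (intro SUP_cong refl) (simp add: mult assms(4))
  then have "N <#> f ` (N #> x) = (\<Union>n\<in>N. \<Union>n'\<in>N. {n \<otimes> (f n' \<otimes> f x)})"
    unfolding set_mult_def by simp
  also have "\<dots> = N #> f x"
  proof (intro equalityI subsetI)
    fix z assume "z \<in> (\<Union>n\<in>N. \<Union>n'\<in>N. {n \<otimes> (f n' \<otimes> f x)})"
    then obtain n n' where n: "n \<in> N" "n' \<in> N" "z = n \<otimes> (f n' \<otimes> f x)"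
      by blast
    then have "f n' \<in> N"
      using assms(3) by blast
    moreover have "z = n \<otimes> f n' \<otimes> f x"
      using n \<open>f n' \<in> N\<close> fx by (simp add: m_assoc)
    ultimately show "z \<in> N #> f x"
      using n unfolding r_coset_def by blast
  next
    fix z assume "z \<in> N #> f x"
    then obtain n where n: "n \<in> N" "z = n \<otimes> f x"
      by (auto simp: r_coset_def)
    have "f \<one> = \<one>"
      by (rule hom_one[OF assms(2) is_group is_group])
    then have "z = n \<otimes> (f \<one> \<otimes> f x)"
      using n fx by simp
    then show "z \<in> (\<Union>n\<in>N. \<Union>n'\<in>N. {n \<otimes> (f n' \<otimes> f x)})"
      by (intro UN_I[OF n(1)] UN_I[OF subgroup.one_closed[OF subgroup_axioms]]) simp
  qed
  finally show ?thesis
    using rcosetsI[OF subset assms(4)] by (simp add: quotient_map_def FactGroup_def)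
qed

lemma quotient_map_auto:
  fixes G (structure)
  assumes "N \<lhd> G" "f \<in> hom G G" "bij_betw f (carrier G) (carrier G)" "f ` N = N"
  shows "quotient_map G N f \<in> auto (G Mod N)"
proof -
  interpret normal N G by (rule assms)
  have f: "f x \<in> carrier G" "f (x \<otimes> y) = f x \<otimes> f y" if "x \<in> carrier G" "y \<in> carrier G" for x y
    using that assms(2) by (auto simp: hom_def)
  have q: "quotient_map G N f (N #> x) = N #> f x" if "x \<in> carrier G" for x
    using assms that by (intro quotient_map_coset) auto
  have carr: "carrier (G Mod N) = (\<lambda>x. N #> x) ` carrier G"
    by (auto simp: FactGroup_def RCOSETS_def)
  have mult: "(N #> x) \<otimes>\<^bsub>G Mod N\<^esub> (N #> y) = N #> (x \<otimes> y)"
    if "x \<in> carrier G" "y \<in> carrier G" for x y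
    using that by (simp add: FactGroup_def rcos_sum)
  have "quotient_map G N f \<in> hom (G Mod N) (G Mod N)"
  proof (rule homI, unfold carr, elim imageE, hypsubst)
    fix x assume "x \<in> carrier G"
    then show "quotient_map G N f (N #> x) \<in> (\<lambda>x. N #> x) ` carrier G"
      by (simp add: q f)
  next
    fix C D assume "C \<in> (\<lambda>x. N #> x) ` carrier G" "D \<in> (\<lambda>x. N #> x) ` carrier G"
    then obtain x y where "x \<in> carrier G" "y \<in> carrier G" "C = N #> x" "D = N #> y"
      by blast
    then show "quotient_map G N f (C \<otimes>\<^bsub>G Mod N\<^esub> D) =
        quotient_map G N f C \<otimes>\<^bsub>G Mod N\<^esub> quotient_map G N f D"
      by (simp only: mult q f m_closed)
  qed
  moreover have "inj_on (quotient_map G N f) (carrier (G Mod N))"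
  proof (rule inj_onI, unfold carr, elim imageE, hypsubst)
    fix x y assume xy: "x \<in> carrier G" "y \<in> carrier G"
      and "quotient_map G N f (N #> x) = quotient_map G N f (N #> y)"
    then have "N #> f x = N #> f y"
      by (simp add: q)
    then have "f x \<in> N #> f y"
      using rcos_self[OF f(1)[OF xy(1) xy(1)] subgroup_axioms] by simp
    then obtain n where n: "n \<in> N" "f x = n \<otimes> f y"
      by (auto simp: r_coset_def)
    then obtain n' where n': "n' \<in> N" "n = f n'"
      using assms(4) by blast
    then have "f x = f (n' \<otimes> y)"
      using n xy by (simp add: f)
    then have "x = n' \<otimes> y"
      using assms(3) xy n' by (auto simp: bij_betw_def inj_on_def)
    then show "N #> x = N #> y"
      using n' xy by (intro repr_independence[symmetric] subgroup_axioms) (auto simp: r_coset_def)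
  qed
  moreover have "quotient_map G N f ` carrier (G Mod N) = carrier (G Mod N)"
  proof -
    have "quotient_map G N f ` carrier (G Mod N) = (\<lambda>x. N #> x) ` f ` carrier G"
      by (auto simp: carr q image_image)
    then show ?thesis
      using assms(3) by (simp add: carr bij_betw_def)
  qed
  ultimately show ?thesis
    by (auto simp: auto_def Bij_def bij_betw_def quotient_map_def)
qed

lemma lower_central_2_eq_derived: "lower_central G (osucc 1) = derived G (carrier G)"
  by (simp add: lower_central_osucc lower_central_1 commutator_subgroup_def derived_def)

lemma
  assumes "group G"
  shows group_abelianization: "comm_group (abelianization G)"
    and abelianization_map_auto: "f \<in> auto G \<Longrightarrow> abelianization_map G f \<in> auto (abelianization G)"
proof -
  interpret group G by (rule assms)
  show "comm_group (abelianization G)"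
    unfolding abelianization_def lower_central_2_eq_derived
    using derived_quot_is_comm_group .
  assume f: "f \<in> auto G"
  then interpret f: group_hom G G f
    by unfold_locales (simp add: auto_def)
  have "f ` carrier G = carrier G"
    using f by (auto simp: auto_def Bij_def bij_betw_def)
  then have "f ` derived G (carrier G) = derived G (carrier G)"
    using f.derived_img[of "carrier G"] by simp
  then show "abelianization_map G f \<in> auto (abelianization G)"
    using f derived_self_is_normal
    unfolding abelianization_def abelianization_map_def lower_central_2_eq_derived
    by (intro quotient_map_auto) (auto simp: auto_def Bij_def)
qed

lemma tensor_relators_subset:
  assumes "group A"
  shows "tensor_relators A k \<subseteq> carrier (free_Abelian_group (tuples A k))"
proof -
  interpret group A by (rule assms)
  have sub: "Poly_Mapping.keys (frag_of u - frag_of v - frag_of w) \<subseteq> S" if "u \<in> S" "v \<in> S" "w \<in> S"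
    for u v w :: "'a list" and S
    using that keys_diff[of "frag_of u - frag_of v" "frag_of w"] keys_diff[of "frag_of u" "frag_of v"]
    by (auto simp: keys_frag_of)
  show ?thesis
    unfolding tensor_relators_def
    by (clarsimp simp del: subset_iff) (rule subsetD[OF sub], auto simp: tuples_def)
qed

lemma tensor_power_map_auto:
  fixes A (structure)
  assumes "comm_group A" "\<psi> \<in> auto A"
  shows "comm_group (tensor_power A k)" "tensor_power_map A k \<psi> \<in> auto (tensor_power A k)"
proof -
  interpret comm_group A by (rule assms)
  let ?F = "free_Abelian_group (tuples A k)" and ?f = "frag_extend (frag_of \<circ> map \<psi>)"
  interpret F: comm_group ?F by (rule abelian_free_Abelian_group)
  have \<psi>: "bij_betw \<psi> (carrier A) (carrier A)" "\<psi> \<in> hom A A"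
    using assms(2) by (auto simp: auto_def Bij_def)
  define \<chi> where "\<chi> = inv_into (carrier A) \<psi>"
  have inv: "\<psi> (\<chi> x) = x" "\<chi> (\<psi> x) = x" "\<chi> x \<in> carrier A" "\<psi> x \<in> carrier A"
    if "x \<in> carrier A" for x
    using that \<psi>(1) bij_betw_inv_into_right[OF \<psi>(1)] bij_betw_inv_into_left[OF \<psi>(1)]
      bij_betw_apply[OF bij_betw_inv_into[OF \<psi>(1)]] bij_betw_apply[OF \<psi>(1)]
    by (simp_all add: \<chi>_def)
  have mult: "\<psi> (x \<otimes> y) = \<psi> x \<otimes> \<psi> y" if "x \<in> carrier A" "y \<in> carrier A" for x y
    using that \<psi>(2) by (auto simp: hom_def)
  have tuples_map: "map g xs \<in> tuples A k"
    if "\<And>x. x \<in> carrier A \<Longrightarrow> g x \<in> carrier A" "xs \<in> tuples A k" for g xs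
    using that by (auto simp: tuples_def)
  have closed: "frag_extend (frag_of \<circ> map g) x \<in> carrier ?F"
    if g: "\<And>x. x \<in> carrier A \<Longrightarrow> g x \<in> carrier A" and x: "x \<in> carrier ?F" for g x
  proof -
    have "Poly_Mapping.keys (frag_extend (frag_of \<circ> map g) x) \<subseteq> map g ` Poly_Mapping.keys x"
      using keys_frag_extend[of "frag_of \<circ> map g" x]
      by (simp add: keys_frag_of UNION_singleton_eq_range)
    moreover have "map g ` Poly_Mapping.keys x \<subseteq> tuples A k"
      using x tuples_map[OF g] by (simp add: image_subset_iff subset_eq)
    ultimately show ?thesis
      by simp
  qed
  have cancel: "frag_extend (frag_of \<circ> map g) (frag_extend (frag_of \<circ> map h) x) = x"
    if gh: "\<And>x. x \<in> carrier A \<Longrightarrow> g (h x) = x" and x: "x \<in> carrier ?F" for g h x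
  proof -
    have "map g (map h xs) = xs" if "xs \<in> Poly_Mapping.keys x" for xs
    proof -
      have "set xs \<subseteq> carrier A"
        using x that by (auto simp: tuples_def)
      then show ?thesis
        using gh by (simp add: map_idI subset_eq)
    qed
    then have "frag_extend (frag_of \<circ> map g \<circ> map h) x = frag_extend frag_of x"
      by (intro frag_extend_eq) simp
    then show ?thesis
      by (simp only: frag_extend_compose flip: frag_expansion)
  qed
  have hom: "?f \<in> hom ?F ?F"
    using closed[of \<psi>] inv(4) by (intro homI) (auto simp: frag_extend_add)
  have bij: "bij_betw ?f (carrier ?F) (carrier ?F)"
  proof (rule bij_betw_byWitness[where f' = "frag_extend (frag_of \<circ> map \<chi>)"])
    show "\<forall>x\<in>carrier ?F. frag_extend (frag_of \<circ> map \<chi>) (?f x) = x"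
      using cancel[of \<chi> \<psi>] inv(2) by blast
    show "\<forall>x\<in>carrier ?F. ?f (frag_extend (frag_of \<circ> map \<chi>) x) = x"
      using cancel[of \<psi> \<chi>] inv(1) by blast
    show "?f ` carrier ?F \<subseteq> carrier ?F"
      using closed[of \<psi>] inv(4) by blast
    show "frag_extend (frag_of \<circ> map \<chi>) ` carrier ?F \<subseteq> carrier ?F"
      using closed[of \<chi>] inv(3) by blast
  qed
  have "?f ` tensor_relators A k = tensor_relators A k"
  proof (intro equalityI subsetI)
    fix z assume "z \<in> ?f ` tensor_relators A k"
    then obtain xs a b ys where
      "z = ?f (frag_of (xs @ (a \<otimes> b) # ys) - frag_of (xs @ a # ys) - frag_of (xs @ b # ys))"
      and l: "length xs + Suc (length ys) = k" and c: "set xs \<union> set ys \<union> {a, b} \<subseteq> carrier A"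
      by (auto simp: tensor_relators_def)
    then have "z = frag_of (map \<psi> xs @ (\<psi> a \<otimes> \<psi> b) # map \<psi> ys) -
        frag_of (map \<psi> xs @ \<psi> a # map \<psi> ys) - frag_of (map \<psi> xs @ \<psi> b # map \<psi> ys)"
      by (simp add: frag_extend_diff mult)
    moreover have "length (map \<psi> xs) + Suc (length (map \<psi> ys)) = k"
      "set (map \<psi> xs) \<union> set (map \<psi> ys) \<union> {\<psi> a, \<psi> b} \<subseteq> carrier A"
      using l c inv(4) by auto
    ultimately show "z \<in> tensor_relators A k"
      unfolding tensor_relators_def by blast
  next
    fix z assume "z \<in> tensor_relators A k"
    then obtain xs a b ys where
      z: "z = frag_of (xs @ (a \<otimes> b) # ys) - frag_of (xs @ a # ys) - frag_of (xs @ b # ys)"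
      and l: "length xs + Suc (length ys) = k" and c: "set xs \<union> set ys \<union> {a, b} \<subseteq> carrier A"
      by (auto simp: tensor_relators_def)
    have id: "map (\<psi> \<circ> \<chi>) us = us" if "set us \<subseteq> carrier A" for us
      using that inv by (intro map_idI) auto
    define z' where "z' = frag_of (map \<chi> xs @ (\<chi> a \<otimes> \<chi> b) # map \<chi> ys) -
        frag_of (map \<chi> xs @ \<chi> a # map \<chi> ys) - frag_of (map \<chi> xs @ \<chi> b # map \<chi> ys)"
    have "z = ?f z'"
      using c by (simp add: z z'_def frag_extend_diff mult inv id)
    moreover have "length (map \<chi> xs) + Suc (length (map \<chi> ys)) = k"
      "set (map \<chi> xs) \<union> set (map \<chi> ys) \<union> {\<chi> a, \<chi> b} \<subseteq> carrier A"
      using l c inv(3) by auto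
    then have "z' \<in> tensor_relators A k"
      unfolding z'_def tensor_relators_def by blast
    ultimately show "z \<in> ?f ` tensor_relators A k"
      by blast
  qed
  note relators = this
  interpret f: group_hom ?F ?F ?f
    by unfold_locales (rule hom)
  have img: "?f ` tensor_relations A k = tensor_relations A k"
    using relators f.generate_img[OF tensor_relators_subset[OF is_group]] by (simp add: tensor_relations_def)
  have normal: "tensor_relations A k \<lhd> ?F"
    unfolding tensor_relations_def
    by (intro F.subgroup_imp_normal F.generate_is_subgroup tensor_relators_subset is_group)
  show "comm_group (tensor_power A k)"
    unfolding tensor_power_def using F.abelian_FactGroup normal.axioms(1)[OF normal] by blast
  show "tensor_power_map A k \<psi> \<in> auto (tensor_power A k)"
    unfolding tensor_power_def tensor_power_map_def by (intro quotient_map_auto normal hom bij img)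
qed

end

theory Submission
  imports Defs
begin

text \<open>
  Let \<open>D\<^sub>k\<close> be the subgroup of those \<open>w \<in> F\<close> whose Magnus expansion is \<open>1\<close> plus terms of degree at
  least \<open>k\<close>. Taking the degree \<open>k\<close> part embeds \<open>D\<^sub>k / D\<^sub>k\<^sub>+\<^sub>1\<close> into the \<open>k\<close>-fold tensor power of the
  abelianization. The embedding is compatible with \<open>\<phi>\<close>, because an endomorphism of \<open>F\<close> extends to a
  substitution of power series whose linear part is the induced map on the abelianization. Modulo
  \<open>D\<^sub>k\<^sub>+\<^sub>1\<close>, commutators of \<open>D\<^sub>k\<close> with \<open>G\<close> can therefore be computed in the \<open>k\<close>-th group of the
  hypothesis, so each block of \<open>\<omega>\<close> steps of the lower central series of \<open>G\<close> descends from \<open>D\<^sub>k\<close> to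
  \<open>D\<^sub>k\<^sub>+\<^sub>1\<close>, and the intersection of all \<open>D\<^sub>k\<close> is trivial.

  Conversely, if \<open>\<gamma>\<^sub>\<omega>(G)\<close> is nontrivial, then the rank is at least 2. The commutator subgroup of
  \<open>K = \<gamma>\<^sub>\<alpha>(G)\<close>, \<open>\<alpha> \<ge> \<omega>\<close>, lies in \<open>[K, \<gamma>\<^sub>j(G)] \<subseteq> \<gamma>\<^sub>\<alpha>\<^sub>+\<^sub>j(G)\<close> for all \<open>j\<close>, and a nontrivial normal subgroup of
  a non-abelian free group is not abelian; hence \<open>\<gamma>\<^sub>\<alpha>\<^sub>+\<^sub>\<omega>(G)\<close> is nontrivial as well.
\<close>

section \<open>Countable limit ordinals\<close>

text \<open>The degree k part is additive on D_k but not on F, so it gives no homomorphism from G to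
  the k-th group of the hypothesis. The descent is therefore stated for a map on a subgroup under
  which conjugation by any element of G becomes conjugation by some element of the target. This
  holds for D_k because m in F does not change the lowest part of an element of D_k, so m t^i acts
  on the tensor as t^i alone. Defining D_k by coefficients, instead of using gamma_k(F), makes
  injectivity on D_k / D_{k+1} a question about linear functionals; the one comparison of the two
  filtrations that is used is gamma_2(F) inside D_2. A nontrivial word leaves the D_k because of its
  coefficient at the monomial listing its syllables once each. The first block starts at gamma_2(G),
  inside F = D_1, and ends at \<omega>; thus the k-th multiple of \<omega> is an index whose term
  lies in D_{k+1}. For the lower bound, the commutator rule needs a transfinite first index and a
  finite second one. A term from \<omega> on lies in all finite terms, so it can serve as its own
  second argument.\<close>

lemma less_ordinal_iff: "\<alpha> < \<beta> \<longleftrightarrow> rep_ordinal \<alpha> <o rep_ordinal \<beta>"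
  by (rule less_ordinal.abs_eq[OF rep_ordinal_refl rep_ordinal_refl, unfolded abs_rep_ordinal])

lemma ordinal_eq_iff: "\<alpha> = \<beta> \<longleftrightarrow> rep_ordinal \<alpha> =o rep_ordinal \<beta>"
  using Quotient3_rel_rep[OF Quotient3_ordinal] by blast

lemma zero_le_ordinal: "(0 :: ordinal) \<le> \<alpha>"
  by (simp add: zero_ordinal_def Least_le)

text \<open>The ordinals below an order type are the types of its proper initial segments, one for
  each element and in the same order. The clauses on successors and on the least element suffice to
  compute in \<open>omega\<close> and \<open>omega_squared\<close> without returning to
  representatives.\<close>

lemma order_type_segments:
  fixes r :: "'a :: countable rel"
  assumes r: "Well_order r" and F: "Field r = UNIV"
  obtains f :: "'a \<Rightarrow> ordinal"
  where "\<And>\<beta>. \<beta> < order_type r \<longleftrightarrow> \<beta> \<in> range f"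
    and "\<And>a b. f a < f b \<longleftrightarrow> (a, b) \<in> r \<and> a \<noteq> b"
    and "\<And>a b. (a, b) \<in> r \<Longrightarrow> a \<noteq> b \<Longrightarrow> (\<And>c. (a, c) \<in> r \<Longrightarrow> a \<noteq> c \<Longrightarrow> (b, c) \<in> r) \<Longrightarrow> f b = osucc (f a)"
    and "\<And>a. (\<And>c. (a, c) \<in> r) \<Longrightarrow> f a = 0"
proof
  define f where "f a = order_type (Restr r (underS r a))" for a
  have wo: "wo_rel r"
    using r by (simp add: wo_rel_def)
  have seg: "Well_order (Restr r (underS r a))" for a
    using r by (rule Well_order_Restr)
  have rep: "rep_ordinal (f a) =o Restr r (underS r a)" for a
    unfolding f_def by (rule order_type_Well_order[OF seg])
  show range: "\<beta> < order_type r \<longleftrightarrow> \<beta> \<in> range f" for \<beta>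
  proof -
    have "\<beta> < order_type r \<longleftrightarrow> rep_ordinal \<beta> <o r"
      unfolding less_ordinal_iff
      using ordLess_ordIso_trans[OF _ order_type_Well_order[OF r]]
        ordLess_ordIso_trans[OF _ ordIso_symmetric[OF order_type_Well_order[OF r]]] by blast
    also have "\<dots> \<longleftrightarrow> (\<exists>a\<in>Field r. rep_ordinal \<beta> =o Restr r (underS r a))"
      using ordIso_Well_order_simp[OF rep_ordinal_refl[of \<beta>]] r
      by (intro ordLess_iff_ordIso_Restr) auto
    also have "\<dots> \<longleftrightarrow> (\<exists>a. \<beta> = f a)"
      unfolding ordinal_eq_iff F using rep ordIso_symmetric ordIso_transitive by (metis UNIV_I)
    finally show ?thesis
      by blast
  qed
  have mono: "f a < f b" if "(a, b) \<in> r" "a \<noteq> b" for a b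
  proof -
    have "underS r a \<subset> underS r b"
    proof
      show "underS r a \<subseteq> underS r b"
        using that wo_rel.TRANS[OF wo] wo_rel.ANTISYM[OF wo] by (auto simp: underS_def dest: transD antisymD)
      show "underS r a \<noteq> underS r b"
        using that by (auto simp: underS_def)
    qed
    then have "Restr r (underS r a) <o Restr r (underS r b)"
      using ofilter_subset_ordLess[OF r wo_rel.underS_ofilter[OF wo] wo_rel.underS_ofilter[OF wo]] by blast
    then show ?thesis
      unfolding less_ordinal_iff
      using rep ordIso_ordLess_trans ordLess_ordIso_trans ordIso_symmetric by meson
  qed
  have total: "(a, b) \<in> r \<or> (b, a) \<in> r" for a b
    using wo_rel.TOTALS[OF wo] F by blast
  show less: "f a < f b \<longleftrightarrow> (a, b) \<in> r \<and> a \<noteq> b" for a b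
    using mono[of a b] mono[of b a] total[of a b] by (metis less_asym less_irrefl)
  show "f b = osucc (f a)"
    if ab: "(a, b) \<in> r" "a \<noteq> b" and nxt: "\<And>c. (a, c) \<in> r \<Longrightarrow> a \<noteq> c \<Longrightarrow> (b, c) \<in> r" for a b
  proof (rule order_antisym)
    show "osucc (f a) \<le> f b"
      unfolding osucc_le_iff using ab by (rule mono)
    show "f b \<le> osucc (f a)"
    proof (rule ccontr)
      assume "\<not> f b \<le> osucc (f a)"
      then have *: "osucc (f a) < f b" by simp
      moreover have "f b < order_type r" using range by blast
      ultimately have "osucc (f a) < order_type r" by (rule less_trans)
      \<comment> \<open>The values of \<open>f\<close> are closed downwards, so this successor is
        itself some \<open>f c\<close>. Then c comes strictly after a, while b is by assumption the
        first such element.\<close>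
      then obtain c where c: "osucc (f a) = f c" using range by blast
      then have "(b, c) \<in> r"
        using less_osucc[of "f a"] less nxt by simp
      then show False
        using * mono[of b c] unfolding c by (metis less_asym less_irrefl)
    qed
  qed
  show "f a = 0" if "\<And>c. (a, c) \<in> r" for a
  proof (rule ccontr)
    assume "f a \<noteq> 0"
    then have *: "0 < f a"
      using zero_le_ordinal[of "f a"] by simp
    moreover have "f a < order_type r" using range by blast
    ultimately have "0 < order_type r" by (rule less_trans)
    then obtain c where "0 = f c" using range by blast
    then show False
      using * that[of c] mono[of a c] by (metis less_asym less_irrefl)
  qed
qed

lemma one_le_osucc: "1 \<le> osucc \<alpha>"
  unfolding one_ordinal_def osucc_le_iff by (rule le_less_trans[OF zero_le_ordinal less_osucc])

lemma le_funpow_osucc: "\<alpha> \<le> (osucc ^^ j) \<alpha>"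
  by (induction j) (auto intro: order.trans less_imp_le[OF less_osucc])

text \<open>That is, \<open>\<mu> = \<alpha> + \<omega>\<close>.\<close>

definition is_next_limit :: "ordinal \<Rightarrow> ordinal \<Rightarrow> bool"
  where "is_next_limit \<alpha> \<mu> \<longleftrightarrow> (\<forall>\<beta>. \<beta> < \<mu> \<longleftrightarrow> (\<exists>j. \<beta> < (osucc ^^ j) \<alpha>))"

lemma is_next_limit_unique:
  assumes "is_next_limit \<alpha> \<mu>" "is_next_limit \<alpha> \<nu>"
  shows "\<mu> = \<nu>"
proof -
  have "\<beta> < \<mu> \<longleftrightarrow> \<beta> < \<nu>" for \<beta>
    using assms unfolding is_next_limit_def by simp
  then show ?thesis
    by (meson less_irrefl linorder_neqE)
qed

text \<open>A finite initial stretch is absorbed by \<omega>. This lets a block begin at index 1 or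
  2 and still end at \<open>omega\<close>.\<close>

lemma is_next_limit_osucc:
  assumes "is_next_limit \<alpha> \<mu>"
  shows "is_next_limit (osucc \<alpha>) \<mu>"
proof -
  have "(osucc ^^ j) (osucc \<alpha>) = (osucc ^^ Suc j) \<alpha>" for j
    by (simp add: funpow_swap1)
  moreover have "(\<exists>j. \<beta> < (osucc ^^ j) \<alpha>) \<longleftrightarrow> (\<exists>j. \<beta> < (osucc ^^ Suc j) \<alpha>)" for \<beta>
    using less_trans[OF _ less_osucc] by (metis funpow.simps(2) comp_apply)
  ultimately show ?thesis
    using assms unfolding is_next_limit_def by simp
qed

lemma is_next_limit_less: "is_next_limit \<alpha> \<mu> \<Longrightarrow> (osucc ^^ j) \<alpha> < \<mu>"
  unfolding is_next_limit_def using less_osucc[of "(osucc ^^ j) \<alpha>"] by (metis comp_apply funpow.simps(2))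

lemma is_next_limit_limit:
  assumes "is_next_limit \<alpha> \<mu>" "\<beta> < \<mu>"
  shows "osucc \<beta> < \<mu>"
proof -
  obtain j where "\<beta> < (osucc ^^ j) \<alpha>"
    using assms unfolding is_next_limit_def by blast
  then have "osucc \<beta> \<le> (osucc ^^ j) \<alpha>"
    by (simp add: osucc_le_iff)
  then show ?thesis
    using is_next_limit_less[OF assms(1)] by (rule le_less_trans)
qed

lemma is_next_limit_omega: "is_next_limit 0 omega"
proof -
  have F: "Field {(m, n). m \<le> n} = (UNIV :: nat set)"
    by (auto simp: Field_def)
  obtain f :: "nat \<Rightarrow> ordinal" where f: "\<And>\<beta>. \<beta> < omega \<longleftrightarrow> \<beta> \<in> range f"
      "\<And>n. f (Suc n) = osucc (f n)" "f 0 = 0"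
    by (rule order_type_segments[OF Well_order_omega F, folded omega_def]) (simp add: Suc_le_eq)
  have "f j = (osucc ^^ j) 0" for j
    by (induction j) (simp_all add: f)
  then have "\<beta> < omega \<longleftrightarrow> (\<exists>j. \<beta> = (osucc ^^ j) 0)" for \<beta>
    using f(1) by auto
  then show ?thesis
    unfolding is_next_limit_def using less_osucc by (metis comp_apply funpow.simps(2) less_trans)
qed

text \<open>Here \<open>f a\<close> is the a-th multiple of \<omega>, realized by the pair
  \<open>(a, 0)\<close> of the lexicographic order; these multiples are cofinal.\<close>

lemma omega_squared_limits:
  obtains f :: "nat \<Rightarrow> ordinal"
  where "f 0 = 0" "\<And>a. is_next_limit (f a) (f (Suc a))" "\<And>\<beta>. \<beta> < omega_squared \<longleftrightarrow> (\<exists>a. \<beta> < f a)"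
proof -
  let ?r = "{((a :: nat, b :: nat), (c, d)). a < c \<or> a = c \<and> b \<le> d}"
  have "Field ?r = UNIV"
    by (auto simp: Field_def)
  then obtain g :: "nat \<times> nat \<Rightarrow> ordinal" where range: "\<And>\<beta>. \<beta> < omega_squared \<longleftrightarrow> \<beta> \<in> range g"
    and less: "\<And>a b c d. g (a, b) < g (c, d) \<longleftrightarrow> a < c \<or> a = c \<and> b < d"
    and succ: "\<And>a b. g (a, Suc b) = osucc (g (a, b))" and zero: "g (0, 0) = 0"
  proof (rule order_type_segments[OF Well_order_omega_squared, folded omega_squared_def])
    fix g assume g1: "\<And>\<beta>. \<beta> < omega_squared \<longleftrightarrow> \<beta> \<in> range g"
      and g2: "\<And>p q. g p < g q \<longleftrightarrow> (p, q) \<in> ?r \<and> p \<noteq> q"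
      and g3: "\<And>p q. (p, q) \<in> ?r \<Longrightarrow> p \<noteq> q \<Longrightarrow> (\<And>c. (p, c) \<in> ?r \<Longrightarrow> p \<noteq> c \<Longrightarrow> (q, c) \<in> ?r) \<Longrightarrow> g q = osucc (g p)"
      and g4: "\<And>p. (\<And>c. (p, c) \<in> ?r) \<Longrightarrow> g p = 0"
    show thesis
    proof (rule that[of g])
      show "g (a, b) < g (c, d) \<longleftrightarrow> a < c \<or> a = c \<and> b < d" for a b c d
        by (auto simp: g2)
      show "g (a, Suc b) = osucc (g (a, b))" for a b
        by (rule g3) auto
      show "g (0, 0) = 0"
        by (rule g4) auto
    qed (rule g1)
  qed
  have pow: "g (a, b) = (osucc ^^ b) (g (a, 0))" for a b
    by (induction b) (simp_all add: succ)
  have lim: "\<beta> < g (Suc a, 0) \<longleftrightarrow> (\<exists>b. \<beta> < g (a, b))" for \<beta> a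
  proof
    assume *: "\<beta> < g (Suc a, 0)"
    also have "g (Suc a, 0) < omega_squared" using range by blast
    finally obtain c d where "\<beta> = g (c, d)" using range by auto
    with * show "\<exists>b. \<beta> < g (a, b)"
      by (auto simp: less intro!: exI[of _ "Suc d"])
  next
    assume "\<exists>b. \<beta> < g (a, b)"
    then show "\<beta> < g (Suc a, 0)"
      using less[of a _ "Suc a" 0] less_trans by blast
  qed
  show thesis
  proof (rule that[of "\<lambda>a. g (a, 0)"])
    show "is_next_limit (g (a, 0)) (g (Suc a, 0))" for a
      unfolding is_next_limit_def lim by (simp add: pow[symmetric])
    show "\<beta> < omega_squared \<longleftrightarrow> (\<exists>a. \<beta> < g (a, 0))" for \<beta>
    proof
      assume "\<beta> < omega_squared"
      then obtain c d where "\<beta> = g (c, d)" using range by auto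
      then show "\<exists>a. \<beta> < g (a, 0)"
        by (auto simp: less)
    next
      assume "\<exists>a. \<beta> < g (a, 0)"
      then show "\<beta> < omega_squared"
        using range less_trans by (metis rangeI)
    qed
  qed (rule zero)
qed


section \<open>The transfinite lower central series\<close>

lemma ordinal_cases [case_names le_one osucc limit]:
  obtains "\<alpha> \<le> 1" | \<beta> where "1 \<le> \<beta>" "\<alpha> = osucc \<beta>"
    | "1 < \<alpha>" "\<And>\<beta>. \<beta> < \<alpha> \<Longrightarrow> osucc \<beta> < \<alpha>"
proof (cases "\<alpha> \<le> 1")
  case False
  show ?thesis
  proof (cases "\<exists>\<beta>. \<alpha> = osucc \<beta>")
    case True
    then obtain \<beta> where \<beta>: "\<alpha> = osucc \<beta>" ..
    with False have "1 \<le> \<beta>"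
      using osucc_le_iff by (metis not_less)
    with \<beta> show ?thesis using that by blast
  next
    case no_succ: False
    have "osucc \<beta> < \<alpha>" if "\<beta> < \<alpha>" for \<beta>
      using that no_succ by (metis osucc_le_iff order.order_iff_strict)
    with False show ?thesis using that by simp
  qed
qed (rule that)

lemma lower_central_le_one: "\<alpha> \<le> 1 \<Longrightarrow> lower_central G \<alpha> = carrier G"
  by (simp add: lower_central.simps)

context group
begin

lemma inv_cancel [simp]:
  assumes "x \<in> carrier G" "y \<in> carrier G"
  shows "inv x \<otimes> (x \<otimes> y) = y" "x \<otimes> (inv x \<otimes> y) = y"
  using assms by (simp_all flip: m_assoc)

lemma normal_commutator_subgroup:
  assumes "N \<lhd> G"
  shows "commutator_subgroup G N (carrier G) \<lhd> G" "commutator_subgroup G N (carrier G) \<subseteq> N"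
proof -
  interpret N: normal N G by (rule assms)
  let ?S = "\<Union>h\<in>N. \<Union>k\<in>carrier G. {h \<otimes> k \<otimes> inv h \<otimes> inv k}"
  have "h \<otimes> k \<otimes> inv h \<otimes> inv k \<in> N" if "h \<in> N" "k \<in> carrier G" for h k
  proof -
    have "h \<otimes> (k \<otimes> inv h \<otimes> inv k) \<in> N"
      using that by (intro N.m_closed N.inv_op_closed2 N.m_inv_closed)
    then show ?thesis using that by (simp add: m_assoc)
  qed
  then have sub: "?S \<subseteq> N" by blast
  then show "commutator_subgroup G N (carrier G) \<subseteq> N"
    unfolding commutator_subgroup_def by (rule generate_subgroup_incl[OF _ N.subgroup_axioms])
  show "commutator_subgroup G N (carrier G) \<lhd> G"
    unfolding commutator_subgroup_def
  proof (rule normal_generateI)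
    show "?S \<subseteq> carrier G" using sub N.subset by blast
    fix s g assume "s \<in> ?S" and g: "g \<in> carrier G"
    then obtain h k where hk: "h \<in> N" "k \<in> carrier G" "s = h \<otimes> k \<otimes> inv h \<otimes> inv k" by blast
    have "h \<in> carrier G" using hk by simp
    have "g \<otimes> s \<otimes> inv g = (g \<otimes> h \<otimes> inv g) \<otimes> (g \<otimes> k \<otimes> inv g) \<otimes> inv (g \<otimes> h \<otimes> inv g) \<otimes> inv (g \<otimes> k \<otimes> inv g)"
      using hk \<open>h \<in> carrier G\<close> g by (simp add: m_assoc inv_mult_group)
    moreover have "g \<otimes> h \<otimes> inv g \<in> N" "g \<otimes> k \<otimes> inv g \<in> carrier G"
      using hk g by (auto intro: N.inv_op_closed2)
    ultimately show "g \<otimes> s \<otimes> inv g \<in> ?S" by blast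
  qed
qed

lemma lower_central_normal: "lower_central G \<alpha> \<lhd> G"
proof (induction \<alpha> rule: less_induct)
  case (less \<alpha>)
  show ?case
  proof (cases \<alpha> rule: ordinal_cases)
    case le_one
    then show ?thesis
      using normal_self by (simp add: lower_central_le_one)
  next
    case (osucc \<beta>)
    then show ?thesis
      using less[of \<beta>] less_osucc[of \<beta>] normal_commutator_subgroup by (simp add: lower_central_osucc)
  next
    case limit
    have "normal (\<Inter>(lower_central G ` {1..<\<alpha>})) G"
    proof (rule normal_invI)
      show "subgroup (\<Inter>(lower_central G ` {1..<\<alpha>})) G"
        using less limit by (intro subgroups_Inter) (auto simp: normal_def)
      show "x \<otimes> h \<otimes> inv x \<in> \<Inter>(lower_central G ` {1..<\<alpha>})"
        if "x \<in> carrier G" "h \<in> \<Inter>(lower_central G ` {1..<\<alpha>})" for x h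
        using that less by (auto intro: normal.inv_op_closed2)
    qed
    then show ?thesis
      using lower_central_limit[of \<alpha> G] limit by simp
  qed
qed

lemma lower_central_subgroup: "subgroup (lower_central G \<alpha>) G"
  using lower_central_normal by (rule normal_imp_subgroup)

lemma lower_central_closed: "x \<in> lower_central G \<alpha> \<Longrightarrow> x \<in> carrier G"
  by (rule subgroup.mem_carrier[OF lower_central_subgroup])

lemma lower_central_antimono: "\<alpha> \<le> \<beta> \<Longrightarrow> lower_central G \<beta> \<subseteq> lower_central G \<alpha>"
proof (induction \<beta> rule: less_induct)
  case (less \<beta>)
  show ?case
  proof (cases "\<alpha> = \<beta> \<or> \<alpha> \<le> 1")
    case True
    then show ?thesis
      using lower_central_closed by (auto simp: lower_central_le_one)
  next
    case False
    then have "\<alpha> < \<beta>" "1 \<le> \<alpha>" using less.prems by auto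
    show ?thesis
    proof (cases \<beta> rule: ordinal_cases)
      case le_one
      then show ?thesis
        using \<open>\<alpha> < \<beta>\<close> False by (meson less_imp_le order.trans)
    next
      case (osucc \<delta>)
      then have "\<alpha> \<le> \<delta>"
        using \<open>\<alpha> < \<beta>\<close> osucc_le_iff by (metis not_less)
      then have "lower_central G \<delta> \<subseteq> lower_central G \<alpha>"
        using less.IH osucc less_osucc by blast
      moreover have "lower_central G \<beta> \<subseteq> lower_central G \<delta>"
        using osucc normal_commutator_subgroup(2)[OF lower_central_normal] by (simp add: lower_central_osucc)
      ultimately show ?thesis by blast
    next
      case limit
      then show ?thesis
        using \<open>\<alpha> < \<beta>\<close> \<open>1 \<le> \<alpha>\<close> lower_central_limit[of \<beta> G] by auto
    qed
  qed
qed

lemma commutator_in_lower_central: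
  assumes "1 \<le> \<alpha>" "x \<in> lower_central G \<alpha>" "g \<in> carrier G"
  shows "x \<otimes> g \<otimes> inv x \<otimes> inv g \<in> lower_central G (osucc \<alpha>)"
  unfolding lower_central_osucc[OF assms(1)] commutator_subgroup_def
  using assms by (intro generate.incl) blast

lemma lower_central_osucc_subset:
  assumes "1 \<le> \<alpha>" "subgroup S G"
    and "\<And>x g. x \<in> lower_central G \<alpha> \<Longrightarrow> g \<in> carrier G \<Longrightarrow> x \<otimes> g \<otimes> inv x \<otimes> inv g \<in> S"
  shows "lower_central G (osucc \<alpha>) \<subseteq> S"
  unfolding lower_central_osucc[OF assms(1)] commutator_subgroup_def
  using assms(3) by (intro generate_subgroup_incl assms(2)) blast

lemma lower_central_next_limit:
  assumes "1 \<le> \<alpha>" "is_next_limit \<alpha> \<mu>"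
  shows "lower_central G \<mu> = (\<Inter>j. lower_central G ((osucc ^^ j) \<alpha>))"
proof (intro equalityI subsetI)
  fix x assume "x \<in> lower_central G \<mu>"
  then show "x \<in> (\<Inter>j. lower_central G ((osucc ^^ j) \<alpha>))"
    using lower_central_antimono[OF less_imp_le[OF is_next_limit_less[OF assms(2)]]] by blast
next
  fix x assume x: "x \<in> (\<Inter>j. lower_central G ((osucc ^^ j) \<alpha>))"
  have "1 \<le> \<mu>"
    using assms(1) is_next_limit_less[OF assms(2), of 0] by simp
  then have "lower_central G \<mu> = (\<Inter>\<beta>\<in>{1..<\<mu>}. lower_central G \<beta>)"
    using is_next_limit_limit[OF assms(2)] by (rule lower_central_limit)
  moreover have "x \<in> lower_central G \<beta>" if \<beta>: "\<beta> < \<mu>" for \<beta>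
  proof -
    obtain j where "\<beta> < (osucc ^^ j) \<alpha>"
      using \<beta> assms(2) unfolding is_next_limit_def by blast
    then show ?thesis
      using x lower_central_antimono[OF less_imp_le, of \<beta> "(osucc ^^ j) \<alpha>"] by blast
  qed
  ultimately show "x \<in> lower_central G \<mu>" by auto
qed

lemma lower_central_stationary:
  assumes "1 \<le> \<alpha>" "lower_central G (osucc \<alpha>) = lower_central G \<alpha>" "\<alpha> \<le> \<beta>"
  shows "lower_central G \<beta> = lower_central G \<alpha>"
  using assms(3)
proof (induction \<beta> rule: less_induct)
  case (less \<beta>)
  show ?case
  proof (cases "\<alpha> = \<beta>")
    case False
    then have "\<alpha> < \<beta>" using less.prems by simp
    show ?thesis
    proof (cases \<beta> rule: ordinal_cases)
      case le_one
      then show ?thesis using \<open>\<alpha> < \<beta>\<close> assms(1) by simp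
    next
      case (osucc \<delta>)
      then have "\<alpha> \<le> \<delta>"
        using \<open>\<alpha> < \<beta>\<close> osucc_le_iff by (metis not_less)
      then have "lower_central G \<delta> = lower_central G \<alpha>"
        using less.IH osucc less_osucc by blast
      then show ?thesis
        using osucc assms(1,2) by (simp add: lower_central_osucc)
    next
      case limit
      show ?thesis
      proof
        show "lower_central G \<beta> \<subseteq> lower_central G \<alpha>"
          using less.prems by (rule lower_central_antimono)
        have "lower_central G \<alpha> \<subseteq> lower_central G \<delta>" if "\<delta> < \<beta>" for \<delta>
          using less.IH[OF that] lower_central_antimono by (metis linear order_refl)
        then have "lower_central G \<alpha> \<subseteq> (\<Inter>\<delta>\<in>{1..<\<beta>}. lower_central G \<delta>)"
          by (intro INT_greatest) simp
        then show "lower_central G \<alpha> \<subseteq> lower_central G \<beta>"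
          using lower_central_limit[of \<beta> G] limit by simp
      qed
    qed
  qed simp
qed

section \<open>Commutator calculus for terms of the series\<close>

lemma commute_inv:
  assumes "x \<in> carrier G" "y \<in> carrier G" "x \<otimes> y = y \<otimes> x"
  shows "x \<otimes> inv y = inv y \<otimes> x"
proof -
  have "x \<otimes> inv y = inv y \<otimes> (y \<otimes> x) \<otimes> inv y"
    using assms(1,2) by (simp add: m_assoc)
  also have "\<dots> = inv y \<otimes> x"
    using assms(1,2) unfolding assms(3)[symmetric] by (simp add: m_assoc)
  finally show ?thesis .
qed

lemma commute_mult:
  assumes "x \<in> carrier G" "y \<in> carrier G" "z \<in> carrier G" "x \<otimes> y = y \<otimes> x" "x \<otimes> z = z \<otimes> x"
  shows "x \<otimes> (y \<otimes> z) = (y \<otimes> z) \<otimes> x"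
  using assms by (metis m_assoc)

text \<open>An elementwise three subgroups lemma, with [x, y] = x y x^-1 y^-1: here [a, b] is
  central and [g^-1, a] commutes with b. Moving a to the right through b, g, b^-1, g^-1 leaves
  behind u, v, u^-1, v^-1, and these cancel.\<close>

lemma commute_commutator:
  assumes [simp]: "a \<in> carrier G" "b \<in> carrier G" "g \<in> carrier G"
    and z: "\<And>x. x \<in> carrier G \<Longrightarrow> (a \<otimes> b \<otimes> inv a \<otimes> inv b) \<otimes> x = x \<otimes> (a \<otimes> b \<otimes> inv a \<otimes> inv b)"
    and y: "(inv g \<otimes> a \<otimes> g \<otimes> inv a) \<otimes> b = b \<otimes> (inv g \<otimes> a \<otimes> g \<otimes> inv a)"
  shows "a \<otimes> (b \<otimes> g \<otimes> inv b \<otimes> inv g) = (b \<otimes> g \<otimes> inv b \<otimes> inv g) \<otimes> a"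
proof -
  define u where "u = a \<otimes> b \<otimes> inv a \<otimes> inv b"
  define v where "v = inv g \<otimes> a \<otimes> g \<otimes> inv a"
  have [simp]: "u \<in> carrier G" "v \<in> carrier G" by (simp_all add: u_def v_def)
  have ab: "a \<otimes> b = u \<otimes> b \<otimes> a" by (simp add: u_def m_assoc)
  have ag: "a \<otimes> g = g \<otimes> v \<otimes> a" by (simp add: v_def m_assoc)
  have vb: "v \<otimes> inv b = inv b \<otimes> v"
    using y unfolding v_def[symmetric] by (intro commute_inv) simp_all
  have ab': "a \<otimes> inv b = inv u \<otimes> inv b \<otimes> a"
  proof -
    have "a = (a \<otimes> b) \<otimes> inv b"
      by (simp add: m_assoc)
    also have "\<dots> = b \<otimes> (u \<otimes> (a \<otimes> inv b))"
      unfolding ab using z[of b, folded u_def] by (simp add: m_assoc[symmetric])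
    finally have "inv u \<otimes> (inv b \<otimes> a) = inv u \<otimes> (inv b \<otimes> (b \<otimes> (u \<otimes> (a \<otimes> inv b))))"
      by simp
    then show ?thesis by (simp add: m_assoc)
  qed
  have ag': "a \<otimes> inv g = inv v \<otimes> inv g \<otimes> a"
  proof -
    have "a = (a \<otimes> g) \<otimes> inv g"
      by (simp add: m_assoc)
    also have "\<dots> = g \<otimes> (v \<otimes> (a \<otimes> inv g))"
      unfolding ag by (simp add: m_assoc)
    finally have "inv v \<otimes> (inv g \<otimes> a) = inv v \<otimes> (inv g \<otimes> (g \<otimes> (v \<otimes> (a \<otimes> inv g))))"
      by simp
    then show ?thesis by (simp add: m_assoc)
  qed
  have "a \<otimes> (b \<otimes> g \<otimes> inv b \<otimes> inv g) = (a \<otimes> b) \<otimes> g \<otimes> inv b \<otimes> inv g"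
    by (simp add: m_assoc)
  also have "\<dots> = u \<otimes> b \<otimes> (a \<otimes> g) \<otimes> inv b \<otimes> inv g"
    by (simp add: ab m_assoc)
  also have "\<dots> = u \<otimes> b \<otimes> g \<otimes> v \<otimes> (a \<otimes> inv b) \<otimes> inv g"
    by (simp add: ag m_assoc)
  also have "\<dots> = u \<otimes> b \<otimes> g \<otimes> v \<otimes> inv u \<otimes> inv b \<otimes> (a \<otimes> inv g)"
    by (simp add: ab' m_assoc)
  also have "\<dots> = u \<otimes> (b \<otimes> g \<otimes> v) \<otimes> inv u \<otimes> inv b \<otimes> inv v \<otimes> inv g \<otimes> a"
    by (simp add: ag' m_assoc)
  also have "\<dots> = (b \<otimes> g \<otimes> v) \<otimes> u \<otimes> inv u \<otimes> inv b \<otimes> inv v \<otimes> inv g \<otimes> a"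
    using z[of "b \<otimes> g \<otimes> v"] unfolding u_def[symmetric] by simp
  also have "\<dots> = b \<otimes> g \<otimes> (v \<otimes> inv b) \<otimes> inv v \<otimes> inv g \<otimes> a"
    by (simp add: m_assoc)
  also have "\<dots> = (b \<otimes> g \<otimes> inv b \<otimes> inv g) \<otimes> a"
    by (simp add: vb m_assoc)
  finally show ?thesis .
qed

lemma commutator_mem_iff:
  assumes "N \<lhd> G" "x \<in> carrier G" "y \<in> carrier G"
  shows "x \<otimes> y \<otimes> inv x \<otimes> inv y \<in> N \<longleftrightarrow>
    (N #> x) \<otimes>\<^bsub>G Mod N\<^esub> (N #> y) = (N #> y) \<otimes>\<^bsub>G Mod N\<^esub> (N #> x)"
proof -
  interpret N: normal N G by (rule assms)
  have "(N #> x) \<otimes>\<^bsub>G Mod N\<^esub> (N #> y) = (N #> y) \<otimes>\<^bsub>G Mod N\<^esub> (N #> x) \<longleftrightarrow> N #> (x \<otimes> y) = N #> (y \<otimes> x)"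
    using assms by (simp add: FactGroup_def N.rcos_sum)
  also have "\<dots> \<longleftrightarrow> x \<otimes> y \<otimes> inv (y \<otimes> x) \<in> N"
    using rcos_self[of "x \<otimes> y" N] repr_independence[of "x \<otimes> y" N "y \<otimes> x"] N.rcos_module[of "y \<otimes> x" "x \<otimes> y"] assms
    by (metis N.subgroup_axioms m_closed is_group)
  also have "x \<otimes> y \<otimes> inv (y \<otimes> x) = x \<otimes> y \<otimes> inv x \<otimes> inv y"
    using assms by (simp add: inv_mult_group m_assoc)
  finally show ?thesis ..
qed

text \<open>By the three subgroups argument, [a, [b, g]] is controlled by [[a, b], g] and
  [[g^-1, a], b]. The second of these calls the induction hypothesis at \<alpha> + 1, so \<alpha>
  has to vary in the induction on j.\<close>

lemma commutator_lower_central: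
  assumes "1 \<le> \<alpha>" "a \<in> lower_central G \<alpha>" "b \<in> lower_central G ((osucc ^^ j) 1)"
  shows "a \<otimes> b \<otimes> inv a \<otimes> inv b \<in> lower_central G ((osucc ^^ Suc j) \<alpha>)"
  using assms
proof (induction j arbitrary: \<alpha> a b)
  case 0
  then show ?case
    using commutator_in_lower_central by (simp add: lower_central_1)
next
  case (Suc j)
  define N where "N = lower_central G ((osucc ^^ Suc (Suc j)) \<alpha>)"
  have "N \<lhd> G" unfolding N_def by (rule lower_central_normal)
  then interpret N: normal N G .
  interpret Q: group "G Mod N" by (rule N.factorgroup_is_group)
  interpret \<pi>: group_hom G "G Mod N" "\<lambda>x. N #> x"
    by unfold_locales (rule N.r_coset_hom_Mod)
  have le: "1 \<le> (osucc ^^ i) \<beta>" if "1 \<le> \<beta>" for i \<beta>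
    using that le_funpow_osucc by (rule order.trans)
  \<comment> \<open>The elements commuting with the \<alpha>-th term modulo N. They form a subgroup,
    so only the generators [b, g] of the next finite term have to be tested.\<close>
  define C where "C = {c \<in> carrier G. \<forall>a \<in> lower_central G \<alpha>. a \<otimes> c \<otimes> inv a \<otimes> inv c \<in> N}"
  have C: "c \<in> C \<longleftrightarrow> c \<in> carrier G \<and> (\<forall>a \<in> lower_central G \<alpha>.
      (N #> a) \<otimes>\<^bsub>G Mod N\<^esub> (N #> c) = (N #> c) \<otimes>\<^bsub>G Mod N\<^esub> (N #> a))" for c
    unfolding C_def using commutator_mem_iff[OF \<open>N \<lhd> G\<close> lower_central_closed] by blast
  have "subgroup C G"
  proof (rule subgroupI)
    show "C \<subseteq> carrier G" by (auto simp: C_def)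
    show "C \<noteq> {}"
      unfolding C_def using lower_central_closed by (auto intro!: exI[of _ \<one>])
  next
    fix c assume c: "c \<in> C"
    then have [simp]: "c \<in> carrier G" by (simp add: C_def)
    have "(N #> a) \<otimes>\<^bsub>G Mod N\<^esub> (N #> inv c) = (N #> inv c) \<otimes>\<^bsub>G Mod N\<^esub> (N #> a)"
      if a: "a \<in> lower_central G \<alpha>" for a
    proof -
      note [simp] = lower_central_closed[OF a]
      show ?thesis
        using Q.commute_inv[of "N #> a" "N #> c"] c a unfolding C by simp
    qed
    then show "inv c \<in> C"
      unfolding C by simp
  next
    fix c d assume "c \<in> C" "d \<in> C"
    then have [simp]: "c \<in> carrier G" "d \<in> carrier G"
      by (simp_all add: C_def)
    have "(N #> a) \<otimes>\<^bsub>G Mod N\<^esub> (N #> (c \<otimes> d)) = (N #> (c \<otimes> d)) \<otimes>\<^bsub>G Mod N\<^esub> (N #> a)"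
      if a: "a \<in> lower_central G \<alpha>" for a
    proof -
      note [simp] = lower_central_closed[OF a]
      show ?thesis
        using Q.commute_mult[of "N #> a" "N #> c" "N #> d"] \<open>c \<in> C\<close> \<open>d \<in> C\<close> a
        unfolding C by simp
    qed
    then show "c \<otimes> d \<in> C"
      unfolding C by simp
  qed
  have "lower_central G (osucc ((osucc ^^ j) 1)) \<subseteq> C"
  proof (rule lower_central_osucc_subset[OF le[OF order_refl] \<open>subgroup C G\<close>])
    fix b g assume b: "b \<in> lower_central G ((osucc ^^ j) 1)" and g: "g \<in> carrier G"
    note [simp] = lower_central_closed[OF b] g
    have "(N #> a) \<otimes>\<^bsub>G Mod N\<^esub> (N #> (b \<otimes> g \<otimes> inv b \<otimes> inv g)) =
        (N #> (b \<otimes> g \<otimes> inv b \<otimes> inv g)) \<otimes>\<^bsub>G Mod N\<^esub> (N #> a)"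
      if a: "a \<in> lower_central G \<alpha>" for a
    proof -
      note [simp] = lower_central_closed[OF a]
      define z where "z = a \<otimes> b \<otimes> inv a \<otimes> inv b"
      define y where "y = inv g \<otimes> a \<otimes> g \<otimes> inv a"
      have [simp]: "z \<in> carrier G" "y \<in> carrier G" by (simp_all add: z_def y_def)
      \<comment> \<open>The induction hypothesis puts [a, b] into the term whose successor is N, so
        it is central modulo N.\<close>
      have "z \<in> lower_central G ((osucc ^^ Suc j) \<alpha>)"
        unfolding z_def using Suc.prems(1) a b by (rule Suc.IH)
      then have "z \<otimes> x \<otimes> inv z \<otimes> inv x \<in> N" if "x \<in> carrier G" for x
        using commutator_in_lower_central[OF le[OF Suc.prems(1), of "Suc j"]] that by (simp add: N_def)
      then have z: "(N #> z) \<otimes>\<^bsub>G Mod N\<^esub> (N #> x) = (N #> x) \<otimes>\<^bsub>G Mod N\<^esub> (N #> z)" if "x \<in> carrier G" for x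
        using commutator_mem_iff[OF \<open>N \<lhd> G\<close>] that by simp
      \<comment> \<open>This inverse is [g^-1, a], one step deeper than a. Starting the induction
        hypothesis at \<open>osucc \<alpha>\<close> makes up for the step that j lacks.\<close>
      have "inv (a \<otimes> inv g \<otimes> inv a \<otimes> inv (inv g)) \<in> lower_central G (osucc \<alpha>)"
        using commutator_in_lower_central[OF Suc.prems(1) a, of "inv g"]
        by (intro subgroup.m_inv_closed[OF lower_central_subgroup]) simp
      also have "inv (a \<otimes> inv g \<otimes> inv a \<otimes> inv (inv g)) = y"
        by (simp add: y_def inv_mult_group m_assoc)
      finally have "y \<otimes> b \<otimes> inv y \<otimes> inv b \<in> lower_central G ((osucc ^^ Suc j) (osucc \<alpha>))"
        using Suc.IH[OF one_le_osucc _ b] by blast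
      then have "y \<otimes> b \<otimes> inv y \<otimes> inv b \<in> N"
        by (simp add: N_def funpow_swap1)
      then have y: "(N #> y) \<otimes>\<^bsub>G Mod N\<^esub> (N #> b) = (N #> b) \<otimes>\<^bsub>G Mod N\<^esub> (N #> y)"
        using commutator_mem_iff[OF \<open>N \<lhd> G\<close>] by simp
      have carr: "\<exists>x\<in>carrier G. q = N #> x" if "q \<in> carrier (G Mod N)" for q
        using that by (auto simp: FactGroup_def RCOSETS_def)
      have "(N #> z) \<otimes>\<^bsub>G Mod N\<^esub> q = q \<otimes>\<^bsub>G Mod N\<^esub> (N #> z)" if "q \<in> carrier (G Mod N)" for q
        using carr[OF that] z by blast
      then show ?thesis
        using Q.commute_commutator[of "N #> a" "N #> b" "N #> g"] y
        unfolding z_def y_def by (simp del: \<pi>.hom_inv flip: \<pi>.hom_inv)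
    qed
    then show "b \<otimes> g \<otimes> inv b \<otimes> inv g \<in> C"
      unfolding C by simp
  qed
  then show ?case
    using Suc.prems by (auto simp: C_def N_def)
qed

text \<open>Since [h, g] = h (g h^-1 g^-1) and g acts on H as some p acts on P, the image of [h, g]
  is a commutator of \<theta> h with p. Each step of the series of G is thus matched by a step of
  the series of P, whose term at \<omega> is trivial. The element p may depend on both g and
  h.\<close>

lemma lower_central_descent:
  assumes "group P" "lower_central P omega = {\<one>\<^bsub>P\<^esub>}" and H: "subgroup H G"
    and \<theta>: "\<theta> \<in> hom (G\<lparr>carrier := H\<rparr>) P"
    and conj: "\<And>g h. g \<in> carrier G \<Longrightarrow> h \<in> H \<Longrightarrow> g \<otimes> h \<otimes> inv g \<in> H \<and>
      (\<exists>p\<in>carrier P. \<theta> (g \<otimes> h \<otimes> inv g) = p \<otimes>\<^bsub>P\<^esub> \<theta> h \<otimes>\<^bsub>P\<^esub> inv\<^bsub>P\<^esub> p)"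
    and \<alpha>: "1 \<le> \<alpha>" "lower_central G \<alpha> \<subseteq> H" "is_next_limit \<alpha> \<mu>"
  shows "lower_central G \<mu> \<subseteq> {h \<in> H. \<theta> h = \<one>\<^bsub>P\<^esub>}"
proof -
  interpret P: group P by (rule assms)
  interpret H: subgroup H G by (rule H)
  interpret \<theta>: group_hom "G\<lparr>carrier := H\<rparr>" P \<theta>
    using \<theta> subgroup_imp_group[OF H] by (simp add: group_hom_def group_hom_axioms_def P.is_group)
  have \<theta>: "\<theta> h \<in> carrier P" "\<theta> \<one> = \<one>\<^bsub>P\<^esub>" "\<theta> (h \<otimes> k) = \<theta> h \<otimes>\<^bsub>P\<^esub> \<theta> k" "\<theta> (inv h) = inv\<^bsub>P\<^esub> \<theta> h"
    if "h \<in> H" "k \<in> H" for h k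
    using that \<theta>.hom_closed[of h] \<theta>.hom_one \<theta>.hom_mult[of h k] \<theta>.hom_inv[of h]
      m_inv_consistent[OF H, of h] by auto
  have sub: "lower_central G ((osucc ^^ j) \<alpha>) \<subseteq> {h \<in> H. \<theta> h \<in> lower_central P ((osucc ^^ j) 1)}" for j
  proof (induction j)
    case 0
    then show ?case using \<alpha> \<theta> by (auto simp: lower_central_1)
  next
    case (Suc j)
    define K where "K = lower_central P ((osucc ^^ Suc j) 1)"
    interpret K: subgroup K P unfolding K_def by (rule P.lower_central_subgroup)
    have le: "1 \<le> (osucc ^^ i) \<beta>" if "1 \<le> \<beta>" for i \<beta>
      using that le_funpow_osucc by (rule order.trans)
    have "lower_central G (osucc ((osucc ^^ j) \<alpha>)) \<subseteq> {h \<in> H. \<theta> h \<in> K}"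
    proof (rule lower_central_osucc_subset)
      show "subgroup {h \<in> H. \<theta> h \<in> K} G"
      proof (rule subgroupI)
        show "{h \<in> H. \<theta> h \<in> K} \<noteq> {}"
          using \<theta>(2)[of \<one> \<one>] K.one_closed by (auto intro!: exI[of _ \<one>])
      qed (auto simp: \<theta>)
    next
      fix h g assume "h \<in> lower_central G ((osucc ^^ j) \<alpha>)" and g: "g \<in> carrier G"
      then have h: "h \<in> H" "\<theta> h \<in> lower_central P ((osucc ^^ j) 1)" using Suc by auto
      obtain p where p: "p \<in> carrier P" "g \<otimes> inv h \<otimes> inv g \<in> H"
        "\<theta> (g \<otimes> inv h \<otimes> inv g) = p \<otimes>\<^bsub>P\<^esub> \<theta> (inv h) \<otimes>\<^bsub>P\<^esub> inv\<^bsub>P\<^esub> p"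
        using conj[OF g H.m_inv_closed[OF h(1)]] by blast
      have eq: "h \<otimes> g \<otimes> inv h \<otimes> inv g = h \<otimes> (g \<otimes> inv h \<otimes> inv g)"
        using g h by (simp add: m_assoc)
      have "\<theta> h \<otimes>\<^bsub>P\<^esub> p \<otimes>\<^bsub>P\<^esub> inv\<^bsub>P\<^esub> \<theta> h \<otimes>\<^bsub>P\<^esub> inv\<^bsub>P\<^esub> p \<in> K"
        unfolding K_def using P.commutator_in_lower_central[OF le[OF order_refl] h(2) p(1)] by simp
      then have "\<theta> (h \<otimes> g \<otimes> inv h \<otimes> inv g) \<in> K"
        unfolding eq using h p g by (simp add: \<theta> P.m_assoc)
      then show "h \<otimes> g \<otimes> inv h \<otimes> inv g \<in> {h \<in> H. \<theta> h \<in> K}"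
        using h p by (simp add: eq)
    qed (rule le[OF \<alpha>(1)])
    then show ?case by (simp add: K_def)
  qed
  have "is_next_limit 1 omega"
    unfolding one_ordinal_def by (rule is_next_limit_osucc[OF is_next_limit_omega])
  then have P: "(\<Inter>j. lower_central P ((osucc ^^ j) 1)) = {\<one>\<^bsub>P\<^esub>}"
    using P.lower_central_next_limit[OF order_refl] assms(2) by simp
  show ?thesis
  proof
    fix h assume "h \<in> lower_central G \<mu>"
    then have h: "h \<in> lower_central G ((osucc ^^ j) \<alpha>)" for j
      unfolding lower_central_next_limit[OF \<alpha>(1,3)] by simp
    have "h \<in> H"
      using h[of 0] \<alpha>(2) by auto
    moreover have "\<theta> h \<in> (\<Inter>j. lower_central P ((osucc ^^ j) 1))"
    proof
      show "\<theta> h \<in> lower_central P ((osucc ^^ j) 1)" for j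
        using sub[of j] h[of j] by auto
    qed
    ultimately show "h \<in> {h \<in> H. \<theta> h = \<one>\<^bsub>P\<^esub>}"
      unfolding P by simp
  qed
qed

end


section \<open>The Magnus expansion\<close>

text \<open>
  A function \<open>P :: 'a list \<Rightarrow> int\<close> is read as the non-commutative formal power series with
  coefficient \<open>P u\<close> at the monomial \<open>u\<close>; \<open>conv\<close> is the product of such series.
\<close>

fun conv :: "('a list \<Rightarrow> int) \<Rightarrow> ('a list \<Rightarrow> int) \<Rightarrow> 'a list \<Rightarrow> int"
  where
    "conv P Q [] = P [] * Q []"
  | "conv P Q (x # u) = P [] * Q (x # u) + conv (\<lambda>v. P (x # v)) Q u"

definition unit_series :: "'a list \<Rightarrow> int"
  where "unit_series u = (if u = [] then 1 else 0)"

section \<open>Algebra of power series and their lowest terms\<close>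

lemma conv_add_left: "conv (\<lambda>v. P v + P' v) Q u = conv P Q u + conv P' Q u"
  by (induction u arbitrary: P P') (simp_all add: algebra_simps)

lemma conv_zero_left [simp]: "conv (\<lambda>_. 0) Q u = 0"
  by (induction u) simp_all

lemma conv_zero_right [simp]: "conv P (\<lambda>_. 0) u = 0"
  by (induction u arbitrary: P) simp_all

lemma conv_add_right: "conv P (\<lambda>v. Q v + Q' v) u = conv P Q u + conv P Q' u"
  by (induction u arbitrary: P) (simp_all add: algebra_simps)

lemma conv_scale_right: "conv P (\<lambda>v. c * Q v) u = c * conv P Q u"
  by (induction u arbitrary: P) (simp_all add: algebra_simps)

lemma conv_sum_right: "conv P (\<lambda>v. \<Sum>i\<in>I. c i * Q i v) u = (\<Sum>i\<in>I. c i * conv P (Q i) u)"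
  by (induction I rule: infinite_finite_induct) (simp_all add: conv_add_right conv_scale_right)

lemma conv_cong_right:
  "(\<And>v. length v \<le> length u \<Longrightarrow> Q v = Q' v) \<Longrightarrow> conv P Q u = conv P Q' u"
  by (induction u arbitrary: P) simp_all

lemma conv_unit_left: "conv unit_series Q = Q"
proof
  show "conv unit_series Q u = Q u" for u
    by (cases u) (simp_all add: unit_series_def)
qed

lemma conv_lowest_left:
  "(\<And>v. length v < length u \<Longrightarrow> P v = 0) \<Longrightarrow> conv P Q u = P u * Q []"
  by (induction u arbitrary: P) simp_all

lemma conv_lowest_right:
  assumes "\<And>v. length v < length u \<Longrightarrow> Q v = 0"
  shows "conv P Q u = P [] * Q u"
proof (cases u)
  case (Cons x u')
  have "conv (\<lambda>v. P (x # v)) Q u' = conv (\<lambda>v. P (x # v)) (\<lambda>_. 0) u'"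
    using assms Cons by (intro conv_cong_right) simp
  then show ?thesis using Cons by simp
qed simp

lemma conv_split_left:
  "P [] = 1 \<Longrightarrow> conv P Q u = Q u + conv (\<lambda>s. if s = [] then 0 else P s) Q u"
  by (cases u) simp_all

lemma conv_split_right:
  "Q [] = 1 \<Longrightarrow> conv P Q u = P u + conv P (\<lambda>s. if s = [] then 0 else Q s) u"
  by (induction u arbitrary: P) simp_all

text \<open>Write P = 1 + P' and Q = 1 + Q'. The cross term P'Q' vanishes at u, because P' starts in
  degree \<open>length u\<close> at the earliest and Q' has no constant term.\<close>

lemma conv_leading:
  assumes "P [] = 1" "Q [] = 1" "u \<noteq> []" "\<And>v. v \<noteq> [] \<Longrightarrow> length v < length u \<Longrightarrow> P v = 0"
  shows "conv P Q u = P u + Q u" "conv Q P u = P u + Q u"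
proof -
  let ?P = "\<lambda>s. if s = [] then 0 else P s"
  have "conv ?P Q u = ?P u * Q []"
    using assms by (intro conv_lowest_left) auto
  then show "conv P Q u = P u + Q u"
    using assms by (simp add: conv_split_left[of P])
  have "conv Q ?P u = Q [] * ?P u"
    using assms by (intro conv_lowest_right) auto
  then show "conv Q P u = P u + Q u"
    using assms by (simp add: conv_split_right[of P])
qed

text \<open>Left multiplication by \<open>1 + x\<close> and by its inverse.\<close>

fun letter_act :: "'a letter \<Rightarrow> ('a list \<Rightarrow> int) \<Rightarrow> 'a list \<Rightarrow> int"
  where
    "letter_act a P [] = P []"
  | "letter_act (x, True) P (y # u) = P (y # u) + (if y = x then P u else 0)"
  | "letter_act (x, False) P (y # u) = P (y # u) - (if y = x then letter_act (x, False) P u else 0)"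

definition magnus :: "'a letter list \<Rightarrow> 'a list \<Rightarrow> int"
  where "magnus w = foldr letter_act w unit_series"

lemma letter_act_inv: "letter_act a (letter_act (letter_inv a) P) = P"
proof
  fix u
  obtain x s where a: "a = (x, s)" by (cases a)
  show "letter_act a (letter_act (letter_inv a) P) u = P u"
  proof (induction u)
    case (Cons y u)
    then show ?case
      by (cases s) (simp_all add: a letter_inv_def)
  qed simp
qed

lemma letter_act_conv: "letter_act a (conv P Q) = conv (letter_act a P) Q"
proof -
  have pos: "letter_act (x, True) (conv P Q) = conv (letter_act (x, True) P) Q" for x P
  proof
    show "letter_act (x, True) (conv P Q) u = conv (letter_act (x, True) P) Q u" for u
      by (cases u) (simp_all add: conv_add_left)
  qed
  obtain x s where a: "a = (x, s)" by (cases a)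
  show ?thesis
  proof (cases s)
    case False
    \<comment> \<open>Writing P as (1 + x) times (1 + x)^-1 P reduces the inverse letter to the
      positive one.\<close>
    have "P = letter_act (x, True) (letter_act (x, False) P)"
      using letter_act_inv[of "(x, True)"] by (simp add: letter_inv_def)
    then have "conv P Q = letter_act (x, True) (conv (letter_act (x, False) P) Q)"
      using pos by metis
    then show ?thesis
      using letter_act_inv[of "(x, False)"] False by (simp add: a letter_inv_def)
  qed (simp add: a pos)
qed

text \<open>A letter and its inverse act as mutually inverse maps, so free cancellation is invisible
  to the action. Hence the free group acts on series, and applying words to the series 1 gives a
  multiplicative map.\<close>

lemma foldr_letter_act_reduced_Cons:
  "foldr letter_act (reduced_Cons a w) P = letter_act a (foldr letter_act w P)"
  by (cases w) (auto simp: reduced_Cons_def letter_act_inv)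

lemma foldr_letter_act_mult:
  "foldr letter_act (v \<otimes>\<^bsub>free_group S\<^esub> w) P = foldr letter_act v (foldr letter_act w P)"
  unfolding free_group_def by (induction v) (simp_all add: foldr_letter_act_reduced_Cons)

lemma foldr_letter_act_conv: "foldr letter_act w P = conv (magnus w) P"
  unfolding magnus_def by (induction w) (simp_all add: conv_unit_left letter_act_conv)

lemma magnus_one: "magnus \<one>\<^bsub>free_group S\<^esub> = unit_series"
  by (simp add: magnus_def free_group_def)

lemma magnus_mult: "magnus (v \<otimes>\<^bsub>free_group S\<^esub> w) = conv (magnus v) (magnus w)"
  using foldr_letter_act_mult foldr_letter_act_conv unfolding magnus_def by metis

lemma magnus_Nil [simp]: "magnus w [] = 1"
  unfolding magnus_def by (induction w) (simp_all add: unit_series_def)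

lemma magnus_Cons: "magnus (a # w) = letter_act a (magnus w)"
  by (simp add: magnus_def)

lemma magnus_generator: "magnus [(x, True)] [y] = (if y = x then 1 else 0)"
  by (simp add: magnus_def unit_series_def)

lemma magnus_support: "magnus w u \<noteq> 0 \<Longrightarrow> set u \<subseteq> fst ` set w"
proof (induction w arbitrary: u)
  case Nil
  then show ?case by (auto simp: magnus_def unit_series_def split: if_splits)
next
  case (Cons a w)
  obtain x s where a: "a = (x, s)" by (cases a)
  show ?case
    using Cons.prems
  \<comment> \<open>A second induction, on the monomial: for an inverse letter,
    \<open>letter_act\<close> refers to its own value at a shorter monomial.\<close>
  proof (induction u)
    case (Cons y u)
    show ?case
    proof (cases "magnus w (y # u) = 0")
      case True
      then have "y = x \<and> (magnus w u \<noteq> 0 \<or> magnus (a # w) u \<noteq> 0)"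
        using Cons.prems by (cases s) (auto simp: a magnus_Cons split: if_splits)
      then show ?thesis
        using Cons.IH \<open>\<And>u. magnus w u \<noteq> 0 \<Longrightarrow> set u \<subseteq> fst ` set w\<close>[of u] by (auto simp: a)
    qed (use \<open>\<And>u. magnus w u \<noteq> 0 \<Longrightarrow> set u \<subseteq> fst ` set w\<close>[of "y # u"] in auto)
  qed simp
qed

section \<open>Dimension subgroups and additivity of leading coefficients\<close>

definition dimension_subgroup :: "'a set \<Rightarrow> nat \<Rightarrow> 'a letter list set"
  where "dimension_subgroup S k =
    {w \<in> carrier (free_group S). \<forall>u. u \<noteq> [] \<longrightarrow> length u < k \<longrightarrow> magnus w u = 0}"

lemma dimension_subgroup_1: "dimension_subgroup S 1 = carrier (free_group S)"
  by (auto simp: dimension_subgroup_def)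

text \<open>One factor in D_k is enough to push the cross terms above degree k. With k = 1, the
  linear coefficients are additive on the whole group.\<close>

lemma magnus_mult_leading:
  assumes "w \<in> dimension_subgroup S k" "u \<noteq> []" "length u \<le> k"
  shows "magnus (v \<otimes>\<^bsub>free_group S\<^esub> w) u = magnus v u + magnus w u"
    "magnus (w \<otimes>\<^bsub>free_group S\<^esub> v) u = magnus w u + magnus v u"
  using assms conv_leading[of "magnus w" "magnus v" u] by (auto simp: magnus_mult dimension_subgroup_def)

lemma magnus_inv_leading:
  assumes "w \<in> dimension_subgroup S k" "u \<noteq> []" "length u \<le> k"
  shows "magnus (inv\<^bsub>free_group S\<^esub> w) u = - magnus w u"
proof -
  interpret F: group "free_group S" by (rule group_free_group)
  have "w \<in> carrier (free_group S)"
    using assms by (simp add: dimension_subgroup_def)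
  then have "magnus (w \<otimes>\<^bsub>free_group S\<^esub> inv\<^bsub>free_group S\<^esub> w) u = 0"
    using assms by (simp add: magnus_one unit_series_def)
  then show ?thesis
    using magnus_mult_leading(2)[OF assms] by simp
qed

text \<open>With c = v w v^-1, the coefficients are compared in c v = v w, so that v^-1 is never
  expanded. The induction on the length supplies the vanishing of the lower coefficients of
  c.\<close>

lemma magnus_conj_leading:
  assumes "w \<in> dimension_subgroup S k" "v \<in> carrier (free_group S)" "u \<noteq> []" "length u \<le> k"
  shows "magnus (v \<otimes>\<^bsub>free_group S\<^esub> w \<otimes>\<^bsub>free_group S\<^esub> inv\<^bsub>free_group S\<^esub> v) u = magnus w u"
  using assms(3,4)
proof (induction u rule: length_induct)
  case (1 u)
  interpret F: group "free_group S" by (rule group_free_group)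
  let ?c = "v \<otimes>\<^bsub>free_group S\<^esub> w \<otimes>\<^bsub>free_group S\<^esub> inv\<^bsub>free_group S\<^esub> v"
  have w: "w \<in> carrier (free_group S)"
    using assms by (simp add: dimension_subgroup_def)
  have "magnus ?c s = 0" if "s \<noteq> []" "length s < length u" for s
    using 1 that assms(1) by (simp add: dimension_subgroup_def)
  then have "conv (magnus ?c) (magnus v) u = magnus ?c u + magnus v u"
    using 1 by (intro conv_leading) auto
  moreover have "conv (magnus ?c) (magnus v) = magnus (?c \<otimes>\<^bsub>free_group S\<^esub> v)"
    by (simp only: magnus_mult)
  moreover have "?c \<otimes>\<^bsub>free_group S\<^esub> v = v \<otimes>\<^bsub>free_group S\<^esub> w"
    using assms w by (simp add: F.m_assoc)
  ultimately show ?case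
    using magnus_mult_leading(1)[OF assms(1), of u v] 1 by simp
qed

lemma dimension_subgroup_normal: "dimension_subgroup S k \<lhd> free_group S"
proof -
  interpret F: group "free_group S" by (rule group_free_group)
  show ?thesis
  proof (rule F.normal_invI)
    show "subgroup (dimension_subgroup S k) (free_group S)"
    proof (rule F.subgroupI)
      have "\<one>\<^bsub>free_group S\<^esub> \<in> dimension_subgroup S k"
        by (simp add: dimension_subgroup_def magnus_one unit_series_def)
      then show "dimension_subgroup S k \<noteq> {}" by blast
      show "inv\<^bsub>free_group S\<^esub> w \<in> dimension_subgroup S k" if "w \<in> dimension_subgroup S k" for w
        using that magnus_inv_leading[OF that] by (simp add: dimension_subgroup_def)
      show "v \<otimes>\<^bsub>free_group S\<^esub> w \<in> dimension_subgroup S k"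
        if "v \<in> dimension_subgroup S k" "w \<in> dimension_subgroup S k" for v w
        using that magnus_mult_leading(1)[OF that(2)] by (simp add: dimension_subgroup_def)
    qed (auto simp: dimension_subgroup_def)
    show "v \<otimes>\<^bsub>free_group S\<^esub> w \<otimes>\<^bsub>free_group S\<^esub> inv\<^bsub>free_group S\<^esub> v \<in> dimension_subgroup S k"
      if "v \<in> carrier (free_group S)" "w \<in> dimension_subgroup S k" for v w
      using that magnus_conj_leading[OF that(2,1)] by (simp add: dimension_subgroup_def)
  qed
qed

text \<open>The inverse of 1 + x is 1 - x + x^2 - ..., but a monomial without equal neighbours meets
  only 1 - x. On such monomials letters of both signs are treated alike.\<close>

lemma magnus_Cons_distinct_adj:
  assumes "distinct_adj (y # v)"
  shows "magnus ((x, s) # w) (y # v) =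
    magnus w (y # v) + (if y = x then (if s then 1 else - 1) * magnus w v else 0)"
  using assms by (cases s; cases v) (auto simp: magnus_Cons)

text \<open>A syllable is a power of some 1 + x and contributes at most one letter to a monomial
  without equal neighbours. If there are as many letters as syllables, each syllable must
  contribute, so the first letters agree; this second case keeps the induction going.\<close>

lemma magnus_too_long:
  assumes "distinct_adj u"
    and "length (remdups_adj (map fst w)) < length u \<or>
      length (remdups_adj (map fst w)) = length u \<and> u \<noteq> [] \<and> hd u \<noteq> fst (hd w)"
  shows "magnus w u = 0"
  using assms
proof (induction w arbitrary: u)
  case Nil
  then show ?case by (auto simp: magnus_def unit_series_def)
next
  case (Cons a w)
  obtain x s where a: "a = (x, s)" by (cases a)
  obtain y v where u: "u = y # v"
    using Cons.prems by (cases u) auto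
  have v: "distinct_adj v" "v \<noteq> [] \<Longrightarrow> hd v \<noteq> y"
    using Cons.prems by (cases v; auto simp: u)+
  have 1: "magnus w (y # v) = 0"
    using Cons.prems by (intro Cons.IH) (cases w; auto simp: u a split: if_splits)+
  have 2: "magnus w v = 0" if "y = x"
  proof (rule Cons.IH[OF v(1)])
    have long: "length (remdups_adj (x # map fst w)) \<le> length v"
      using Cons.prems that by (simp add: u a)
    show "length (remdups_adj (map fst w)) < length v \<or>
      length (remdups_adj (map fst w)) = length v \<and> v \<noteq> [] \<and> hd v \<noteq> fst (hd w)"
    proof (cases w)
      case Nil
      then show ?thesis using long by auto
    next
      case (Cons b w')
      have "v \<noteq> []" using long by (cases v) simp_all
      with v(2) that have "hd v \<noteq> x" by simp
      show ?thesis
      proof (cases "fst b = x")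
        case True
        then have "length (remdups_adj (map fst w)) \<le> length v"
          using long by (simp add: Cons)
        then show ?thesis
          using True \<open>v \<noteq> []\<close> \<open>hd v \<noteq> x\<close> by (auto simp: Cons)
      next
        case False
        then show ?thesis using long by (simp add: Cons)
      qed
    qed
  qed
  show ?case
    using Cons.prems 1 2 by (simp add: u a magnus_Cons_distinct_adj)
qed

text \<open>
  If \<open>w\<close> has the syllables \<open>x\<^sub>1\<^sup>e\<^sup>1, \<dots>, x\<^sub>s\<^sup>e\<^sup>s\<close>, then the coefficient at \<open>x\<^sub>1\<dots>x\<^sub>s\<close> is
  the product of the exponents.
\<close>

lemma magnus_syllables:
  assumes "reduced w" "w \<noteq> []"
  shows "magnus w (remdups_adj (map fst w)) \<noteq> 0"
proof -
  \<comment> \<open>The coefficient is split into the first exponent, with its sign and its absolute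
    value \<open>e\<close>, and the coefficient at the remaining syllables. In a reduced word a
    syllable has letters of one sign only, so \<open>e\<close> grows and nothing cancels.\<close>
  have "magnus w (tl (remdups_adj (map fst w))) \<noteq> 0 \<and> (\<exists>e>0. magnus w (remdups_adj (map fst w)) =
      (if snd (hd w) then e else - e) * magnus w (tl (remdups_adj (map fst w))))"
    using assms
  proof (induction w)
    case (Cons a w)
    obtain x s where a: "a = (x, s)" by (cases a)
    let ?r = "\<lambda>w. remdups_adj (map fst w)"
    show ?case
    proof (cases w)
      case Nil
      then show ?thesis
        by (auto simp: a magnus_Cons magnus_def unit_series_def intro!: exI[of _ 1])
    next
      case w: (Cons b w')
      obtain y t where b: "b = (y, t)" by (cases b)
      have "reduced w"
        using Cons.prems by (cases w) (auto simp: reduced_def)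
      with Cons.IH w obtain e where e: "e > 0" "magnus w (tl (?r w)) \<noteq> 0"
          "magnus w (?r w) = (if t then e else - e) * magnus w (tl (?r w))"
        by (auto simp: b)
      have hd: "hd (?r w) = y" "?r w \<noteq> []" "distinct_adj (?r w)"
        by (simp_all add: w b)
      then obtain v where v: "?r w = y # v" by (cases "?r w") auto
      show ?thesis
      proof (cases "x = y")
        case True
        then have "s = t"
          using Cons.prems by (auto simp: reduced_def w a b letter_inv_def)
        have r: "?r (a # w) = x # v"
          using v True by (simp add: a w b)
        have "v = [] \<or> hd v \<noteq> x"
          using hd v True by (cases v) auto
        then have "magnus (a # w) v = magnus w v"
          using hd(3) unfolding v
          by (cases v) (auto simp: a magnus_Cons_distinct_adj True)
        moreover have "magnus (a # w) (x # v) = (if s then e + 1 else - (e + 1)) * magnus w v"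
          using hd(3) e(3) unfolding v by (simp add: a True magnus_Cons_distinct_adj \<open>s = t\<close> algebra_simps)
        ultimately show ?thesis
          unfolding r using e v by (auto simp: a intro!: exI[of _ "e + 1"])
      next
        case False
        have r: "?r (a # w) = x # y # v"
          using v False by (simp add: a w b)
        have d: "distinct_adj (x # y # v)"
          using hd(3) v False by simp
        \<comment> \<open>The syllables of w spell y # v, one letter short of this monomial, so x
          can only come from the new letter.\<close>
        have "magnus w (x # y # v) = 0"
          using v by (intro magnus_too_long d) simp
        then have "magnus (a # w) (x # y # v) = (if s then 1 else - 1) * magnus w (y # v)"
          using d by (simp add: a magnus_Cons_distinct_adj)
        moreover have "magnus (a # w) (y # v) = magnus w (y # v)"
          using d False by (simp add: a magnus_Cons_distinct_adj)
        moreover have "magnus w (y # v) \<noteq> 0"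
          using e v by simp
        ultimately show ?thesis
          unfolding r by (auto simp: a intro!: exI[of _ 1])
      qed
    qed
  qed simp
  then show ?thesis by (auto split: if_splits)
qed

text \<open>A nonempty reduced word with s syllables has a nonzero coefficient in degree s, so it is
  not in D_{s+1}.\<close>

lemma dimension_subgroup_Inter: "(\<Inter>k. dimension_subgroup S k) = {[]}"
proof -
  have "[] \<in> dimension_subgroup S k" for k
    by (simp add: dimension_subgroup_def free_group_def reduced_def magnus_def unit_series_def)
  moreover have "w = []" if w: "\<And>k. w \<in> dimension_subgroup S k" for w
  proof (rule ccontr)
    assume "w \<noteq> []"
    moreover have "reduced w"
      using w[of 0] by (simp add: dimension_subgroup_def free_group_def)
    ultimately show False
      using magnus_syllables[of w] w[of "Suc (length (remdups_adj (map fst w)))"]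
      by (auto simp: dimension_subgroup_def)
  qed
  ultimately show ?thesis by blast
qed

text \<open>Over at most one generator a nonempty reduced word is a single syllable, so its linear
  coefficient is nonzero. This disposes of the ranks 0 and 1.\<close>

lemma dimension_subgroup_2_trivial:
  assumes "S \<subseteq> {x}"
  shows "dimension_subgroup S 2 = {[]}"
proof -
  have "[] \<in> dimension_subgroup S 2"
    using dimension_subgroup_Inter[of S] by blast
  moreover have "w = []" if w: "w \<in> dimension_subgroup S 2" for w
  proof (rule ccontr)
    assume "w \<noteq> []"
    have "map fst w = replicate (length w) x"
      using w assms by (intro replicate_eqI) (auto simp: dimension_subgroup_def free_group_def)
    then have "remdups_adj (map fst w) = [x]"
      using \<open>w \<noteq> []\<close> by (simp add: remdups_adj_replicate)
    then show False
      using magnus_syllables[of w] w \<open>w \<noteq> []\<close>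
      by (auto simp: dimension_subgroup_def free_group_def)
  qed
  ultimately show ?thesis by blast
qed

section \<open>Homomorphisms of free groups as substitutions of power series\<close>

fun msubst :: "('a \<Rightarrow> 'b list \<Rightarrow> int) \<Rightarrow> 'a list \<Rightarrow> 'b list \<Rightarrow> int"
  where
    "msubst f [] = unit_series"
  | "msubst f (x # v) = conv (\<lambda>s. if s = [] then 0 else f x s) (msubst f v)"

text \<open>\<open>msubst f v\<close> is a product of one series without constant term for each
  letter of v, so it starts in degree \<open>length v\<close>. For this reason the substitution into
  a series is a finite sum in each degree.\<close>

lemma msubst_short: "length u < length v \<Longrightarrow> msubst f v u = 0"
proof (induction v arbitrary: u)
  case (Cons x v)
  then have "conv (\<lambda>s. if s = [] then 0 else f x s) (msubst f v) u = 0 * msubst f v u"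
    by (subst conv_lowest_right) auto
  then show ?case by simp
qed simp

text \<open>In the lowest possible degree every factor contributes exactly its linear part.\<close>

lemma msubst_same_length:
  "length v = length u \<Longrightarrow> msubst f v u = prod_list (map2 (\<lambda>x y. f x [y]) v u)"
proof (induction v u rule: list_induct2)
  case (Cons x v y u)
  have "conv (\<lambda>s. f x (y # s)) (msubst f v) u = f x [y] * msubst f v u"
    using Cons.hyps by (intro conv_lowest_right) (simp add: msubst_short)
  then show ?case using Cons by simp
qed (simp add: unit_series_def)

text \<open>
  The series obtained from \<open>P\<close> by substituting \<open>f x - 1\<close> for each variable \<open>x \<in> S\<close>, where the
  series \<open>f x\<close> has constant term 1.
\<close>

definition series_subst :: "'a set \<Rightarrow> ('a \<Rightarrow> 'b list \<Rightarrow> int) \<Rightarrow> ('a list \<Rightarrow> int) \<Rightarrow> 'b list \<Rightarrow> int"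
  where "series_subst S f P u = (\<Sum>v | set v \<subseteq> S \<and> length v \<le> length u. P v * msubst f v u)"

lemma series_subst_bound:
  assumes "finite S" "length u \<le> m"
  shows "series_subst S f P u = (\<Sum>v | set v \<subseteq> S \<and> length v \<le> m. P v * msubst f v u)"
  unfolding series_subst_def using assms
  by (intro sum.mono_neutral_left) (auto simp: finite_lists_length_le msubst_short)

lemma series_subst_unit:
  assumes "finite S"
  shows "series_subst S f unit_series = unit_series"
proof
  fix u :: "'b list"
  have "series_subst S f unit_series u = (\<Sum>v\<in>{[]}. unit_series v * msubst f v u)"
    unfolding series_subst_def using assms
    by (intro sum.mono_neutral_right) (auto simp: finite_lists_length_le unit_series_def)
  then show "series_subst S f unit_series u = unit_series u"
    by (simp add: unit_series_def)
qed

lemma series_subst_letter_act: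
  assumes "finite S" "x \<in> S" "f x [] = 1"
  shows "series_subst S f (letter_act (x, True) P) = conv (f x) (series_subst S f P)"
proof
  fix u
  let ?L = "\<lambda>m. {v. set v \<subseteq> S \<and> length v \<le> m}" and ?f = "\<lambda>s. if s = [] then 0 else f x s"
  \<comment> \<open>This is the series x P, so that P + Q is (1 + x) P. The length bound is raised
    by one below because the monomials of Q are those of P with x prepended.\<close>
  define Q where "Q v = (case v of [] \<Rightarrow> 0 | y # v' \<Rightarrow> if y = x then P v' else 0)" for v
  have "letter_act (x, True) P v = P v + Q v" for v
    by (cases v) (simp_all add: Q_def)
  then have "series_subst S f (letter_act (x, True) P) u =
      (\<Sum>v\<in>?L (Suc (length u)). P v * msubst f v u) + (\<Sum>v\<in>?L (Suc (length u)). Q v * msubst f v u)"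
    using assms(1) by (simp add: series_subst_bound[of S u "Suc (length u)"] algebra_simps sum.distrib)
  also have "(\<Sum>v\<in>?L (Suc (length u)). P v * msubst f v u) = series_subst S f P u"
    using assms(1) by (simp add: series_subst_bound[of S u "Suc (length u)"])
  also have "(\<Sum>v\<in>?L (Suc (length u)). Q v * msubst f v u) = (\<Sum>v\<in>(#) x ` ?L (length u). Q v * msubst f v u)"
    using assms(1,2)
    by (intro sum.mono_neutral_right) (auto simp: finite_lists_length_le Q_def split: list.splits)
  also have "\<dots> = (\<Sum>v\<in>?L (length u). P v * conv ?f (msubst f v) u)"
    by (subst sum.reindex) (auto simp: Q_def)
  also have "\<dots> = conv ?f (\<lambda>s. \<Sum>v\<in>?L (length u). P v * msubst f v s) u"
    by (rule conv_sum_right[symmetric])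
  also have "\<dots> = conv ?f (series_subst S f P) u"
    using assms(1) by (intro conv_cong_right) (simp add: series_subst_bound)
  finally show "series_subst S f (letter_act (x, True) P) u = conv (f x) (series_subst S f P) u"
    using assms(3) by (simp add: conv_split_left[of "f x"])
qed

lemma free_group_Cons:
  assumes "a # w \<in> carrier (free_group S)"
  shows "[a] \<in> carrier (free_group S)" "w \<in> carrier (free_group S)" "a # w = [a] \<otimes>\<^bsub>free_group S\<^esub> w"
  using assms by (cases w; auto simp: free_group_def reduced_def reduced_Cons_def)+

lemma free_group_inv_letter:
  assumes "x \<in> S"
  shows "inv\<^bsub>free_group S\<^esub> [(x, True)] = [(x, False)]"
proof -
  interpret F: group "free_group S" by (rule group_free_group)
  show ?thesis
    using assms by (intro F.inv_equality) (auto simp: free_group_def reduced_Cons_def letter_inv_def reduced_def)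
qed

text \<open>Both sides turn left multiplication by a letter into left multiplication by the
  expansion of its image, and they agree on the empty word. For an inverse letter this follows from
  the positive letter by cancellation.\<close>

lemma magnus_hom:
  assumes \<phi>: "\<phi> \<in> hom (free_group S) (free_group T)" and S: "finite S" and w: "w \<in> carrier (free_group S)"
  shows "magnus (\<phi> w) = series_subst S (\<lambda>x. magnus (\<phi> [(x, True)])) (magnus w)"
proof -
  interpret F: group "free_group S" by (rule group_free_group)
  interpret F': group "free_group T" by (rule group_free_group)
  interpret \<phi>: group_hom "free_group S" "free_group T" \<phi>
    using \<phi> by unfold_locales
  let ?\<Phi> = "series_subst S (\<lambda>x. magnus (\<phi> [(x, True)]))"
  have letter: "?\<Phi> (letter_act a P) = conv (magnus (\<phi> [a])) (?\<Phi> P)" if a: "[a] \<in> carrier (free_group S)" for a P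
  proof -
    obtain x s where xs: "a = (x, s)" by (cases a)
    then have x: "x \<in> S" "[(x, True)] \<in> carrier (free_group S)"
      using a by (auto simp: free_group_def reduced_def)
    have pos: "?\<Phi> (letter_act (x, True) P) = conv (magnus (\<phi> [(x, True)])) (?\<Phi> P)" for P
      using S x by (intro series_subst_letter_act) simp_all
    show ?thesis
    proof (cases s)
      case False
      have "?\<Phi> P = foldr letter_act (\<phi> [(x, True)]) (?\<Phi> (letter_act (x, False) P))"
        using pos[of "letter_act (x, False) P"] letter_act_inv[of "(x, True)" P]
        by (simp add: letter_inv_def foldr_letter_act_conv)
      then have "foldr letter_act (\<phi> [(x, False)]) (?\<Phi> P) =
          foldr letter_act (\<phi> [(x, False)] \<otimes>\<^bsub>free_group T\<^esub> \<phi> [(x, True)]) (?\<Phi> (letter_act (x, False) P))"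
        by (simp only: foldr_letter_act_mult)
      also have "\<phi> [(x, False)] \<otimes>\<^bsub>free_group T\<^esub> \<phi> [(x, True)] = \<one>\<^bsub>free_group T\<^esub>"
        using x free_group_inv_letter[OF x(1)] \<phi>.hom_inv[OF x(2)] by simp
      finally show ?thesis
        using False xs by (simp add: foldr_letter_act_conv magnus_one conv_unit_left)
    qed (simp add: xs pos)
  qed
  show ?thesis
    using w
  proof (induction w)
    case Nil
    then show ?case
      using \<phi>.hom_one S magnus_one[of T] magnus_one[of S]
      by (simp add: free_group_def series_subst_unit)
  next
    case (Cons a w)
    then have "magnus (\<phi> (a # w)) = conv (magnus (\<phi> [a])) (magnus (\<phi> w))"
      using free_group_Cons[OF Cons.prems] by (metis \<phi>.hom_mult magnus_mult)
    then show ?case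
      using Cons.IH free_group_Cons(1,2)[OF Cons.prems] letter by (simp add: magnus_Cons)
  qed
qed

text \<open>Nonempty monomials shorter than k have coefficient 0 in w, and longer ones are
  substituted by terms of degree above k. What survives in degree k is transformed by the k-fold
  tensor power of the linear part. The first claim also shows that homomorphisms respect
  D_k.\<close>

lemma magnus_hom_leading:
  assumes \<phi>: "\<phi> \<in> hom (free_group S) (free_group T)" and S: "finite S"
    and w: "w \<in> dimension_subgroup S k" and u: "u \<noteq> []"
  shows "length u < k \<Longrightarrow> magnus (\<phi> w) u = 0"
    and "length u = k \<Longrightarrow> magnus (\<phi> w) u = (\<Sum>v | set v \<subseteq> S \<and> length v = k.
      magnus w v * prod_list (map2 (\<lambda>x y. magnus (\<phi> [(x, True)]) [y]) v u))"
proof -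
  let ?f = "\<lambda>x. magnus (\<phi> [(x, True)])"
  have w': "w \<in> carrier (free_group S)" "\<And>v. v \<noteq> [] \<Longrightarrow> length v < k \<Longrightarrow> magnus w v = 0"
    using w by (auto simp: dimension_subgroup_def)
  have eq: "magnus (\<phi> w) u = (\<Sum>v | set v \<subseteq> S \<and> length v \<le> length u. magnus w v * msubst ?f v u)"
    using magnus_hom[OF \<phi> S w'(1)] by (simp add: series_subst_def)
  have zero: "magnus w v * msubst ?f v u = 0" if "length v < k" for v
    using that w'(2)[of v] u by (cases "v = []") (auto simp: unit_series_def)
  show "magnus (\<phi> w) u = 0" if "length u < k"
    unfolding eq using that zero by (intro sum.neutral) auto
  show "magnus (\<phi> w) u = (\<Sum>v | set v \<subseteq> S \<and> length v = k.
      magnus w v * prod_list (map2 (\<lambda>x y. ?f x [y]) v u))" if k: "length u = k"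
  proof -
    have "magnus (\<phi> w) u = (\<Sum>v | set v \<subseteq> S \<and> length v = k. magnus w v * msubst ?f v u)"
      unfolding eq
    proof (rule sum.mono_neutral_right)
      show "finite {v. set v \<subseteq> S \<and> length v \<le> length u}"
        using S by (rule finite_lists_length_le)
      show "{v. set v \<subseteq> S \<and> length v = k} \<subseteq> {v. set v \<subseteq> S \<and> length v \<le> length u}"
        using k by auto
      show "\<forall>v\<in>{v. set v \<subseteq> S \<and> length v \<le> length u} - {v. set v \<subseteq> S \<and> length v = k}.
          magnus w v * msubst ?f v u = 0"
        using k by (intro ballI zero) auto
    qed
    then show ?thesis
      using k by (simp add: msubst_same_length)
  qed
qed


section \<open>Tensor powers of the abelianization\<close>

lemma frag_cmul_diff: "frag_cmul c (x - y) = frag_cmul c x - frag_cmul c y"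
  by (rule poly_mapping_eqI) (simp add: lookup_minus algebra_simps)

lemma frag_cmul_sum_left: "frag_cmul (\<Sum>i\<in>I. c i * d i) x = (\<Sum>i\<in>I. frag_cmul (c i) (frag_cmul (d i) x))"
  by (induction I rule: infinite_finite_induct) (simp_all add: frag_cmul_distrib)

lemma subgroup_tensor_relations:
  assumes "group A"
  shows "subgroup (tensor_relations A k) (free_Abelian_group (tuples A k))"
proof -
  interpret F: group "free_Abelian_group (tuples A k)" by simp
  show ?thesis
    unfolding tensor_relations_def
    by (rule F.generate_is_subgroup[OF tensor_relators_subset[OF assms]])
qed

lemma tensor_relations_closed:
  assumes "group A"
  shows "0 \<in> tensor_relations A k"
    and "x \<in> tensor_relations A k \<Longrightarrow> y \<in> tensor_relations A k \<Longrightarrow> x + y \<in> tensor_relations A k"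
    and "x \<in> tensor_relations A k \<Longrightarrow> - x \<in> tensor_relations A k"
    and "x \<in> tensor_relations A k \<Longrightarrow> y \<in> tensor_relations A k \<Longrightarrow> x - y \<in> tensor_relations A k"
    and "x \<in> tensor_relations A k \<Longrightarrow> frag_cmul c x \<in> tensor_relations A k"
proof -
  interpret R: subgroup "tensor_relations A k" "free_Abelian_group (tuples A k)"
    by (rule subgroup_tensor_relations[OF assms])
  show zero: "0 \<in> tensor_relations A k"
    using R.one_closed by simp
  show minus: "- x \<in> tensor_relations A k" if "x \<in> tensor_relations A k" for x
    using R.m_inv_closed[OF that] R.mem_carrier[OF that] by simp
  show "x + y \<in> tensor_relations A k" if "x \<in> tensor_relations A k" "y \<in> tensor_relations A k" for x y
    using R.m_closed[OF that] by simp
  show diff: "x - y \<in> tensor_relations A k" if "x \<in> tensor_relations A k" "y \<in> tensor_relations A k" for x y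
    using R.m_closed[OF that(1) minus[OF that(2)]] by simp
  show "frag_cmul c x \<in> tensor_relations A k" if "x \<in> tensor_relations A k"
    by (rule frag_closure_minus_cmul[where P = "\<lambda>x. x \<in> tensor_relations A k"]) (auto intro: zero diff that)
qed

lemma tensor_relations_sum:
  assumes "group A" "\<And>i. i \<in> I \<Longrightarrow> x i \<in> tensor_relations A k"
  shows "sum x I \<in> tensor_relations A k"
  using assms(2)
  by (induction I rule: infinite_finite_induct) (auto intro: tensor_relations_closed[OF assms(1)])

lemma tensor_relation:
  assumes "length xs + Suc (length ys) = k" "set xs \<union> set ys \<union> {a, b} \<subseteq> carrier A"
  shows "frag_of (xs @ (a \<otimes>\<^bsub>A\<^esub> b) # ys) - frag_of (xs @ a # ys) - frag_of (xs @ b # ys) \<in> tensor_relations A k"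
  unfolding tensor_relations_def
  by (rule generate.incl) (use assms in \<open>unfold tensor_relators_def, blast\<close>)

lemma tensor_relation_one:
  assumes "group A" "length xs + Suc (length ys) = k" "set xs \<union> set ys \<subseteq> carrier A"
  shows "frag_of (xs @ \<one>\<^bsub>A\<^esub> # ys) \<in> tensor_relations A k"
proof -
  interpret A: group A by (rule assms)
  \<comment> \<open>The relator with both entries equal to the identity is minus the tensor in
    question.\<close>
  have "- (frag_of (xs @ (\<one>\<^bsub>A\<^esub> \<otimes>\<^bsub>A\<^esub> \<one>\<^bsub>A\<^esub>) # ys) - frag_of (xs @ \<one>\<^bsub>A\<^esub> # ys) - frag_of (xs @ \<one>\<^bsub>A\<^esub> # ys))
      \<in> tensor_relations A k"
    using assms by (intro tensor_relations_closed(3)[OF assms(1)] tensor_relation) auto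
  then show ?thesis by simp
qed

lemma tensor_coset_eq_iff:
  assumes "group A" "x \<in> carrier (free_Abelian_group (tuples A k))" "y \<in> carrier (free_Abelian_group (tuples A k))"
  shows "tensor_relations A k #>\<^bsub>free_Abelian_group (tuples A k)\<^esub> x =
      tensor_relations A k #>\<^bsub>free_Abelian_group (tuples A k)\<^esub> y \<longleftrightarrow> x - y \<in> tensor_relations A k"
proof -
  let ?F = "free_Abelian_group (tuples A k)" and ?R = "tensor_relations A k"
  interpret F: group ?F by simp
  interpret R: subgroup ?R ?F by (rule subgroup_tensor_relations[OF assms(1)])
  have "?R #>\<^bsub>?F\<^esub> x = ?R #>\<^bsub>?F\<^esub> y \<longleftrightarrow> x \<in> ?R #>\<^bsub>?F\<^esub> y"
    using F.repr_independence[OF _ assms(3) R.subgroup_axioms] F.rcos_self[OF assms(2) R.subgroup_axioms] by blast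
  also have "\<dots> \<longleftrightarrow> (\<exists>r\<in>?R. x = r + y)"
    by (auto simp: r_coset_def)
  also have "\<dots> \<longleftrightarrow> x - y \<in> ?R"
    by (metis add_diff_cancel_right' diff_add_cancel)
  finally show ?thesis .
qed

section \<open>The leading part of the Magnus expansion as a tensor\<close>

definition ab_class :: "'a set \<Rightarrow> 'a letter list \<Rightarrow> 'a letter list set"
  where "ab_class S w = lower_central (free_group S) (osucc 1) #>\<^bsub>free_group S\<^esub> w"

text \<open>The degree k part with each variable read as the class of its generator. It stays in the
  free abelian group on tuples, where coefficients are visible; the tensor proper is its coset
  modulo \<open>tensor_relations\<close>.\<close>

definition magnus_tensor :: "'a set \<Rightarrow> nat \<Rightarrow> 'a letter list \<Rightarrow> ('a letter list set list \<Rightarrow>\<^sub>0 int)"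
  where "magnus_tensor S k w = (\<Sum>u | set u \<subseteq> S \<and> length u = k.
    frag_cmul (magnus w u) (frag_of (map (\<lambda>x. ab_class S [(x, True)]) u)))"

lemma lower_central_2_normal: "lower_central (free_group S) (osucc 1) \<lhd> free_group S"
  by (rule group.lower_central_normal[OF group_free_group])

lemma ab_class_carrier: "w \<in> carrier (free_group S) \<Longrightarrow> ab_class S w \<in> carrier (abelianization (free_group S))"
  unfolding abelianization_def ab_class_def FactGroup_def RCOSETS_def by auto

lemma ab_class_mult:
  assumes "v \<in> carrier (free_group S)" "w \<in> carrier (free_group S)"
  shows "ab_class S (v \<otimes>\<^bsub>free_group S\<^esub> w) = ab_class S v \<otimes>\<^bsub>abelianization (free_group S)\<^esub> ab_class S w"
  using assms normal.rcos_sum[OF lower_central_2_normal[of S]]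
  unfolding abelianization_def ab_class_def FactGroup_def by (simp del: osucc_inject)

lemma ab_class_one: "ab_class S [] = \<one>\<^bsub>abelianization (free_group S)\<^esub>"
proof -
  interpret F: group "free_group S" by (rule group_free_group)
  have "ab_class S \<one>\<^bsub>free_group S\<^esub> = \<one>\<^bsub>abelianization (free_group S)\<^esub>"
    using F.coset_mult_one[OF subgroup.subset[OF F.lower_central_subgroup]]
    unfolding abelianization_def ab_class_def FactGroup_def by simp
  then show ?thesis by (simp add: free_group_def)
qed

lemma generator_closed: "x \<in> S \<Longrightarrow> [(x, s)] \<in> carrier (free_group S)"
  by (simp add: free_group_def reduced_def)

lemma group_ab: "group (abelianization (free_group S))"
  using group_abelianization[OF group_free_group] by (rule comm_group.axioms)

text \<open>\<open>magnus w [i]\<close> is the exponent sum of i in w. This sum is additive in w,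
  and so is the slot modulo the relations, which reduces the claim to single letters. An inverse
  letter is treated by placing x x^-1 = 1 in the slot.\<close>

lemma tensor_slot_expansion:
  assumes S: "finite S" and l: "length xs + Suc (length ys) = k"
    and c: "set xs \<union> set ys \<subseteq> carrier (abelianization (free_group S))"
    and w: "w \<in> carrier (free_group S)"
  shows "frag_of (xs @ ab_class S w # ys) -
      (\<Sum>i\<in>S. frag_cmul (magnus w [i]) (frag_of (xs @ ab_class S [(i, True)] # ys)))
      \<in> tensor_relations (abelianization (free_group S)) k"
  using w
proof (induction w)
  case Nil
  have "magnus [] [i] = 0" for i :: 'a
    by (simp add: magnus_def unit_series_def)
  then show ?case
    using tensor_relation_one[OF group_ab l c] by (simp add: ab_class_one)
next
  case (Cons a w)
  let ?A = "abelianization (free_group S)"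
  let ?g = "\<lambda>w. frag_of (xs @ ab_class S w # ys)"
  let ?e = "\<lambda>w. \<Sum>i\<in>S. frag_cmul (magnus w [i]) (?g [(i, True)])"
  note aw = free_group_Cons[OF Cons.prems]
  have add: "?g (v \<otimes>\<^bsub>free_group S\<^esub> w) - ?g v - ?g w \<in> tensor_relations ?A k"
    if "v \<in> carrier (free_group S)" "w \<in> carrier (free_group S)" for v w
    unfolding ab_class_mult[OF that] using that c
    by (intro tensor_relation[OF l]) (auto simp: ab_class_carrier)
  obtain x s where a: "a = (x, s)" by (cases a)
  with aw have x: "x \<in> S" by (simp add: free_group_def)
  have "magnus (v \<otimes>\<^bsub>free_group S\<^esub> w) [i] = magnus v [i] + magnus w [i]"
    if "w \<in> carrier (free_group S)" for v w i
    using that magnus_mult_leading(1)[of w S 1 "[i]" v] dimension_subgroup_1[of S] by simp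
  then have e_add: "?e ([a] \<otimes>\<^bsub>free_group S\<^esub> w) = ?e [a] + ?e w"
    using aw by (simp add: frag_cmul_distrib sum.distrib)
  have e_gen: "(\<Sum>i\<in>S. frag_cmul (c * (if i = x then 1 else 0)) (?g [(i, True)])) = frag_cmul c (?g [(x, True)])" for c
  proof -
    have "(\<Sum>i\<in>S. frag_cmul (c * (if i = x then 1 else 0)) (?g [(i, True)])) =
        (\<Sum>i\<in>S. if i = x then frag_cmul c (?g [(i, True)]) else 0)"
      by (intro sum.cong) auto
    then show ?thesis using S x by simp
  qed
  have letter: "?g [a] - ?e [a] \<in> tensor_relations ?A k"
  proof (cases s)
    case True
    then have "?e [a] = ?g [a]"
      using e_gen[of 1] by (simp add: a magnus_generator)
    then show ?thesis
      using tensor_relations_closed(1)[OF group_ab] by simp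
  next
    case False
    have "magnus [a] [i] = - 1 * (if i = x then 1 else 0)" for i
      using False by (simp add: a magnus_def unit_series_def)
    then have e: "?e [a] = - ?g [(x, True)]"
      using e_gen[of "- 1"] by simp
    have "[(x, True)] \<otimes>\<^bsub>free_group S\<^esub> [(x, False)] = []"
      by (simp add: free_group_def reduced_Cons_def letter_inv_def)
    then have "?g [] - ?g [(x, True)] - ?g [a] \<in> tensor_relations ?A k"
      using add[OF generator_closed[OF x, of True] generator_closed[OF x, of False]] False by (simp add: a)
    moreover have "?g [] \<in> tensor_relations ?A k"
      using tensor_relation_one[OF group_ab l c] by (simp add: ab_class_one)
    ultimately have "?g [] - (?g [] - ?g [(x, True)] - ?g [a]) \<in> tensor_relations ?A k"
      using tensor_relations_closed(4)[OF group_ab] by blast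
    then show ?thesis
      by (simp add: e add.commute)
  qed
  have "(?g ([a] \<otimes>\<^bsub>free_group S\<^esub> w) - ?g [a] - ?g w) + ((?g [a] - ?e [a]) + (?g w - ?e w)) \<in> tensor_relations ?A k"
    using add letter Cons.IH aw by (intro tensor_relations_closed(2)[OF group_ab]) simp_all
  then show ?case
    unfolding aw(3) e_add by (simp add: algebra_simps)
qed

lemma lists_Suc_eq: "{u. set u \<subseteq> S \<and> length u = Suc m} = (\<lambda>(i, u). i # u) ` (S \<times> {u. set u \<subseteq> S \<and> length u = m})"
  by (auto simp: length_Suc_conv image_iff)

text \<open>Slots are expanded one at a time from the left. The prefix \<open>xs\<close> collects
  those already replaced by generators, so it must be arbitrary in the induction.\<close>

lemma tensor_expansion:
  assumes S: "finite S" and ws: "set ws \<subseteq> carrier (free_group S)"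
    and xs: "set xs \<subseteq> carrier (abelianization (free_group S))" and l: "length xs + length ws = k"
  shows "frag_of (xs @ map (ab_class S) ws) -
      (\<Sum>u | set u \<subseteq> S \<and> length u = length ws. frag_cmul (prod_list (map2 (\<lambda>w y. magnus w [y]) ws u))
        (frag_of (xs @ map (\<lambda>x. ab_class S [(x, True)]) u)))
      \<in> tensor_relations (abelianization (free_group S)) k"
  using ws xs l
proof (induction ws arbitrary: xs)
  case Nil
  have "{u. set u \<subseteq> S \<and> length u = 0} = {[]}" by auto
  then show ?case
    using tensor_relations_closed(1)[OF group_ab] by simp
next
  case (Cons w ws)
  let ?R = "tensor_relations (abelianization (free_group S)) k"
  let ?gen = "\<lambda>x. ab_class S [(x, True)]" and ?L = "{u. set u \<subseteq> S \<and> length u = length ws}"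
  let ?p = "\<lambda>u. prod_list (map2 (\<lambda>w y. magnus w [y]) ws u)"
  let ?t = "\<lambda>i. frag_of (xs @ ?gen i # map (ab_class S) ws)"
  let ?s = "\<lambda>i. \<Sum>u\<in>?L. frag_cmul (?p u) (frag_of (xs @ ?gen i # map ?gen u))"
  have 1: "frag_of (xs @ ab_class S w # map (ab_class S) ws) - (\<Sum>i\<in>S. frag_cmul (magnus w [i]) (?t i)) \<in> ?R"
    using Cons.prems by (intro tensor_slot_expansion[OF S]) (auto intro: ab_class_carrier)
  have "?t i - ?s i \<in> ?R" if "i \<in> S" for i
    using Cons.IH[of "xs @ [?gen i]"] Cons.prems that by (auto simp: ab_class_carrier generator_closed)
  then have "(\<Sum>i\<in>S. frag_cmul (magnus w [i]) (?t i - ?s i)) \<in> ?R"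
    by (intro tensor_relations_sum tensor_relations_closed(5) group_ab)
  from tensor_relations_closed(2)[OF group_ab 1 this]
  have "frag_of (xs @ ab_class S w # map (ab_class S) ws) - (\<Sum>i\<in>S. frag_cmul (magnus w [i]) (?s i)) \<in> ?R"
    by (simp add: frag_cmul_diff sum_subtractf)
  also have "(\<Sum>i\<in>S. frag_cmul (magnus w [i]) (?s i)) = (\<Sum>(i, u)\<in>S \<times> ?L.
      frag_cmul (magnus w [i] * ?p u) (frag_of (xs @ ?gen i # map ?gen u)))"
    by (simp add: frag_cmul_sum sum.cartesian_product)
  also have "\<dots> = (\<Sum>u | set u \<subseteq> S \<and> length u = Suc (length ws).
      frag_cmul (prod_list (map2 (\<lambda>w y. magnus w [y]) (w # ws) u)) (frag_of (xs @ map ?gen u)))"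
    unfolding lists_Suc_eq by (subst sum.reindex) (auto simp: inj_on_def intro!: sum.cong)
  finally show ?case by simp
qed

lemma magnus_tensor_carrier:
  "magnus_tensor S k w \<in> carrier (free_Abelian_group (tuples (abelianization (free_group S)) k))"
  unfolding magnus_tensor_def
  by (intro sum_closed_free_Abelian_group)
    (auto simp: keys_frag_of tuples_def intro!: ab_class_carrier generator_closed)

text \<open>The degree k parts of w and of v w^-1 v^-1 are opposite and cancel in the
  product.\<close>

lemma commutator_dimension_subgroup:
  assumes w: "w \<in> dimension_subgroup S k" and v: "v \<in> carrier (free_group S)"
  shows "w \<otimes>\<^bsub>free_group S\<^esub> v \<otimes>\<^bsub>free_group S\<^esub> inv\<^bsub>free_group S\<^esub> w \<otimes>\<^bsub>free_group S\<^esub> inv\<^bsub>free_group S\<^esub> v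
    \<in> dimension_subgroup S (Suc k)" (is "?c \<in> _")
proof -
  interpret F: group "free_group S" by (rule group_free_group)
  interpret D: normal "dimension_subgroup S k" "free_group S" by (rule dimension_subgroup_normal)
  let ?d = "v \<otimes>\<^bsub>free_group S\<^esub> inv\<^bsub>free_group S\<^esub> w \<otimes>\<^bsub>free_group S\<^esub> inv\<^bsub>free_group S\<^esub> v"
  have w': "inv\<^bsub>free_group S\<^esub> w \<in> dimension_subgroup S k"
    using w by (rule D.m_inv_closed)
  have c: "?c = w \<otimes>\<^bsub>free_group S\<^esub> ?d"
    using w v by (simp add: F.m_assoc)
  have "?d \<in> dimension_subgroup S k"
    using v w' by (rule D.inv_op_closed2)
  then have "magnus ?c u = 0" if "u \<noteq> []" "length u \<le> k" for u
    using that unfolding c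
    by (simp add: magnus_mult_leading(1) magnus_conj_leading[OF w' v] magnus_inv_leading[OF w])
  moreover have "?c \<in> carrier (free_group S)"
    using v D.mem_carrier[OF w] by simp
  ultimately show ?thesis
    unfolding dimension_subgroup_def less_Suc_eq_le by blast
qed

text \<open>The commutator subgroup lies in D_2, so its elements have no linear part. Linear
  coefficients thereby become coordinates on the abelianization.\<close>

lemma magnus_ab_class:
  assumes "w \<in> carrier (free_group S)" "v \<in> ab_class S w"
  shows "magnus v [i] = magnus w [i]"
proof -
  interpret F: group "free_group S" by (rule group_free_group)
  have "lower_central (free_group S) (osucc 1) \<subseteq> dimension_subgroup S (Suc 1)"
  proof (rule F.lower_central_osucc_subset)
    show "subgroup (dimension_subgroup S (Suc 1)) (free_group S)"
      by (rule normal_imp_subgroup[OF dimension_subgroup_normal])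
  qed (use commutator_dimension_subgroup[of _ S 1] dimension_subgroup_1 in \<open>auto simp: lower_central_1\<close>)
  moreover obtain c where c: "c \<in> lower_central (free_group S) (osucc 1)" "v = c \<otimes>\<^bsub>free_group S\<^esub> w"
    using assms by (auto simp: ab_class_def r_coset_def)
  ultimately have "magnus c [i] = 0"
    by (auto simp: dimension_subgroup_def)
  then show ?thesis
    using assms magnus_mult_leading(1)[of w S 1 "[i]" c] dimension_subgroup_1[of S] c by simp
qed

lemma ab_classE:
  assumes "C \<in> carrier (abelianization (free_group S))"
  obtains w where "w \<in> carrier (free_group S)" "C = ab_class S w"
  using assms unfolding abelianization_def ab_class_def FactGroup_def RCOSETS_def by auto

text \<open>The universal property of the tensor power: the linear extension of a function that is
  additive in each slot kills every relator.\<close>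

lemma tensor_relations_eval:
  assumes A: "group A" and r: "x \<in> tensor_relations A k"
    and add: "\<And>xs a b ys. length xs + Suc (length ys) = k \<Longrightarrow> set xs \<union> set ys \<union> {a, b} \<subseteq> carrier A \<Longrightarrow>
      q (xs @ (a \<otimes>\<^bsub>A\<^esub> b) # ys) = q (xs @ a # ys) + q (xs @ b # ys)"
  shows "frag_extend q x = 0"
proof -
  let ?F = "free_Abelian_group (tuples A k)"
  interpret F: group ?F by simp
  have "subgroup {x \<in> carrier ?F. frag_extend q x = 0} ?F"
  proof (rule F.subgroupI)
    show "{x \<in> carrier ?F. frag_extend q x = 0} \<noteq> {}"
      by (auto intro!: exI[of _ 0])
  qed (use keys_add in \<open>fastforce simp: frag_extend_minus frag_extend_add\<close>)+
  moreover have "tensor_relators A k \<subseteq> {x \<in> carrier ?F. frag_extend q x = 0}"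
  proof
    fix z assume "z \<in> tensor_relators A k"
    then show "z \<in> {x \<in> carrier ?F. frag_extend q x = 0}"
      using tensor_relators_subset[OF A, of k] add
      by (fastforce simp: tensor_relators_def frag_extend_diff simp del: carrier_free_Abelian_group_iff)
  qed
  ultimately have "tensor_relations A k \<subseteq> {x \<in> carrier ?F. frag_extend q x = 0}"
    unfolding tensor_relations_def by (intro F.generate_subgroup_incl)
  then show ?thesis using r by auto
qed

text \<open>The product of the coordinate functionals dual to the letters of u is additive in each
  slot, so it kills the relations. On tensors of generators it is 1 at u and 0 elsewhere, so on
  \<open>magnus_tensor\<close> it returns the coefficient at u.\<close>

lemma magnus_tensor_inj:
  fixes w :: "'a letter list"
  assumes S: "finite S" and w: "magnus_tensor S k w \<in> tensor_relations (abelianization (free_group S)) k"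
    and u: "set u \<subseteq> S" "length u = k"
  shows "magnus w u = 0"
proof -
  let ?A = "abelianization (free_group S)" and ?gen = "\<lambda>x. ab_class S [(x, True)]"
  interpret F: group "free_group S" by (rule group_free_group)
  \<comment> \<open>The choice of a representative does not matter on cosets, by
    \<open>magnus_ab_class\<close>.\<close>
  define e where "e i C = magnus (SOME v. v \<in> C) [i]" for i :: 'a and C
  define p where "p xs = prod_list (map2 e u xs)" for xs
  have e: "e i (ab_class S v) = magnus v [i]" if "v \<in> carrier (free_group S)" for i v
  proof -
    have "v \<in> ab_class S v"
      unfolding ab_class_def by (rule F.rcos_self[OF that F.lower_central_subgroup])
    then show ?thesis
      unfolding e_def by (intro magnus_ab_class[OF that] someI)
  qed
  have e_add: "e i (a \<otimes>\<^bsub>?A\<^esub> b) = e i a + e i b" if a: "a \<in> carrier ?A" and b: "b \<in> carrier ?A" for i a b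
  proof -
    obtain v where "v \<in> carrier (free_group S)" "a = ab_class S v"
      using a by (rule ab_classE)
    moreover obtain v' where "v' \<in> carrier (free_group S)" "b = ab_class S v'"
      using b by (rule ab_classE)
    ultimately show ?thesis
      using magnus_mult_leading(1)[of v' S 1 "[i]" v] dimension_subgroup_1[of S]
      by (simp add: e flip: ab_class_mult)
  qed
  have p_add: "p (xs @ (a \<otimes>\<^bsub>?A\<^esub> b) # ys) = p (xs @ a # ys) + p (xs @ b # ys)"
    if l: "length xs + Suc (length ys) = k" and c: "set xs \<union> set ys \<union> {a, b} \<subseteq> carrier ?A" for xs a b ys
  proof -
    define v i v' where "v = take (length xs) u" and "i = u ! length xs" and "v' = drop (Suc (length xs)) u"
    have "u = v @ i # v'" "length v = length xs"
      using u l unfolding v_def i_def v'_def by (auto intro: id_take_nth_drop)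
    then show ?thesis
      using c by (simp add: p_def e_add distrib_left distrib_right)
  qed
  have p_gen: "p (map ?gen v) = (if v = u then 1 else 0)" if "set v \<subseteq> S" "length v = k" for v
  proof -
    have "length u = length v" using u that by simp
    then show ?thesis
      using that(1) unfolding p_def
      by (induction u v rule: list_induct2) (auto simp: e generator_closed magnus_generator)
  qed
  \<comment> \<open>Integers appear as multiples of \<open>frag_of ()\<close>, because
    \<open>frag_extend\<close> takes values in a free abelian group.\<close>
  let ?q = "\<lambda>xs. frag_cmul (p xs) (frag_of ())"
  have "0 = frag_extend ?q (magnus_tensor S k w)"
    using tensor_relations_eval[OF group_ab w, of ?q] by (simp add: p_add frag_cmul_distrib)
  also have "\<dots> = (\<Sum>v | set v \<subseteq> S \<and> length v = k. frag_cmul (magnus w v * p (map ?gen v)) (frag_of ()))"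
    unfolding magnus_tensor_def using S
    by (subst frag_extend_sum) (auto simp: finite_lists_length_eq frag_extend_cmul)
  also have "\<dots> = (\<Sum>v | set v \<subseteq> S \<and> length v = k. if v = u then frag_cmul (magnus w v) (frag_of ()) else 0)"
    by (intro sum.cong) (auto simp: p_gen)
  also have "\<dots> = frag_cmul (magnus w u) (frag_of ())"
    using S u by (simp add: finite_lists_length_eq)
  finally show ?thesis by (metis frag_cmul_eq_0_iff frag_of_nonzero)
qed

lemma abelianization_map_ab_class:
  assumes \<phi>: "\<phi> \<in> hom (free_group S) (free_group S)" and w: "w \<in> carrier (free_group S)"
  shows "abelianization_map (free_group S) \<phi> (ab_class S w) = ab_class S (\<phi> w)"
proof -
  interpret F: group "free_group S" by (rule group_free_group)
  interpret \<phi>: group_hom "free_group S" "free_group S" \<phi>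
    using \<phi> by unfold_locales
  have "\<phi> ` derived (free_group S) (carrier (free_group S)) \<subseteq> derived (free_group S) (carrier (free_group S))"
    unfolding \<phi>.derived_img[OF subset_refl, symmetric] by (intro F.mono_derived) auto
  then show ?thesis
    unfolding abelianization_map_def ab_class_def
    by (intro quotient_map_coset[OF lower_central_2_normal \<phi> _ w]) (simp add: lower_central_2_eq_derived)
qed

text \<open>The induced map puts the class of the image of a generator into each slot. Expanding
  these slots by \<open>tensor_expansion\<close> produces exactly the coefficients that
  \<open>magnus_hom_leading\<close> gives for \<open>\<phi> w\<close>.\<close>

lemma magnus_tensor_hom:
  assumes \<phi>: "\<phi> \<in> hom (free_group S) (free_group S)" and S: "finite S" and k: "k \<ge> 1"
    and w: "w \<in> dimension_subgroup S k"
  shows "frag_extend (frag_of \<circ> map (abelianization_map (free_group S) \<phi>)) (magnus_tensor S k w) -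
      magnus_tensor S k (\<phi> w) \<in> tensor_relations (abelianization (free_group S)) k"
proof -
  let ?A = "abelianization (free_group S)" and ?gen = "\<lambda>x. ab_class S [(x, True)]"
  let ?L = "{u. set u \<subseteq> S \<and> length u = k}" and ?\<phi> = "\<lambda>x. \<phi> [(x, True)]"
  let ?p = "\<lambda>v u. prod_list (map2 (\<lambda>w y. magnus w [y]) (map ?\<phi> v) u)"
  interpret \<phi>: group_hom "free_group S" "free_group S" \<phi>
    using \<phi> group_free_group by (auto simp: group_hom_def group_hom_axioms_def)
  have fin: "finite ?L" using S by (rule finite_lists_length_eq)
  have ab: "map (abelianization_map (free_group S) \<phi>) (map ?gen v) = map (ab_class S) (map ?\<phi> v)" if "set v \<subseteq> S" for v
    using that by (auto simp: abelianization_map_ab_class[OF \<phi>] generator_closed)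
  have 1: "frag_extend (frag_of \<circ> map (abelianization_map (free_group S) \<phi>)) (magnus_tensor S k w) =
      (\<Sum>v\<in>?L. frag_cmul (magnus w v) (frag_of (map (ab_class S) (map ?\<phi> v))))"
    unfolding magnus_tensor_def
    by (subst frag_extend_sum[OF fin], rule sum.cong) (simp_all add: frag_extend_cmul ab del: map_map)
  have "magnus (\<phi> w) u = (\<Sum>v\<in>?L. magnus w v * ?p v u)" if "u \<in> ?L" for u
  proof -
    have "u \<noteq> []" "length u = k" using that k by auto
    then show ?thesis
      using magnus_hom_leading(2)[OF \<phi> S w] by (simp add: zip_map1 case_prod_unfold comp_def)
  qed
  then have "magnus_tensor S k (\<phi> w) = (\<Sum>u\<in>?L. \<Sum>v\<in>?L. frag_cmul (magnus w v) (frag_cmul (?p v u) (frag_of (map ?gen u))))"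
    unfolding magnus_tensor_def by (intro sum.cong) (simp_all add: frag_cmul_sum_left)
  also have "\<dots> = (\<Sum>v\<in>?L. frag_cmul (magnus w v) (\<Sum>u\<in>?L. frag_cmul (?p v u) (frag_of (map ?gen u))))"
    by (subst sum.swap) (simp add: frag_cmul_sum)
  finally have "frag_extend (frag_of \<circ> map (abelianization_map (free_group S) \<phi>)) (magnus_tensor S k w) - magnus_tensor S k (\<phi> w) =
      (\<Sum>v\<in>?L. frag_cmul (magnus w v) (frag_of (map (ab_class S) (map ?\<phi> v)) -
        (\<Sum>u\<in>?L. frag_cmul (?p v u) (frag_of (map ?gen u)))))"
    unfolding 1 by (simp only: sum_subtractf frag_cmul_diff)
  also have "\<dots> \<in> tensor_relations ?A k"
  proof (intro tensor_relations_sum tensor_relations_closed(5) group_ab)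
    fix v assume v: "v \<in> ?L"
    show "frag_of (map (ab_class S) (map ?\<phi> v)) - (\<Sum>u\<in>?L. frag_cmul (?p v u) (frag_of (map ?gen u))) \<in> tensor_relations ?A k"
    proof -
      have "set (map ?\<phi> v) \<subseteq> carrier (free_group S)"
        using v by (auto intro!: \<phi>.hom_closed generator_closed)
      then show ?thesis
        using tensor_expansion[OF S, of "map ?\<phi> v" "[]" k] v by simp
    qed
  qed
  finally show ?thesis .
qed

lemma tensor_power_map_coset:
  assumes A: "comm_group A" and \<psi>: "\<psi> \<in> auto A" and x: "x \<in> carrier (free_Abelian_group (tuples A k))"
  shows "tensor_power_map A k \<psi> (tensor_relations A k #>\<^bsub>free_Abelian_group (tuples A k)\<^esub> x) =
    tensor_relations A k #>\<^bsub>free_Abelian_group (tuples A k)\<^esub> frag_extend (frag_of \<circ> map \<psi>) x"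
proof -
  interpret A: comm_group A by (rule A)
  let ?F = "free_Abelian_group (tuples A k)" and ?f = "frag_extend (frag_of \<circ> map \<psi>)"
  interpret F: comm_group ?F by (rule abelian_free_Abelian_group)
  have \<psi>: "\<psi> a \<in> carrier A" "\<psi> (a \<otimes>\<^bsub>A\<^esub> b) = \<psi> a \<otimes>\<^bsub>A\<^esub> \<psi> b" if "a \<in> carrier A" "b \<in> carrier A" for a b
    using \<psi> that by (auto simp: auto_def hom_def)
  have closed: "?f y \<in> carrier ?F" if "y \<in> carrier ?F" for y
  proof -
    have "Poly_Mapping.keys (?f y) \<subseteq> map \<psi> ` Poly_Mapping.keys y"
      using keys_frag_extend[of "frag_of \<circ> map \<psi>" y]
      by (simp add: keys_frag_of UNION_singleton_eq_range)
    moreover have "map \<psi> ` Poly_Mapping.keys y \<subseteq> tuples A k"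
    proof (rule image_subsetI)
      fix xs assume "xs \<in> Poly_Mapping.keys y"
      then have "xs \<in> tuples A k" using that by auto
      then show "map \<psi> xs \<in> tuples A k" using \<psi>(1) by (auto simp: tuples_def)
    qed
    ultimately show ?thesis by simp
  qed
  have hom: "?f \<in> hom ?F ?F"
    using closed by (intro homI) (auto simp: frag_extend_add)
  interpret f: group_hom ?F ?F ?f
    using hom by unfold_locales
  have "?f ` tensor_relators A k \<subseteq> tensor_relators A k"
  proof (intro image_subsetI)
    fix z assume "z \<in> tensor_relators A k"
    then obtain xs a b ys where
      z: "z = frag_of (xs @ (a \<otimes>\<^bsub>A\<^esub> b) # ys) - frag_of (xs @ a # ys) - frag_of (xs @ b # ys)"
      and l: "length xs + Suc (length ys) = k" and c: "set xs \<union> set ys \<union> {a, b} \<subseteq> carrier A"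
      by (auto simp: tensor_relators_def)
    then have "?f z = frag_of (map \<psi> xs @ (\<psi> a \<otimes>\<^bsub>A\<^esub> \<psi> b) # map \<psi> ys) -
        frag_of (map \<psi> xs @ \<psi> a # map \<psi> ys) - frag_of (map \<psi> xs @ \<psi> b # map \<psi> ys)"
      by (simp add: frag_extend_diff \<psi>)
    moreover have "length (map \<psi> xs) + Suc (length (map \<psi> ys)) = k"
      "set (map \<psi> xs) \<union> set (map \<psi> ys) \<union> {\<psi> a, \<psi> b} \<subseteq> carrier A"
      using l c \<psi>(1) by auto
    ultimately show "?f z \<in> tensor_relators A k"
      unfolding tensor_relators_def by blast
  qed
  then have "?f ` tensor_relations A k \<subseteq> tensor_relations A k"
    unfolding tensor_relations_def f.generate_img[OF tensor_relators_subset[OF A.is_group], symmetric]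
    by (rule F.mono_generate)
  then show ?thesis
    unfolding tensor_power_map_def
    by (intro quotient_map_coset F.subgroup_imp_normal subgroup_tensor_relations A.is_group hom x)
qed


section \<open>Semidirect products of free groups with the integers\<close>

lemma reduced_append_iff:
  "reduced (u @ v) \<longleftrightarrow> reduced u \<and> reduced v \<and> (u = [] \<or> v = [] \<or> hd v \<noteq> letter_inv (last u))"
  by (auto simp: reduced_def successively_append_iff)

lemma free_group_append: "reduced (u @ v) \<Longrightarrow> u \<otimes>\<^bsub>free_group S\<^esub> v = u @ v"
proof (induction u)
  case Nil
  then show ?case by (simp add: free_group_def)
next
  case (Cons a u)
  then have "reduced (u @ v)"
    by (cases "u @ v") (auto simp: reduced_def)
  with Cons show ?case
    by (cases "u @ v") (auto simp: free_group_def reduced_Cons_def reduced_def)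
qed

text \<open>The two inequalities for c exclude cancellation at the left and at the right end of
  g.\<close>

lemma free_group_conj_letter:
  assumes "g \<in> carrier (free_group S)" "g \<noteq> []" "fst c \<in> S" "c \<noteq> letter_inv (hd g)" "c \<noteq> last g"
  shows "c # g @ [letter_inv c] \<in> carrier (free_group S)"
    and "[c] \<otimes>\<^bsub>free_group S\<^esub> g \<otimes>\<^bsub>free_group S\<^esub> inv\<^bsub>free_group S\<^esub> [c] = c # g @ [letter_inv c]"
proof -
  interpret F: group "free_group S" by (rule group_free_group)
  have inj: "letter_inv a = letter_inv b \<longleftrightarrow> a = b" for a b :: "'a letter"
    by (metis letter_inv_inv)
  have "reduced g"
    using assms(1) by (simp add: free_group_def)
  then have cg: "reduced (c # g)"
    using assms reduced_append_iff[of "[c]" g] by (auto simp: reduced_def)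
  then have red: "reduced (c # g @ [letter_inv c])"
    using assms inj[of c "last g"] reduced_append_iff[of "c # g" "[letter_inv c]"] by (simp add: reduced_def)
  then show "c # g @ [letter_inv c] \<in> carrier (free_group S)"
    using assms by (auto simp: free_group_def letter_inv_def)
  have "[c] \<in> carrier (free_group S)" "[letter_inv c] \<in> carrier (free_group S)"
    using assms by (auto simp: free_group_def letter_inv_def reduced_def)
  moreover have "[letter_inv c] \<otimes>\<^bsub>free_group S\<^esub> [c] = \<one>\<^bsub>free_group S\<^esub>"
    by (simp add: free_group_def reduced_Cons_def)
  ultimately have "inv\<^bsub>free_group S\<^esub> [c] = [letter_inv c]"
    by (intro F.inv_equality) simp_all
  moreover have "[c] \<otimes>\<^bsub>free_group S\<^esub> g = c # g"
    using free_group_append[of "[c]" g S] cg by simp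
  ultimately show "[c] \<otimes>\<^bsub>free_group S\<^esub> g \<otimes>\<^bsub>free_group S\<^esub> inv\<^bsub>free_group S\<^esub> [c] = c # g @ [letter_inv c]"
    using free_group_append[of "c # g" "[letter_inv c]" S] red by simp
qed

text \<open>Conjugate by a letter c and then by a letter on a different generator z, both times
  without cancellation. The two resulting words multiply without cancellation in either order, and
  the products begin with different letters.\<close>

lemma free_group_conjugates_not_commuting:
  assumes xy: "x \<in> S" "y \<in> S" "x \<noteq> y" and g: "g \<in> carrier (free_group S)" "g \<noteq> []"
  obtains p q where "p \<in> carrier (free_group S)" "q \<in> carrier (free_group S)"
    "(p \<otimes>\<^bsub>free_group S\<^esub> g \<otimes>\<^bsub>free_group S\<^esub> inv\<^bsub>free_group S\<^esub> p) \<otimes>\<^bsub>free_group S\<^esub>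
      (q \<otimes>\<^bsub>free_group S\<^esub> g \<otimes>\<^bsub>free_group S\<^esub> inv\<^bsub>free_group S\<^esub> q) \<noteq>
     (q \<otimes>\<^bsub>free_group S\<^esub> g \<otimes>\<^bsub>free_group S\<^esub> inv\<^bsub>free_group S\<^esub> q) \<otimes>\<^bsub>free_group S\<^esub>
      (p \<otimes>\<^bsub>free_group S\<^esub> g \<otimes>\<^bsub>free_group S\<^esub> inv\<^bsub>free_group S\<^esub> p)"
proof -
  interpret F: group "free_group S" by (rule group_free_group)
  \<comment> \<open>Two generators give four letters and at most two are forbidden, so a suitable c
    remains.\<close>
  have "card {(x, True), (x, False), (y, True), (y, False)} = 4"
    using xy(3) by simp
  moreover have "card {letter_inv (hd g), last g} \<le> 2"
    by (simp add: card_insert_if)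
  ultimately have "\<not> {(x, True), (x, False), (y, True), (y, False)} \<subseteq> {letter_inv (hd g), last g}"
    using card_mono[of "{letter_inv (hd g), last g}" "{(x, True), (x, False), (y, True), (y, False)}"]
    by (intro notI) simp
  then obtain c where "c \<in> {(x, True), (x, False), (y, True), (y, False)}" "c \<notin> {letter_inv (hd g), last g}"
    by blast
  then have c: "fst c \<in> {x, y}" "c \<noteq> letter_inv (hd g)" "c \<noteq> last g"
    by auto
  define g1 where "g1 = c # g @ [letter_inv c]"
  have "fst c \<in> S" using c xy by auto
  note g1 = free_group_conj_letter[OF g this c(2,3), folded g1_def]
  obtain z where z: "z \<in> S" "z \<noteq> fst c"
    using c xy by (cases "fst c = x") auto
  define g2 where "g2 = (z, True) # g1 @ [letter_inv (z, True)]"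
  have g2: "g2 \<in> carrier (free_group S)"
      "[(z, True)] \<otimes>\<^bsub>free_group S\<^esub> g1 \<otimes>\<^bsub>free_group S\<^esub> inv\<^bsub>free_group S\<^esub> [(z, True)] = g2"
    unfolding g2_def using z by (intro free_group_conj_letter g1(1); auto simp: g1_def letter_inv_def prod_eq_iff)+
  have cz: "[c] \<in> carrier (free_group S)" "[(z, True)] \<in> carrier (free_group S)"
    using z \<open>fst c \<in> S\<close> by (auto simp: free_group_def reduced_def)
  define q where "q = [(z, True)] \<otimes>\<^bsub>free_group S\<^esub> [c]"
  have "q \<otimes>\<^bsub>free_group S\<^esub> g \<otimes>\<^bsub>free_group S\<^esub> inv\<^bsub>free_group S\<^esub> q = g2"
    unfolding g2(2)[symmetric] g1(2)[symmetric] q_def using cz g(1) by (simp add: F.m_assoc F.inv_mult_group)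
  moreover have "reduced (g1 @ g2)" "reduced (g2 @ g1)"
  proof -
    have "g1 \<noteq> []" "hd g1 = c" "last g1 = letter_inv c"
      "g2 \<noteq> []" "hd g2 = (z, True)" "last g2 = letter_inv (z, True)"
      by (simp_all add: g1_def g2_def)
    moreover have "c \<noteq> (z, True)"
      using z(2) by auto
    moreover have "reduced g1" "reduced g2"
      using g1(1) g2(1) by (simp_all add: free_group_def)
    ultimately show "reduced (g1 @ g2)" "reduced (g2 @ g1)"
      by (auto simp: reduced_append_iff)
  qed
  then have "g1 \<otimes>\<^bsub>free_group S\<^esub> g2 \<noteq> g2 \<otimes>\<^bsub>free_group S\<^esub> g1"
    using z by (auto simp: free_group_append g1_def g2_def)
  ultimately show thesis
    using that[of "[c]" q] cz g1(2) by (simp add: q_def)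
qed

section \<open>The base group inside a semidirect product with the integers\<close>

context
  fixes M :: "('a, 'b) monoid_scheme" and \<psi>
  assumes M: "group M" and \<psi>: "\<psi> \<in> auto M"
begin

interpretation M: group M by (rule M)

lemma auto_pow_1: "\<psi> [^]\<^bsub>AutoGroup M\<^esub> (1 :: int) = \<psi>"
  using group.int_pow_1[OF M.AutoGroup] \<psi> by simp

interpretation SD: group "semidirect_int M \<psi>" by (rule group_semidirect_int[OF M \<psi>])

lemma carrier_semidirect_int: "carrier (semidirect_int M \<psi>) = carrier M \<times> UNIV"
  by (simp add: semidirect_int_def)

lemma one_semidirect_int: "\<one>\<^bsub>semidirect_int M \<psi>\<^esub> = (\<one>\<^bsub>M\<^esub>, 0)"
  by (simp add: semidirect_int_def)

lemma semidirect_int_mult_base: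
  "x \<in> carrier M \<Longrightarrow> y \<in> carrier M \<Longrightarrow> (x, 0) \<otimes>\<^bsub>semidirect_int M \<psi>\<^esub> (y, i) = (x \<otimes>\<^bsub>M\<^esub> y, i)"
  by (simp add: semidirect_int_def one_AutoGroup)

lemma semidirect_int_inv_base:
  "x \<in> carrier M \<Longrightarrow> inv\<^bsub>semidirect_int M \<psi>\<^esub> (x, 0) = (inv\<^bsub>M\<^esub> x, 0)"
  by (intro SD.inv_equality) (simp_all add: semidirect_int_mult_base carrier_semidirect_int one_semidirect_int)

lemma semidirect_int_conj:
  assumes "m \<in> carrier M" "x \<in> carrier M"
  shows "(m, i) \<otimes>\<^bsub>semidirect_int M \<psi>\<^esub> (x, 0) \<otimes>\<^bsub>semidirect_int M \<psi>\<^esub> inv\<^bsub>semidirect_int M \<psi>\<^esub> (m, i) =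
    (m \<otimes>\<^bsub>M\<^esub> (\<psi> [^]\<^bsub>AutoGroup M\<^esub> (- i)) x \<otimes>\<^bsub>M\<^esub> inv\<^bsub>M\<^esub> m, 0)"
proof -
  let ?y = "(\<psi> [^]\<^bsub>AutoGroup M\<^esub> (- i)) x"
  have y: "?y \<in> carrier M"
    using assms(2) by (rule auto_pow_closed[OF M \<psi>])
  have "(m, i) \<otimes>\<^bsub>semidirect_int M \<psi>\<^esub> (x, 0) = (m \<otimes>\<^bsub>M\<^esub> ?y, i)"
    by (simp add: semidirect_int_def)
  also have "\<dots> = (m \<otimes>\<^bsub>M\<^esub> ?y \<otimes>\<^bsub>M\<^esub> inv\<^bsub>M\<^esub> m, 0) \<otimes>\<^bsub>semidirect_int M \<psi>\<^esub> (m, i)"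
    using assms y by (simp add: semidirect_int_mult_base M.m_assoc)
  finally have "(m, i) \<otimes>\<^bsub>semidirect_int M \<psi>\<^esub> (x, 0) =
    (m \<otimes>\<^bsub>M\<^esub> ?y \<otimes>\<^bsub>M\<^esub> inv\<^bsub>M\<^esub> m, 0) \<otimes>\<^bsub>semidirect_int M \<psi>\<^esub> (m, i)" .
  moreover have "(m, i) \<in> carrier (semidirect_int M \<psi>)"
      "(m \<otimes>\<^bsub>M\<^esub> ?y \<otimes>\<^bsub>M\<^esub> inv\<^bsub>M\<^esub> m, 0) \<in> carrier (semidirect_int M \<psi>)"
    using assms y by (simp_all add: carrier_semidirect_int)
  ultimately show ?thesis
    by (simp add: SD.m_assoc)
qed

lemma subgroup_semidirect_int_base:
  assumes "subgroup H M"
  shows "subgroup (H \<times> {0}) (semidirect_int M \<psi>)"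
proof -
  interpret H: subgroup H M by (rule assms)
  show ?thesis
  proof (rule SD.subgroupI)
    show "H \<times> {0 :: int} \<noteq> {}" using H.one_closed by blast
  qed (auto simp: carrier_semidirect_int semidirect_int_mult_base semidirect_int_inv_base)
qed

text \<open>The exponent of t is a homomorphism to an abelian group, so it vanishes on
  commutators.\<close>

lemma lower_central_2_semidirect_int:
  "lower_central (semidirect_int M \<psi>) (osucc 1) \<subseteq> carrier M \<times> {0}"
proof (rule SD.lower_central_osucc_subset[OF order_refl subgroup_semidirect_int_base[OF M.subgroup_self]])
  fix x y assume "x \<in> lower_central (semidirect_int M \<psi>) 1" "y \<in> carrier (semidirect_int M \<psi>)"
  then have xy: "x \<in> carrier (semidirect_int M \<psi>)" "y \<in> carrier (semidirect_int M \<psi>)"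
    by (simp_all add: lower_central_1)
  have mult: "snd (u \<otimes>\<^bsub>semidirect_int M \<psi>\<^esub> v) = snd u + snd v" for u v
    by (simp add: semidirect_int_def case_prod_unfold)
  have inv: "snd (inv\<^bsub>semidirect_int M \<psi>\<^esub> u) = - snd u" if "u \<in> carrier (semidirect_int M \<psi>)" for u
    using mult[of "inv\<^bsub>semidirect_int M \<psi>\<^esub> u" u] that by (simp add: one_semidirect_int)
  let ?c = "x \<otimes>\<^bsub>semidirect_int M \<psi>\<^esub> y \<otimes>\<^bsub>semidirect_int M \<psi>\<^esub> inv\<^bsub>semidirect_int M \<psi>\<^esub> x
    \<otimes>\<^bsub>semidirect_int M \<psi>\<^esub> inv\<^bsub>semidirect_int M \<psi>\<^esub> y"
  have "snd ?c = 0"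
    using xy by (simp add: mult inv)
  moreover have "?c \<in> carrier M \<times> UNIV"
    using xy unfolding carrier_semidirect_int[symmetric] by simp
  ultimately show "?c \<in> carrier M \<times> {0}"
    by (metis SigmaE SigmaI prod.sel(2) singletonI)
qed

end

text \<open>\<Theta> is controlled only on D, so D has to be stable under negative powers too. The
  downward step cancels one \<psi> from the identity already known.\<close>

lemma auto_pow_intertwine:
  assumes F: "group F" "\<phi> \<in> auto F" and M: "group M" "\<psi> \<in> auto M"
    and D: "D \<subseteq> carrier F" "\<And>(i :: int) x. x \<in> D \<Longrightarrow> (\<phi> [^]\<^bsub>AutoGroup F\<^esub> i) x \<in> D"
    and \<Theta>: "\<And>x. x \<in> D \<Longrightarrow> \<Theta> x \<in> carrier M" "\<And>x. x \<in> D \<Longrightarrow> \<Theta> (\<phi> x) = \<psi> (\<Theta> x)"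
    and x: "x \<in> D"
  shows "\<Theta> ((\<phi> [^]\<^bsub>AutoGroup F\<^esub> (i :: int)) x) = (\<psi> [^]\<^bsub>AutoGroup M\<^esub> i) (\<Theta> x)"
proof (induction i rule: int_induct[where k = 0])
  case base
  then show ?case
    using x D(1) \<Theta>(1) by (auto simp: one_AutoGroup)
next
  case (step1 i)
  have "(\<phi> [^]\<^bsub>AutoGroup F\<^esub> (i + 1)) x = \<phi> ((\<phi> [^]\<^bsub>AutoGroup F\<^esub> i) x)"
    using auto_pow_add[OF F, of x 1 i] x D(1) by (auto simp: auto_pow_1[OF F] add.commute)
  moreover have "(\<psi> [^]\<^bsub>AutoGroup M\<^esub> (i + 1)) (\<Theta> x) = \<psi> ((\<psi> [^]\<^bsub>AutoGroup M\<^esub> i) (\<Theta> x))"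
    using auto_pow_add[OF M, of "\<Theta> x" 1 i] \<Theta>(1)[OF x] by (simp add: auto_pow_1[OF M] add.commute)
  ultimately show ?case
    using \<Theta>(2)[OF D(2)[OF x]] step1 by simp
next
  case (step2 i)
  let ?y = "(\<phi> [^]\<^bsub>AutoGroup F\<^esub> (i - 1)) x"
  have y: "?y \<in> D" using x by (rule D(2))
  have "\<phi> ?y = (\<phi> [^]\<^bsub>AutoGroup F\<^esub> i) x"
    using auto_pow_add[OF F, of x 1 "i - 1"] x D(1) by (auto simp: auto_pow_1[OF F])
  then have "(\<psi> [^]\<^bsub>AutoGroup M\<^esub> i) (\<Theta> x) = \<psi> (\<Theta> ?y)"
    using \<Theta>(2)[OF y] step2 by simp
  then have "(\<psi> [^]\<^bsub>AutoGroup M\<^esub> (- 1 :: int)) ((\<psi> [^]\<^bsub>AutoGroup M\<^esub> i) (\<Theta> x)) =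
      (\<psi> [^]\<^bsub>AutoGroup M\<^esub> (- 1 :: int)) ((\<psi> [^]\<^bsub>AutoGroup M\<^esub> (1 :: int)) (\<Theta> ?y))"
    by (simp add: auto_pow_1[OF M])
  then show ?case
    using \<Theta>(1)[OF x] \<Theta>(1)[OF y] by (simp add: auto_pow_add[OF M] one_AutoGroup)
qed

section \<open>Descent from D_k to D_{k+1}\<close>

lemma magnus_tensor_mult:
  assumes "v \<in> dimension_subgroup S k" "k \<ge> 1"
  shows "magnus_tensor S k (w \<otimes>\<^bsub>free_group S\<^esub> v) = magnus_tensor S k w + magnus_tensor S k v"
  unfolding magnus_tensor_def sum.distrib[symmetric] using assms
  by (intro sum.cong refl) (subst magnus_mult_leading(1)[OF assms(1)], auto simp: frag_cmul_distrib)

lemma magnus_tensor_conj: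
  assumes "w \<in> dimension_subgroup S k" "v \<in> carrier (free_group S)" "k \<ge> 1"
  shows "magnus_tensor S k (v \<otimes>\<^bsub>free_group S\<^esub> w \<otimes>\<^bsub>free_group S\<^esub> inv\<^bsub>free_group S\<^esub> v) = magnus_tensor S k w"
  unfolding magnus_tensor_def using assms
  by (intro sum.cong refl) (subst magnus_conj_leading[OF assms(1,2)], auto)

text \<open>Injectivity removes the degree k coefficients at monomials over S; at other monomials
  they vanish because w is a word over S.\<close>

lemma dimension_subgroup_Suc:
  assumes S: "finite S" and w: "w \<in> dimension_subgroup S k"
    and T: "magnus_tensor S k w \<in> tensor_relations (abelianization (free_group S)) k"
  shows "w \<in> dimension_subgroup S (Suc k)"
proof -
  have w': "w \<in> carrier (free_group S)" "\<And>u. u \<noteq> [] \<Longrightarrow> length u < k \<Longrightarrow> magnus w u = 0"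
    using w by (auto simp: dimension_subgroup_def)
  have "magnus w u = 0" if "length u = k" for u
  proof (cases "set u \<subseteq> S")
    case True
    then show ?thesis using magnus_tensor_inj[OF S T] that by blast
  next
    case False
    then show ?thesis using magnus_support[of w u] w'(1) by (auto simp: free_group_def)
  qed
  then show ?thesis
    using w' by (auto simp: dimension_subgroup_def less_Suc_eq)
qed

text \<open>\<open>lower_central_descent\<close> applies with D_k in the base as subgroup.
  Conjugation by (m, i) corresponds to conjugation by (1, i) in P: m leaves the leading tensor
  unchanged, and the powers of \<phi> become powers of \<psi>. The kernel on D_k lies in
  D_{k+1}.\<close>

lemma lower_central_descent_free_group:
  fixes S :: "'a set" and k :: nat
  defines "F \<equiv> free_group S"
  assumes S: "finite S" and \<phi>: "\<phi> \<in> auto F" and k: "k \<ge> 1"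
    and rn: "residually_nilpotent (semidirect_int (tensor_power (abelianization F) k)
      (tensor_power_map (abelianization F) k (abelianization_map F \<phi>)))"
    and \<alpha>: "1 \<le> \<alpha>" "lower_central (semidirect_int F \<phi>) \<alpha> \<subseteq> dimension_subgroup S k \<times> {0}"
      "is_next_limit \<alpha> \<mu>"
  shows "lower_central (semidirect_int F \<phi>) \<mu> \<subseteq> dimension_subgroup S (Suc k) \<times> {0}"
proof -
  define A where "A = abelianization F"
  define R where "R = tensor_relations A k"
  define Q where "Q = free_Abelian_group (tuples A k)"
  define M where "M = tensor_power A k"
  define \<phi>' where "\<phi>' = abelianization_map F \<phi>"
  define \<psi> where "\<psi> = tensor_power_map A k \<phi>'"
  define P where "P = semidirect_int M \<psi>"
  define \<Theta> where "\<Theta> w = R #>\<^bsub>Q\<^esub> magnus_tensor S k w" for w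
  define \<theta> where "\<theta> = (\<lambda>(w, i :: int). (\<Theta> w, 0 :: int))"
  let ?D = "dimension_subgroup S k" and ?G = "semidirect_int F \<phi>"
  have F: "group F" unfolding F_def by (rule group_free_group)
  interpret F: group F by (rule F)
  have A: "comm_group A" unfolding A_def by (rule group_abelianization[OF F])
  interpret A: comm_group A by (rule A)
  have \<phi>': "\<phi>' \<in> auto A" unfolding A_def \<phi>'_def by (rule abelianization_map_auto[OF F \<phi>])
  have M: "comm_group M" and \<psi>: "\<psi> \<in> auto M"
    unfolding M_def \<psi>_def by (rule tensor_power_map_auto[OF A \<phi>'])+
  interpret M: comm_group M by (rule M)
  interpret Q: comm_group Q unfolding Q_def by (rule abelian_free_Abelian_group)
  have R: "subgroup R Q" unfolding R_def Q_def by (rule subgroup_tensor_relations[OF A.is_group])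
  then have R_normal: "R \<lhd> Q" by (rule Q.subgroup_imp_normal)
  interpret G: group ?G by (rule group_semidirect_int[OF F \<phi>])
  interpret P: group P unfolding P_def by (rule group_semidirect_int[OF M.is_group \<psi>])
  interpret D: normal ?D F unfolding F_def by (rule dimension_subgroup_normal)
  have T: "magnus_tensor S k w \<in> carrier Q" for w
    unfolding Q_def A_def F_def by (rule magnus_tensor_carrier)
  have \<Theta>_closed: "\<Theta> w \<in> carrier M" for w
    using T[of w] unfolding \<Theta>_def M_def tensor_power_def FactGroup_def RCOSETS_def R_def Q_def by auto
  have \<Theta>_mult: "\<Theta> (v \<otimes>\<^bsub>F\<^esub> w) = \<Theta> v \<otimes>\<^bsub>M\<^esub> \<Theta> w" if "w \<in> ?D" for v w
  proof -
    have "\<Theta> v \<otimes>\<^bsub>M\<^esub> \<Theta> w = R #>\<^bsub>Q\<^esub> (magnus_tensor S k v \<otimes>\<^bsub>Q\<^esub> magnus_tensor S k w)"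
      unfolding M_def tensor_power_def R_def[symmetric] Q_def[symmetric] \<Theta>_def
      using normal.rcos_sum[OF R_normal T T] by (simp add: FactGroup_def)
    then show ?thesis
      using magnus_tensor_mult[OF that k] by (simp add: \<Theta>_def Q_def F_def)
  qed
  have D_pow: "(\<phi> [^]\<^bsub>AutoGroup F\<^esub> i) w \<in> ?D" if "w \<in> ?D" for i :: int and w
  proof -
    have "\<phi> [^]\<^bsub>AutoGroup F\<^esub> i \<in> hom F F"
      using auto_pow[OF F \<phi>] by (simp add: auto_def)
    then show ?thesis
      using that magnus_hom_leading(1)[OF _ S that] auto_pow_closed[OF F \<phi>, of w i]
      unfolding F_def by (auto simp: dimension_subgroup_def)
  qed
  have \<phi>_hom: "\<phi> \<in> hom F F" using \<phi> by (simp add: auto_def)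
  have "\<Theta> (\<phi> w) = \<psi> (\<Theta> w)" if "w \<in> ?D" for w
  proof -
    let ?f = "frag_extend (frag_of \<circ> map \<phi>')"
    have rel: "?f (magnus_tensor S k w) - magnus_tensor S k (\<phi> w) \<in> R"
      using magnus_tensor_hom[OF \<phi>_hom[unfolded F_def] S k that] by (simp add: R_def A_def F_def \<phi>'_def)
    have "\<psi> (\<Theta> w) = R #>\<^bsub>Q\<^esub> ?f (magnus_tensor S k w)"
      unfolding \<psi>_def \<Theta>_def R_def Q_def by (rule tensor_power_map_coset[OF A \<phi>' T[unfolded Q_def]])
    also have "\<dots> = \<Theta> (\<phi> w)"
    proof -
      have "?f (magnus_tensor S k w) \<in> carrier Q"
        using Q.m_closed[OF subgroup.mem_carrier[OF R rel] T[of "\<phi> w"]] by (simp add: Q_def)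
      then show ?thesis
        using rel T[of "\<phi> w"] tensor_coset_eq_iff[OF A.is_group] unfolding \<Theta>_def Q_def R_def by blast
    qed
    finally show ?thesis ..
  qed
  then have \<Theta>_pow: "\<Theta> ((\<phi> [^]\<^bsub>AutoGroup F\<^esub> i) w) = (\<psi> [^]\<^bsub>AutoGroup M\<^esub> i) (\<Theta> w)" if "w \<in> ?D" for i :: int and w
    by (intro auto_pow_intertwine[OF F \<phi> M.is_group \<psi> D.subset] that D_pow \<Theta>_closed)
  have "lower_central ?G \<mu> \<subseteq> {h \<in> ?D \<times> {0}. \<theta> h = \<one>\<^bsub>P\<^esub>}"
  proof (rule G.lower_central_descent[OF P.is_group _ _ _ _ \<alpha>])
    show "lower_central P omega = {\<one>\<^bsub>P\<^esub>}"
      using rn unfolding residually_nilpotent_def P_def M_def \<psi>_def \<phi>'_def A_def .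
    show "subgroup (?D \<times> {0}) ?G"
      by (rule subgroup_semidirect_int_base[OF F \<phi> D.subgroup_axioms])
    show "\<theta> \<in> hom (?G\<lparr>carrier := ?D \<times> {0}\<rparr>) P"
    proof (rule homI)
      fix x y assume "x \<in> carrier (?G\<lparr>carrier := ?D \<times> {0}\<rparr>)" "y \<in> carrier (?G\<lparr>carrier := ?D \<times> {0}\<rparr>)"
      then obtain v w where "x = (v, 0)" "y = (w, 0)" "v \<in> ?D" "w \<in> ?D" by auto
      then show "\<theta> (x \<otimes>\<^bsub>?G\<lparr>carrier := ?D \<times> {0}\<rparr>\<^esub> y) = \<theta> x \<otimes>\<^bsub>P\<^esub> \<theta> y"
        by (simp add: \<theta>_def P_def semidirect_int_mult_base[OF F \<phi>]
            semidirect_int_mult_base[OF M.is_group \<psi>] \<Theta>_closed \<Theta>_mult)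
    qed (auto simp: \<theta>_def P_def carrier_semidirect_int[OF M.is_group \<psi>] \<Theta>_closed)
    fix g h assume "g \<in> carrier ?G" "h \<in> ?D \<times> {0 :: int}"
    then obtain m i w where gh: "g = (m, i)" "h = (w, 0)" and m: "m \<in> carrier F" and w: "w \<in> ?D"
      by (auto simp: carrier_semidirect_int[OF F \<phi>])
    let ?w = "(\<phi> [^]\<^bsub>AutoGroup F\<^esub> (- i)) w"
    have conj: "g \<otimes>\<^bsub>?G\<^esub> h \<otimes>\<^bsub>?G\<^esub> inv\<^bsub>?G\<^esub> g = (m \<otimes>\<^bsub>F\<^esub> ?w \<otimes>\<^bsub>F\<^esub> inv\<^bsub>F\<^esub> m, 0)"
      unfolding gh by (rule semidirect_int_conj[OF F \<phi> m D.mem_carrier[OF w]])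
    have "\<Theta> (m \<otimes>\<^bsub>F\<^esub> ?w \<otimes>\<^bsub>F\<^esub> inv\<^bsub>F\<^esub> m) = \<Theta> ?w"
      using magnus_tensor_conj[OF D_pow[OF w] m[unfolded F_def] k] by (simp add: \<Theta>_def F_def)
    also have "\<dots> = (\<psi> [^]\<^bsub>AutoGroup M\<^esub> (- i)) (\<Theta> w)"
      by (rule \<Theta>_pow[OF w])
    finally have "\<theta> (g \<otimes>\<^bsub>?G\<^esub> h \<otimes>\<^bsub>?G\<^esub> inv\<^bsub>?G\<^esub> g) =
        (\<one>\<^bsub>M\<^esub>, i) \<otimes>\<^bsub>P\<^esub> \<theta> h \<otimes>\<^bsub>P\<^esub> inv\<^bsub>P\<^esub> (\<one>\<^bsub>M\<^esub>, i)"
      using semidirect_int_conj[OF M.is_group \<psi> M.one_closed \<Theta>_closed[of w]] auto_pow_closed[OF M.is_group \<psi> \<Theta>_closed]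
      unfolding conj unfolding gh P_def by (simp add: \<theta>_def)
    moreover have "m \<otimes>\<^bsub>F\<^esub> ?w \<otimes>\<^bsub>F\<^esub> inv\<^bsub>F\<^esub> m \<in> ?D"
      using D.inv_op_closed2[OF m D_pow[OF w]] .
    ultimately show "g \<otimes>\<^bsub>?G\<^esub> h \<otimes>\<^bsub>?G\<^esub> inv\<^bsub>?G\<^esub> g \<in> ?D \<times> {0} \<and> (\<exists>p\<in>carrier P.
        \<theta> (g \<otimes>\<^bsub>?G\<^esub> h \<otimes>\<^bsub>?G\<^esub> inv\<^bsub>?G\<^esub> g) = p \<otimes>\<^bsub>P\<^esub> \<theta> h \<otimes>\<^bsub>P\<^esub> inv\<^bsub>P\<^esub> p)"
      unfolding conj by (auto simp: P_def carrier_semidirect_int[OF M.is_group \<psi>] intro!: bexI[of _ "(\<one>\<^bsub>M\<^esub>, i)"])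
  qed
  also have "\<dots> \<subseteq> dimension_subgroup S (Suc k) \<times> {0}"
  proof
    fix h assume "h \<in> {h \<in> ?D \<times> {0}. \<theta> h = \<one>\<^bsub>P\<^esub>}"
    then obtain w where w: "h = (w, 0)" "w \<in> ?D" "\<Theta> w = \<one>\<^bsub>M\<^esub>"
      by (auto simp: \<theta>_def P_def one_semidirect_int[OF M.is_group \<psi>])
    have "R #>\<^bsub>Q\<^esub> magnus_tensor S k w = R"
      using w(3) by (simp add: \<Theta>_def M_def tensor_power_def FactGroup_def R_def)
    then have "magnus_tensor S k w \<in> R"
      by (rule Q.coset_join1[OF _ T R])
    then show "h \<in> dimension_subgroup S (Suc k) \<times> {0}"
      using dimension_subgroup_Suc[OF S w(2)] w(1) by (simp add: R_def A_def F_def)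
  qed
  finally show ?thesis .
qed

theorem theorem5p4:
  fixes n :: nat and \<phi> :: "nat letter list \<Rightarrow> nat letter list"
  assumes "\<phi> \<in> auto (free_group_of_rank n)"
    and "\<And>k. k \<ge> 1 \<Longrightarrow> residually_nilpotent
      (semidirect_int (tensor_power (abelianization (free_group_of_rank n)) k)
        (tensor_power_map (abelianization (free_group_of_rank n)) k
          (abelianization_map (free_group_of_rank n) \<phi>)))"
  shows "lower_central (semidirect_int (free_group_of_rank n) \<phi>) omega_squared =
      {\<one>\<^bsub>semidirect_int (free_group_of_rank n) \<phi>\<^esub>} \<and>
    (\<not> residually_nilpotent (semidirect_int (free_group_of_rank n) \<phi>) \<longrightarrow>
      lower_central_length (semidirect_int (free_group_of_rank n) \<phi>) = omega_squared)"
proof -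
  define S where "S = {..<n}"
  define F where "F = free_group S"
  define G where "G = semidirect_int F \<phi>"
  have S: "finite S" by (simp add: S_def)
  have F: "group F" and \<phi>: "\<phi> \<in> auto F"
    using assms(1) group_free_group by (simp_all add: F_def S_def)
  interpret F: group F by (rule F)
  interpret G: group G unfolding G_def by (rule group_semidirect_int[OF F \<phi>])
  have "\<one>\<^bsub>F\<^esub> = []"
    by (simp add: F_def free_group_def)
  then have G_one: "\<one>\<^bsub>G\<^esub> = ([], 0)"
    by (simp add: G_def one_semidirect_int[OF F \<phi>])
  have one_subset: "lower_central G \<alpha> = {\<one>\<^bsub>G\<^esub>}" if "lower_central G \<alpha> \<subseteq> {\<one>\<^bsub>G\<^esub>}" for \<alpha>
    using that subgroup.one_closed[OF G.lower_central_subgroup] by blast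
  have step: "lower_central G \<mu> \<subseteq> dimension_subgroup S (Suc k) \<times> {0}"
    if "k \<ge> 1" "1 \<le> \<alpha>" "lower_central G \<alpha> \<subseteq> dimension_subgroup S k \<times> {0}" "is_next_limit \<alpha> \<mu>" for k \<alpha> \<mu>
    using lower_central_descent_free_group[OF S \<phi>[unfolded F_def] that(1) _ that(2) _ that(4)] assms(2)[OF that(1)] that(3)
    by (simp add: G_def F_def S_def)
  obtain f :: "nat \<Rightarrow> ordinal" where f: "f 0 = 0" "\<And>a. is_next_limit (f a) (f (Suc a))"
      "\<And>\<beta>. \<beta> < omega_squared \<longleftrightarrow> (\<exists>a. \<beta> < f a)"
    using omega_squared_limits by metis
  have f_omega: "f (Suc 0) = omega"
    using f(2)[of 0] is_next_limit_omega is_next_limit_unique unfolding f(1) by blast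
  have f_less: "f a < f (Suc a)" for a
    using is_next_limit_less[OF f(2), of 0] by simp
  then have f_less_sq: "f a < omega_squared" for a
    using f(3) by blast
  have f_mono: "f a \<le> f b" if "a \<le> b" for a b
    by (rule lift_Suc_mono_le[of f, OF less_imp_le[OF f_less] that])
  have f_ge: "1 \<le> f (Suc a)" for a
    using is_next_limit_less[OF f(2), of 1 a] one_le_osucc[of "f a"] by simp
  \<comment> \<open>The first block starts at index 2, where the series has entered the base, which
    is D_1.\<close>
  have "lower_central G omega \<subseteq> dimension_subgroup S (Suc 1) \<times> {0}"
  proof (rule step)
    show "lower_central G (osucc 1) \<subseteq> dimension_subgroup S 1 \<times> {0}"
      using lower_central_2_semidirect_int[OF F \<phi>] by (simp add: G_def F_def dimension_subgroup_1[simplified])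
    show "is_next_limit (osucc 1) omega"
      unfolding one_ordinal_def by (intro is_next_limit_osucc is_next_limit_omega)
  qed (simp_all add: one_le_osucc)
  then have omega: "lower_central G omega \<subseteq> dimension_subgroup S 2 \<times> {0}"
    by (simp add: numeral_2_eq_2)
  have descend: "lower_central G (f (Suc a)) \<subseteq> dimension_subgroup S (Suc (Suc a)) \<times> {0}" for a
  proof (induction a)
    case 0
    then show ?case using omega by (simp add: f_omega numeral_2_eq_2)
  next
    case (Suc a)
    then show ?case by (intro step[OF _ f_ge _ f(2)]) simp_all
  qed
  have trivial: "lower_central G omega_squared = {\<one>\<^bsub>G\<^esub>}"
  proof (rule one_subset, rule subsetI)
    fix x assume x: "x \<in> lower_central G omega_squared"
    have *: "x \<in> dimension_subgroup S (Suc (Suc a)) \<times> {0}" for a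
      using x descend G.lower_central_antimono[OF less_imp_le[OF f_less_sq[of "Suc a"]]] by blast
    then obtain w where w: "x = (w, 0)" by blast
    \<comment> \<open>Membership in D_{k+2} implies membership in D_k, so the shift by two is
      harmless.\<close>
    have "w \<in> dimension_subgroup S k" for k
      using *[of k] unfolding w by (simp add: dimension_subgroup_def)
    then have "w = []"
      using dimension_subgroup_Inter[of S] by blast
    then show "x \<in> {\<one>\<^bsub>G\<^esub>}" by (simp add: w G_one)
  qed
  moreover have "lower_central_length G = omega_squared" if nrn: "\<not> residually_nilpotent G"
  proof -
    have not_one: "lower_central G omega \<noteq> {\<one>\<^bsub>G\<^esub>}"
      using nrn by (simp add: residually_nilpotent_def)
    \<comment> \<open>Otherwise D_2 is trivial, and so is the term at \<omega>, which it
      contains.\<close>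
    have "n \<ge> 2"
    proof (rule ccontr)
      assume "\<not> n \<ge> 2"
      then have "S \<subseteq> {0}" by (auto simp: S_def)
      then show False
        using omega one_subset[of omega] not_one by (simp add: dimension_subgroup_2_trivial G_one)
    qed
    then have S01: "0 \<in> S" "1 \<in> S" by (simp_all add: S_def)
    have nontrivial: "lower_central G (f (Suc a)) \<noteq> {\<one>\<^bsub>G\<^esub>}" for a
    proof (induction a)
      case 0
      then show ?case using not_one by (simp add: f_omega)
    next
      case (Suc a)
      define K where "K = lower_central G (f (Suc a))"
      interpret K: normal K G unfolding K_def by (rule G.lower_central_normal)
      obtain x where x: "x \<in> K" "x \<noteq> \<one>\<^bsub>G\<^esub>"
        using Suc K.one_closed unfolding K_def by blast
      then obtain g where g: "x = (g, 0)" "g \<in> carrier F"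
        using descend[of a] unfolding K_def F_def dimension_subgroup_def by blast
      have "g \<noteq> []" using g x by (simp add: G_one)
      obtain p q where pq: "p \<in> carrier F" "q \<in> carrier F"
        and ne: "(p \<otimes>\<^bsub>F\<^esub> g \<otimes>\<^bsub>F\<^esub> inv\<^bsub>F\<^esub> p) \<otimes>\<^bsub>F\<^esub> (q \<otimes>\<^bsub>F\<^esub> g \<otimes>\<^bsub>F\<^esub> inv\<^bsub>F\<^esub> q) \<noteq>
          (q \<otimes>\<^bsub>F\<^esub> g \<otimes>\<^bsub>F\<^esub> inv\<^bsub>F\<^esub> q) \<otimes>\<^bsub>F\<^esub> (p \<otimes>\<^bsub>F\<^esub> g \<otimes>\<^bsub>F\<^esub> inv\<^bsub>F\<^esub> p)"
        using free_group_conjugates_not_commuting[OF S01 _ g(2)[unfolded F_def] \<open>g \<noteq> []\<close>] unfolding F_def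
        by (metis zero_neq_one)
      have conj: "(r \<otimes>\<^bsub>F\<^esub> g \<otimes>\<^bsub>F\<^esub> inv\<^bsub>F\<^esub> r, 0) \<in> K" if "r \<in> carrier F" for r
        using K.inv_op_closed2[OF _ x(1), of "(r, 0)"] semidirect_int_conj[OF F \<phi> that g(2), of 0] that g
        by (simp add: G_def carrier_semidirect_int[OF F \<phi>] one_AutoGroup)
      define u v where "u = (p \<otimes>\<^bsub>F\<^esub> g \<otimes>\<^bsub>F\<^esub> inv\<^bsub>F\<^esub> p, 0 :: int)" and "v = (q \<otimes>\<^bsub>F\<^esub> g \<otimes>\<^bsub>F\<^esub> inv\<^bsub>F\<^esub> q, 0 :: int)"
      have uv: "u \<in> K" "v \<in> K" "u \<in> carrier G" "v \<in> carrier G"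
        using conj pq K.mem_carrier unfolding u_def v_def by blast+
      have "u \<otimes>\<^bsub>G\<^esub> v \<noteq> v \<otimes>\<^bsub>G\<^esub> u"
        using ne pq g unfolding u_def v_def G_def by (simp add: semidirect_int_mult_base[OF F \<phi>])
      moreover have "u \<otimes>\<^bsub>G\<^esub> v = v \<otimes>\<^bsub>G\<^esub> u" if "u \<otimes>\<^bsub>G\<^esub> v \<otimes>\<^bsub>G\<^esub> inv\<^bsub>G\<^esub> u \<otimes>\<^bsub>G\<^esub> inv\<^bsub>G\<^esub> v = \<one>\<^bsub>G\<^esub>"
      proof -
        have "(u \<otimes>\<^bsub>G\<^esub> v \<otimes>\<^bsub>G\<^esub> inv\<^bsub>G\<^esub> u \<otimes>\<^bsub>G\<^esub> inv\<^bsub>G\<^esub> v) \<otimes>\<^bsub>G\<^esub> (v \<otimes>\<^bsub>G\<^esub> u) = u \<otimes>\<^bsub>G\<^esub> v"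
          using uv(3,4) by (simp add: G.m_assoc)
        then show ?thesis using that uv(3,4) by simp
      qed
      \<comment> \<open>Since v lies in K, it lies in every finite term. The commutator rule
        therefore puts [u, v] beyond each finite number of steps after K, that is, into the term at
        the next limit.\<close>
      moreover have "u \<otimes>\<^bsub>G\<^esub> v \<otimes>\<^bsub>G\<^esub> inv\<^bsub>G\<^esub> u \<otimes>\<^bsub>G\<^esub> inv\<^bsub>G\<^esub> v \<in> lower_central G (f (Suc (Suc a)))"
        unfolding G.lower_central_next_limit[OF f_ge f(2)]
      proof
        fix j
        have "is_next_limit 1 omega"
          unfolding one_ordinal_def by (intro is_next_limit_osucc is_next_limit_omega)
        then have "(osucc ^^ j) 1 \<le> f (Suc a)"
          using is_next_limit_less[of 1 omega j] f_mono[of "Suc 0" "Suc a"] by (simp add: f_omega)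
        then have "v \<in> lower_central G ((osucc ^^ j) 1)"
          using uv(2) G.lower_central_antimono unfolding K_def by blast
        then have "u \<otimes>\<^bsub>G\<^esub> v \<otimes>\<^bsub>G\<^esub> inv\<^bsub>G\<^esub> u \<otimes>\<^bsub>G\<^esub> inv\<^bsub>G\<^esub> v \<in> lower_central G ((osucc ^^ Suc j) (f (Suc a)))"
          using uv(1) unfolding K_def by (intro G.commutator_lower_central[OF f_ge])
        moreover have "(osucc ^^ j) (f (Suc a)) \<le> (osucc ^^ Suc j) (f (Suc a))"
          by (simp add: less_imp_le[OF less_osucc])
        ultimately show "u \<otimes>\<^bsub>G\<^esub> v \<otimes>\<^bsub>G\<^esub> inv\<^bsub>G\<^esub> u \<otimes>\<^bsub>G\<^esub> inv\<^bsub>G\<^esub> v \<in> lower_central G ((osucc ^^ j) (f (Suc a)))"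
          using G.lower_central_antimono by blast
      qed
      ultimately show ?case by auto
    qed
    show ?thesis
      unfolding lower_central_length_def
    proof (rule Least_equality)
      have "lower_central G (osucc omega_squared) = {\<one>\<^bsub>G\<^esub>}"
        using one_subset G.lower_central_antimono[OF less_imp_le[OF less_osucc]] trivial by blast
      moreover have "1 \<le> omega_squared"
        using f_ge[of 0] f_less_sq[of "Suc 0"] by simp
      ultimately show "1 \<le> omega_squared \<and> lower_central G omega_squared = lower_central G (osucc omega_squared)"
        using trivial by simp
    next
      fix \<alpha> assume \<alpha>: "1 \<le> \<alpha> \<and> lower_central G \<alpha> = lower_central G (osucc \<alpha>)"
      show "omega_squared \<le> \<alpha>"
      proof (rule ccontr)
        assume "\<not> omega_squared \<le> \<alpha>"
        then have less: "\<alpha> < omega_squared" by simp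
        \<comment> \<open>A stationary value below \<open>omega_squared\<close> persists up to there
          and is trivial, whereas some later \<open>f (Suc a)\<close> still has a nontrivial
          term.\<close>
        then have "lower_central G \<alpha> = {\<one>\<^bsub>G\<^esub>}"
          using G.lower_central_stationary[of \<alpha> omega_squared] \<alpha> trivial by simp
        moreover obtain a where "\<alpha> < f a" using less f(3) by blast
        then have "\<alpha> \<le> f (Suc a)" using f_less[of a] by simp
        ultimately show False
          using G.lower_central_antimono[of \<alpha> "f (Suc a)"] one_subset[of "f (Suc a)"] nontrivial[of a] by simp
      qed
    qed
  qed
  ultimately show ?thesis
    unfolding G_def F_def S_def by blast
qed

end
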